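(* Let $n\ge1$, $0<q\le1$, $t>0$, and let $\mathbf{T}_n(q,t)$ be the set of $(x_1,\dots,x_n)\in\mathbb{R}^n$ with $x_n\ge 1-q$ and $q x_i\le q(1+t)x_{i-1}-t(1-q)(1-x_{j-1})$ for all $1\le j\le i\le n$, where $x_0:=1$. For a labeled forest $F$ on $\{1,\dots,n+1\}$ and each label $k$ define $c(k,F;q,t)$: if the node with label $k$ is a root with NFS position $l$, $c(k,F;q,t)=t(x_l-1+q)$; otherwise $$c(k,F;q,t)=\frac{q x_i-(1-q)(1-x_l)}{(1+t)^j}-(x_l-1+q),$$ where $i$ is its NFS position, $j$ the number of cane paths of $F$ starting at it, and $l$ the NFS position of the root of its component (always $x_0:=1$). Let $$\mathbf{S}_F(q,t)=\{(x_1,\dots,x_n):0\le c(1,F;q,t)\le c(2,F;q,t)\le\dots\le c(n+1,F;q,t)=qt\}.$$ Then $\mathbf{S}_F(q,t)$ is a simplex and $$n!\operatorname{vol}\mathbf{S}_F(q,t)=\sum_{G:\ \Phi(G)=F}q^{k(G)-1}t^{|E(G)|}=q^{k(F)-1}t^{|E(F)|}(1+t)^{\alpha(F)},$$ the sum over labeled graphs $G$ on $\{1,\dots,n+1\}$. Furthermore, the simplices $\mathbf{S}_F(q,t)$, $F$ ranging over labeled forests on $\{1,\dots,n+1\}$, form a triangulation of $\mathbf{T}_n(q,t)$; in particular $$n!\operatorname{vol}\mathbf{T}_n(q,t)=\sum_G q^{k(G)-1}t^{|E(G)|}=\mathrm{Z}_{K_{n+1}}(q,t).$$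
   Context: $k(G)$ is the number of connected components and $E(G)$ the edge set. For a graph $G$, $\mathrm{Z}_G(q,t)=\sum_{H}q^{k(H)-k(G)}t^{e(H)}$ over all spanning subgraphs $H$ of $G$ ($e(H)$ = number of edges); $K_{n+1}$ is the complete graph on $\{1,\dots,n+1\}$. Labeled forest conventions: each component is rooted at its node of largest label, children are ordered left to right by increasing label, components left to right by decreasing largest label. NFS positions in a forest on $n+1$ nodes: components processed left to right; when a component is begun its root gets the next unused position (starting from $0$); within a component the root is initially active, the children of the active node receive the next consecutive positions from right to left and then the leftmost child becomes active; if the active node has no children, the most recently positioned node not yet active becomes active. Cane path: a path $v_0,\dots,v_k$ ($k\ge2$) whose first $k-1$ steps go from a node to its parent and whose last step goes from $v_{k-1}$ to a child of $v_{k-1}$ to the right of $v_{k-2}$; $\alpha(F)$ is the number of cane paths of $F$. NFS of a labeled graph $G$ on $\{1,\dots,n+1\}$: components processed in order of decreasing maximal label; in a component, its node of maximal label is visited first and made active; at each step the unvisited neighbours of the active node are visited in decreasing order of label, each joined to the active node by a search edge, and the one of smallest label becomes active; if the active node has no unvisited neighbours, the most recently visited node not yet active becomes active. $\Phi(G)$ is the labeled spanning forest of search edges. A triangulation of a polytope $P\subset\mathbb{R}^n$ is a set of $n$-simplices with union $P$ and pairwise disjoint interiors. *)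

theory Defs
  imports "HOL-Analysis.Analysis" "HOL-Library.Ramsey"
begin

section \<open>Labeled graphs and forests\<close>

text \<open>A labeled graph on the nodes 1, ..., N is represented by its set of edges, which are two-element
  sets of nodes. Since isolated nodes are not visible in the edge set, N is a separate parameter
  wherever the node set matters. The spanning subgraphs of a graph are the subsets of its edge set.\<close>

type_synonym edge_set = "nat set set"

definition complete_graph :: "nat \<Rightarrow> edge_set" where
  "complete_graph N = nsets {1..N} 2"

definition labeled_graphs :: "nat \<Rightarrow> edge_set set" where
  "labeled_graphs N = Pow (complete_graph N)"

definition neighbours :: "edge_set \<Rightarrow> nat \<Rightarrow> nat set" where
  "neighbours E v = {u. {v, u} \<in> E}"

definition component :: "edge_set \<Rightarrow> nat \<Rightarrow> nat set" where
  "component E v = {u. (v, u) \<in> {(a, b). {a, b} \<in> E}\<^sup>*}"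

definition components :: "nat \<Rightarrow> edge_set \<Rightarrow> nat set set" where
  "components N E = component E ` {1..N}"

definition num_components :: "nat \<Rightarrow> edge_set \<Rightarrow> nat" where
  "num_components N E = card (components N E)"

definition is_path :: "edge_set \<Rightarrow> nat list \<Rightarrow> bool" where
  "is_path E p \<longleftrightarrow> p \<noteq> [] \<and> distinct p \<and> successively (\<lambda>u v. {u, v} \<in> E) p"

definition is_cycle :: "edge_set \<Rightarrow> nat list \<Rightarrow> bool" where
  "is_cycle E p \<longleftrightarrow> is_path E p \<and> length p \<ge> 3 \<and> {last p, hd p} \<in> E"

definition labeled_forests :: "nat \<Rightarrow> edge_set set" where
  "labeled_forests N = {F \<in> labeled_graphs N. \<nexists>p. is_cycle F p}"

text \<open>The exponent is a truncated subtraction on natural numbers, which is harmless: a spanning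
  subgraph of \<open>G\<close> has at least as many components as \<open>G\<close>.\<close>

definition Z_poly :: "nat \<Rightarrow> edge_set \<Rightarrow> real \<Rightarrow> real \<Rightarrow> real" where
  "Z_poly N G q t = (\<Sum>H\<in>Pow G. q ^ (num_components N H - num_components N G) * t ^ card H)"

definition root_of :: "edge_set \<Rightarrow> nat \<Rightarrow> nat" where
  "root_of E v = Max (component E v)"

text \<open>In a forest, the parent of \<open>v\<close> is the second node on the path from \<open>v\<close> to the root of its
  component.\<close>

definition is_parent :: "edge_set \<Rightarrow> nat \<Rightarrow> nat \<Rightarrow> bool" where
  "is_parent F p v \<longleftrightarrow> (\<exists>ps. is_path F (v # p # ps) \<and> last (p # ps) = root_of F v)"

definition children :: "edge_set \<Rightarrow> nat \<Rightarrow> nat set" where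
  "children F v = {u. is_parent F v u}"

text \<open>Children are ordered left to right by increasing label, so ``to the right of'' means
  ``has a larger label than''. The list \<open>p\<close> is \<open>v\<^sub>0, ..., v\<^sub>k\<close> with \<open>k = length p - 1\<close>.\<close>

definition is_cane_path :: "edge_set \<Rightarrow> nat list \<Rightarrow> bool" where
  "is_cane_path F p \<longleftrightarrow> length p \<ge> 3 \<and>
     (let k = length p - 1 in
        (\<forall>i < k - 1. is_parent F (p ! (i + 1)) (p ! i)) \<and>
        is_parent F (p ! (k - 1)) (p ! k) \<and>
        p ! (k - 2) < p ! k)"

definition num_cane_paths :: "edge_set \<Rightarrow> nat" where
  "num_cane_paths F = card {p. is_cane_path F p}"

definition num_cane_paths_from :: "edge_set \<Rightarrow> nat \<Rightarrow> nat" where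
  "num_cane_paths_from F v = card {p. is_cane_path F p \<and> hd p = v}"


section \<open>Neighbors-first search\<close>

text \<open>A state \<open>(vs, as, T)\<close> of the search inside one component consists of the list \<open>vs\<close> of visited
  nodes in the order of their visit, the nonempty list \<open>as\<close> of all nodes activated so far with the
  currently active node at its head, and the set \<open>T\<close> of search edges. The argument \<open>new a X\<close> is the
  set of nodes that are visited when \<open>a\<close> is active and \<open>X\<close> is the set of visited nodes. They are
  visited in decreasing order of label, hence the last of them has the smallest label.\<close>

type_synonym nfs_state = "nat list \<times> nat list \<times> edge_set"

definition nfs_step :: "(nat \<Rightarrow> nat set \<Rightarrow> nat set) \<Rightarrow> nfs_state \<Rightarrow> nfs_state" where
  "nfs_step new = (\<lambda>(vs, as, T).
     let a = hd as;
         us = rev (sorted_list_of_set (new a (set vs)));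
         vs' = vs @ us;
         T' = T \<union> {{a, u} | u. u \<in> set us};
         ws = filter (\<lambda>v. v \<notin> set as) vs';
         as' = (if us \<noteq> [] then last us # as
                else if ws \<noteq> [] then last ws # as
                else as)
     in (vs', as', T'))"

text \<open>Every step activates a further node until the component is exhausted, and then the state does
  not change any more. So \<open>N\<close> steps suffice for a component with at most \<open>N\<close> nodes.\<close>

definition nfs_component :: "(nat \<Rightarrow> nat set \<Rightarrow> nat set) \<Rightarrow> nat \<Rightarrow> nat \<Rightarrow> nfs_state" where
  "nfs_component new N r = (nfs_step new ^^ N) ([r], [r], {})"

definition roots :: "nat \<Rightarrow> edge_set \<Rightarrow> nat list" where
  "roots N E = rev (sorted_list_of_set (Max ` components N E))"

text \<open>The labeled forest \<open>\<Phi>(G)\<close> of search edges.\<close>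

definition search_forest :: "nat \<Rightarrow> edge_set \<Rightarrow> edge_set" where
  "search_forest N G =
     (\<Union>r\<in>set (roots N G). snd (snd (nfs_component (\<lambda>a X. neighbours G a - X) N r)))"

definition nfs_order :: "nat \<Rightarrow> edge_set \<Rightarrow> nat list" where
  "nfs_order N F = concat (map (\<lambda>r. fst (nfs_component (\<lambda>a X. children F a) N r)) (roots N F))"

definition nfs_pos :: "nat \<Rightarrow> edge_set \<Rightarrow> nat \<Rightarrow> nat" where
  "nfs_pos N F v = length (takeWhile (\<lambda>u. u \<noteq> v) (nfs_order N F))"


section \<open>The polytope and the simplices\<close>

text \<open>Points of n-dimensional space are vectors \<open>x :: real ^ 'n\<close>, with the coordinates enumerated
  by a bijection \<open>e\<close> from 1, ..., n to the index type. \<open>coord e x i\<close> is \<open>x\<^sub>i\<close>, including the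
  convention that the 0-th coordinate is 1.\<close>

definition coord :: "(nat \<Rightarrow> 'n) \<Rightarrow> real ^ 'n \<Rightarrow> nat \<Rightarrow> real" where
  "coord e x i = (if i = 0 then 1 else x $ e i)"

definition tutte_polytope :: "nat \<Rightarrow> (nat \<Rightarrow> 'n) \<Rightarrow> real \<Rightarrow> real \<Rightarrow> (real ^ 'n) set" where
  "tutte_polytope n e q t =
     {x. coord e x n \<ge> 1 - q \<and>
         (\<forall>i j. 1 \<le> j \<and> j \<le> i \<and> i \<le> n \<longrightarrow>
            q * coord e x i
              \<le> q * (1 + t) * coord e x (i - 1) - t * (1 - q) * (1 - coord e x (j - 1)))}"

definition c_value ::
  "nat \<Rightarrow> (nat \<Rightarrow> 'n) \<Rightarrow> edge_set \<Rightarrow> real \<Rightarrow> real \<Rightarrow> real ^ 'n \<Rightarrow> nat \<Rightarrow> real" where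
  "c_value n e F q t x k =
     (let r = root_of F k;
          l = nfs_pos (n + 1) F r;
          i = nfs_pos (n + 1) F k;
          j = num_cane_paths_from F k
      in if k = r then t * (coord e x l - 1 + q)
         else (q * coord e x i - (1 - q) * (1 - coord e x l)) / (1 + t) ^ j
                - (coord e x l - 1 + q))"

definition forest_simplex ::
  "nat \<Rightarrow> (nat \<Rightarrow> 'n) \<Rightarrow> edge_set \<Rightarrow> real \<Rightarrow> real \<Rightarrow> (real ^ 'n) set" where
  "forest_simplex n e F q t =
     {x. 0 \<le> c_value n e F q t x 1 \<and>
         (\<forall>k\<in>{1..n}. c_value n e F q t x k \<le> c_value n e F q t x (k + 1)) \<and>
         c_value n e F q t x (n + 1) = q * t}"

text \<open>The simplices of a triangulation are only required to have disjoint interiors; unlike in the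
  library notion \<^const>\<open>triangulation\<close>, they need not meet in common faces.\<close>

definition triangulates :: "'a::euclidean_space set set \<Rightarrow> 'a set \<Rightarrow> bool" where
  "triangulates \<T> P \<longleftrightarrow> polytope P \<and>
     (\<forall>S\<in>\<T>. int DIM('a) simplex S) \<and> \<Union>\<T> = P \<and>
     pairwise (\<lambda>S S'. interior S \<inter> interior S' = {}) \<T>"

end

(* A search state consists of the unvisited nodes and the stack of visited nodes that have not been
   active. Recording for each node in the order of its visit its label v and its height h (0 for
   roots, one more than the size of the stack below it otherwise) encodes labeled forests by the
   pairs (v, h) with h 0 = 0 and h (p + 1) <= h p + 1, where v decreases at every ascent of h and
   every root has a larger label than all later nodes. The stack below a node consists of the end
   points of its cane paths, and these are the nodes to which a graph with the given search forest
   may have additional edges; this gives the factor (1 + t)^alpha.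

   With z_i = x_i - 1 + q, a node at position p whose root is at position l has
   c = (q z_p + (1 - q) z_l) / (1 + t)^(h p - 1) - z_l, and 0 <= c <= t z_l says that
   (q z_p + (1 - q) z_l) / z_l lies between (1 + t)^(h p - 1) and (1 + t)^(h p). So the heights can be
   read off from a point of the polytope, and the labels from the order of the c-values. In the
   coordinates c, which depend on z through a triangular matrix, the simplex of a forest is an order
   simplex, which determines its volume. *)

theory Submission
  imports Defs
begin

section \<open>Neighbors-first search as a stack machine\<close>

text \<open>Powers of \<open>1 + t\<close> enter as follows. Put Y p = q z_p + (1 - q) z_l with l
  the position of the current root. The polytope inequality with last term z_l reads q z_(p+1) + (1
  - q) z_l \<le> (1 + t) Y p. Root values never increase and bound the other values of their
  component from below, so z_l is the smallest value up to p and this inequality is the strongest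
  one at p. It lets Y grow by at most a factor 1 + t, whence h (p + 1) \<le> h p + 1.

  The definitions describe parents and cane paths by paths in the graph and the search by iterated
  list steps. Neither form carries an induction along the search, so all of it is derived from one
  recursive function \<open>nfs_trace\<close> on states. A step of it sees only the edges from the
  active node to unvisited nodes; hence the search of a graph, of its search forest and of a graph
  built from a code can be compared.

  Strict inequalities in the interior of a simplex recover the coding, and weak ones with a rule for
  ties yield a coding for every point; disjointness and covering are thus statements about
  codings.\<close>

definition desc :: "nat set \<Rightarrow> nat list" where
  "desc A = rev (sorted_list_of_set A)"

lemma desc_simps [simp]:
  "finite A \<Longrightarrow> set (desc A) = A" "distinct (desc A)" "length (desc A) = card A" "desc {} = []"
  by (simp_all add: desc_def)

lemma sorted_desc: "sorted_wrt (>) (desc A)"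
proof -
  have "sorted_wrt (<) (sorted_list_of_set A)" by simp
  thus ?thesis unfolding desc_def by (simp add: sorted_wrt_rev)
qed

lemma desc_unique: "sorted_wrt (>) us \<Longrightarrow> desc (set us) = us"
proof -
  assume a: "sorted_wrt (>) us"
  hence "sorted_wrt (<) (rev us)" by (simp add: sorted_wrt_rev)
  hence "sorted_list_of_set (set (rev us)) = rev us"
    by (intro sorted_list_of_set.idem_if_sorted_distinct) (auto simp: strict_sorted_iff)
  thus ?thesis by (simp add: desc_def)
qed

text \<open>An entry consists of a node, its height and its parent; a root is its own parent.\<close>

type_synonym nfs_entry = "nat \<times> nat \<times> nat"

text \<open>The stack grows by one with each sibling that is pushed, so the heights of a list of
  siblings are consecutive; \<open>h\<close> is the height of the first one.\<close>

fun child_entries :: "nat \<Rightarrow> nat \<Rightarrow> nat list \<Rightarrow> nfs_entry list" where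
  "child_entries a h [] = []"
| "child_entries a h (u # us) = (u, h, a) # child_entries a (Suc h) us"

text \<open>An empty stack \<open>S\<close> means that a component is exhausted, and the largest
  unvisited label opens the next one. The active node is popped and its new neighbours are pushed so
  that the smallest ends on top. \<open>length S\<close> still counts the active node, which makes
  it one more than the size of the stack under the first child. For infinite \<open>U\<close> the
  empty list is a default value.\<close>

function nfs_trace :: "edge_set \<Rightarrow> nat set \<Rightarrow> nat list \<Rightarrow> nfs_entry list" where
  "nfs_trace G U S = (if infinite U then [] else
     (case S of
        [] \<Rightarrow> if U = {} then [] else (Max U, 0, Max U) # nfs_trace G (U - {Max U}) [Max U]
      | a # S' \<Rightarrow> let D = neighbours G a \<inter> U in
          child_entries a (length S) (desc D) @ nfs_trace G (U - D) (rev (desc D) @ S')))"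
  by auto
termination
\<comment> \<open>An unvisited node weighs 2 and a node on the stack 1, so visiting a node and
  popping the active one both lower the weight.\<close>
proof (relation "Wellfounded.measure (\<lambda>(G, U, S). 2 * card U + length S)", goal_cases)
  case 1 show ?case by simp
next
  case (2 G U S)
  hence "0 < card U" by (simp add: card_gt_0_iff)
  moreover from 2 have "card (U - {Max U}) = card U - 1" by simp
  ultimately show ?case using 2 by simp
next
  case (3 G U S a S' D)
  hence "card (U - D) + card D = card U"
    by (metis card_Diff_subset card_mono finite_Int inf_le2 le_add_diff_inverse2)
  then show ?case using 3 by simp
qed

declare nfs_trace.simps [simp del]

lemma trace_empty [simp]: "nfs_trace G {} [] = []"
  by (subst nfs_trace.simps) simp

lemma trace_root: "finite U \<Longrightarrow> U \<noteq> {} \<Longrightarrow>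
    nfs_trace G U [] = (Max U, 0, Max U) # nfs_trace G (U - {Max U}) [Max U]"
  by (subst nfs_trace.simps) simp

lemma trace_active: "finite U \<Longrightarrow>
    nfs_trace G U (a # S) = child_entries a (Suc (length S)) (desc (neighbours G a \<inter> U))
      @ nfs_trace G (U - neighbours G a) (rev (desc (neighbours G a \<inter> U)) @ S)"
  by (subst nfs_trace.simps) (simp add: Let_def Diff_Int)

definition nfs_state :: "nat set \<Rightarrow> nat list \<Rightarrow> bool" where
  "nfs_state U S \<longleftrightarrow> finite U \<and> distinct S \<and> set S \<inter> U = {}"

lemma nfs_state_root: "nfs_state U [] \<Longrightarrow> nfs_state (U - {r}) [r]"
  by (simp add: nfs_state_def)

lemma nfs_state_active:
  "nfs_state U (a # S) \<Longrightarrow> nfs_state (U - neighbours G a) (rev (desc (neighbours G a \<inter> U)) @ S)"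
  by (auto simp: nfs_state_def)

text \<open>The recursion of \<open>nfs_trace\<close> restricted to legal states: carrying
  \<open>nfs_state\<close> along removes the default case for infinite sets, and the successor
  states have the shape of \<open>trace_root\<close> and \<open>trace_active\<close>.\<close>

lemma nfs_state_induct [consumes 1, case_names empty root active]:
  assumes "nfs_state U S"
    and "P {} []"
    and "\<And>U. nfs_state U [] \<Longrightarrow> U \<noteq> {} \<Longrightarrow> Max U \<in> U \<Longrightarrow> P (U - {Max U}) [Max U] \<Longrightarrow> P U []"
    and "\<And>U a S. nfs_state U (a # S) \<Longrightarrow>
          P (U - neighbours G a) (rev (desc (neighbours G a \<inter> U)) @ S) \<Longrightarrow> P U (a # S)"
  shows "P U S"
  using assms(1)
proof (induction "2 * card U + length S" arbitrary: U S rule: less_induct)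
  case less
  hence fin: "finite U" by (simp add: nfs_state_def)
  show ?case
  proof (cases S)
    case Nil
    show ?thesis
    proof (cases "U = {}")
      case False
      hence "0 < card U" using fin by (simp add: card_gt_0_iff)
      moreover have m: "Max U \<in> U" using fin False by simp
      ultimately have "2 * card (U - {Max U}) + length [Max U] < 2 * card U + length S"
        using Nil by simp
      then show ?thesis
        using less(1) nfs_state_root less(2) assms(3) Nil False m by blast
    qed (use assms(2) Nil in simp)
  next
    case (Cons a S')
    have "card (U - neighbours G a) + card (neighbours G a \<inter> U) = card U"
      using fin by (metis Int_commute card_Diff_subset_Int card_mono finite_Int inf_le1 le_add_diff_inverse2)
    then have "2 * card (U - neighbours G a) + length (rev (desc (neighbours G a \<inter> U)) @ S')
        < 2 * card U + length S" using Cons by simp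
    then show ?thesis
      using less(1) nfs_state_active less(2) assms(4) Cons by blast
  qed
qed

lemma child_entries_fst [simp]: "map fst (child_entries a h us) = us"
  by (induction us arbitrary: h) auto

lemma child_entries_fst_image [simp]: "fst ` set (child_entries a h us) = set us"
  by (metis child_entries_fst set_map)

lemma length_child_entries [simp]: "length (child_entries a h us) = length us"
  by (induction us arbitrary: h) auto

lemma child_entries_eq_Nil [simp]: "child_entries a h us = [] \<longleftrightarrow> us = []"
  by (cases us) auto

lemma nth_child_entries: "i < length us \<Longrightarrow> child_entries a h us ! i = (us ! i, h + i, a)"
  by (induction us arbitrary: h i) (auto simp: nth_Cons')

lemma mem_child_entries:
  "(v, k, b) \<in> set (child_entries a h us) \<longleftrightarrow>
     b = a \<and> h \<le> k \<and> k < h + length us \<and> us ! (k - h) = v"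
proof
  assume "(v, k, b) \<in> set (child_entries a h us)"
  then show "b = a \<and> h \<le> k \<and> k < h + length us \<and> us ! (k - h) = v"
    by (auto simp: in_set_conv_nth nth_child_entries)
next
  assume *: "b = a \<and> h \<le> k \<and> k < h + length us \<and> us ! (k - h) = v"
  then have "child_entries a h us ! (k - h) \<in> set (child_entries a h us)"
    by (intro nth_mem) auto
  with * show "(v, k, b) \<in> set (child_entries a h us)" by (auto simp: nth_child_entries)
qed

lemma trace_nodes: 
  assumes "nfs_state U S"
  shows "fst ` set (nfs_trace G U S) = U" "distinct (map fst (nfs_trace G U S))"
  using assms
proof (induction rule: nfs_state_induct[where G = G])
  case (active U a S)
  { case 1 then show ?case using active
    by (auto simp: trace_active nfs_state_def image_Un) }
  { case 2 then show ?case using active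
    by (auto simp: trace_active nfs_state_def image_Un) }
next
  case (root U)
  { case 1 then show ?case using root
    by (simp add: trace_root nfs_state_def insert_absorb) }
  { case 2 then show ?case using root
    by (auto simp: trace_root nfs_state_def) }
qed auto

definition entry_step :: "nfs_entry \<Rightarrow> nfs_entry \<Rightarrow> bool" where
  "entry_step = (\<lambda>(v, h, a) (v', h', a'). h' \<le> Suc h \<and> (h' = Suc h \<longrightarrow> v' < v))"

lemma successively_child_entries:
  assumes "sorted_wrt (>) us"
  shows "successively entry_step (child_entries a h us)"
  using assms
  by (induction us arbitrary: h rule: induct_list012) (auto simp: entry_step_def)

lemma last_child_entries: 
  "us \<noteq> [] \<Longrightarrow> last (child_entries a h us) = (last us, h + length us - 1, a)"
  by (induction us arbitrary: h) auto

text \<open>The bound on the first height serves the joint between the children of the active node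
  and the rest of the trace: the last child has the height of the whole new stack, and the next
  entry is at most that high, so no ascent occurs there.\<close>

lemma trace_successively:
  assumes "nfs_state U S"
  shows "successively entry_step (nfs_trace G U S)"
    "nfs_trace G U S \<noteq> [] \<Longrightarrow> fst (snd (hd (nfs_trace G U S))) \<le> length S"
  using assms
proof (induction rule: nfs_state_induct[where G = G])
  case (root U)
  hence fin: "finite U" by (simp add: nfs_state_def)
  { case 1
    let ?T = "nfs_trace G (U - {Max U}) [Max U]"
    have "entry_step (Max U, 0, Max U) (hd ?T)" if "?T \<noteq> []"
    proof -
      have "fst (hd ?T) \<in> fst ` set ?T" using that by (intro imageI hd_in_set)
      hence "fst (hd ?T) \<in> U - {Max U}" using trace_nodes(1)[OF nfs_state_root[OF root(1)]] by blast
      hence "fst (hd ?T) < Max U" using fin by (auto simp: less_le)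
      thus ?thesis using root(5)[OF that] by (cases "hd ?T") (auto simp: entry_step_def)
    qed
    then show ?case using root(4) fin root(2) by (auto simp: trace_root successively_Cons)
  next
    case 2
    then show ?case using root fin by (simp add: trace_root)
  }
next
  case (active U a S)
  hence fin: "finite U" by (simp add: nfs_state_def)
  let ?D = "neighbours G a \<inter> U"
  let ?T = "nfs_trace G (U - neighbours G a) (rev (desc ?D) @ S)"
  let ?C = "child_entries a (Suc (length S)) (desc ?D)"
  have hd: "fst (snd (hd ?T)) \<le> card ?D + length S" if "?T \<noteq> []" using active(3) that by simp
  { case 1
    have "entry_step (last ?C) (hd ?T)" if "?T \<noteq> []" "?C \<noteq> []"
      using hd[OF that(1)] that(2)
      by (cases "hd ?T") (auto simp: entry_step_def last_child_entries)
    then show ?case using active(2) fin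
      by (auto simp: trace_active successively_append_iff successively_child_entries sorted_desc)
  next
    case 2
    have "desc ?D \<noteq> [] \<Longrightarrow> fst (snd (hd ?C)) = Suc (length S)"
      by (cases "desc ?D") auto
    moreover have "desc ?D = [] \<Longrightarrow> ?D = {}" using fin
      by (metis desc_simps(1) finite_Int set_empty)
    ultimately show ?case using 2 hd fin
      by (cases "desc ?D = []") (auto simp: trace_active hd_append)
  }
qed auto

text \<open>A root is picked as the maximum of the unvisited nodes, and everything recorded after it
  was unvisited at that moment.\<close>

lemma trace_root_entry:
  assumes "nfs_state U S" and "nfs_trace G U S = xs @ (v, 0, a) # ys"
  shows "a = v \<and> (\<forall>e\<in>set ys. fst e < v)"
  using assms
proof (induction arbitrary: xs rule: nfs_state_induct[where G = G])
  case (root U)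
  hence fin: "finite U" by (simp add: nfs_state_def)
  let ?T = "nfs_trace G (U - {Max U}) [Max U]"
  have eq: "(Max U, 0, Max U) # ?T = xs @ (v, 0, a) # ys" using root fin by (simp add: trace_root)
  show ?case
  proof (cases xs)
    case Nil
    have "fst ` set ?T = U - {Max U}" using trace_nodes(1)[OF nfs_state_root[OF root(1)]] by blast
    then have "\<forall>e\<in>set ?T. fst e < Max U" using fin
      by (metis Diff_iff Max_ge imageI insertI1 less_le)
    with Nil eq show ?thesis by auto
  next
    case (Cons e xs')
    then show ?thesis using eq root(4) by auto
  qed
next
  case (active U a' S)
  hence fin: "finite U" by (simp add: nfs_state_def)
  let ?D = "neighbours G a' \<inter> U"
  let ?T = "nfs_trace G (U - neighbours G a') (rev (desc ?D) @ S)"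
  let ?C = "child_entries a' (Suc (length S)) (desc ?D)"
  have "?C @ ?T = xs @ (v, 0, a) # ys" using active fin by (simp add: trace_active)
  then obtain us where "xs = ?C @ us \<and> ?T = us @ (v, 0, a) # ys \<or>
      ?C = xs @ us \<and> us @ ?T = (v, 0, a) # ys"
    by (auto simp: append_eq_append_conv2)
  then show ?case
  proof
    assume "?C = xs @ us \<and> us @ ?T = (v, 0, a) # ys"
    moreover have "(v, 0, a) \<notin> set ?C" by (simp add: mem_child_entries)
    ultimately have "us = []" by (cases us) auto
    with \<open>?C = xs @ us \<and> us @ ?T = (v, 0, a) # ys\<close> show ?thesis using active(2)[of "[]"] by simp
  qed (use active(2) in auto)
qed auto

lemma trace_parent:
  assumes "nfs_state U S" and "nfs_trace G U S = xs @ (v, h, a) # ys" and "h > 0"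
  shows "a \<in> set S \<union> fst ` set xs \<and> {a, v} \<in> G"
  using assms(1,2)
proof (induction arbitrary: xs rule: nfs_state_induct[where G = G])
  case (root U)
  hence fin: "finite U" by (simp add: nfs_state_def)
  let ?T = "nfs_trace G (U - {Max U}) [Max U]"
  have eq: "(Max U, 0, Max U) # ?T = xs @ (v, h, a) # ys" using root fin by (simp add: trace_root)
  then show ?case using root(4) assms(3)
    by (cases xs) auto
next
  case (active U a' S)
  hence fin: "finite U" by (simp add: nfs_state_def)
  let ?D = "neighbours G a' \<inter> U"
  let ?T = "nfs_trace G (U - neighbours G a') (rev (desc ?D) @ S)"
  let ?C = "child_entries a' (Suc (length S)) (desc ?D)"
  have "?C @ ?T = xs @ (v, h, a) # ys" using active fin by (simp add: trace_active)
  then obtain us where us: "xs = ?C @ us \<and> ?T = us @ (v, h, a) # ys \<or>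
      ?C = xs @ us \<and> us @ ?T = (v, h, a) # ys"
    by (auto simp: append_eq_append_conv2)
  have *: ?case if "xs = ?C @ us" "?T = us @ (v, h, a) # ys" for us
    using active(2)[OF that(2)] fin that(1) by (auto simp: image_Un)
  show ?case
  proof (cases "us = []")
    case True
    then show ?thesis using us *[of "[]"] by auto
  next
    case False
    show ?thesis
    proof (cases "xs = ?C @ us \<and> ?T = us @ (v, h, a) # ys")
      case c: False
      with us False have "(v, h, a) \<in> set ?C" by (cases us) auto
      hence "a = a'" "v \<in> set (desc ?D)" by (auto simp: mem_child_entries intro!: nth_mem)
      thus ?thesis using fin by (auto simp: neighbours_def)
    qed (use * in auto)
  qed
qed auto

text \<open>Each step asks only for edges between the active node and unvisited nodes. Edges at
  nodes that have left the stack, or between two nodes on the stack, never influence the rest of the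
  search.\<close>

lemma trace_cong:
  assumes "nfs_state U S" and "\<And>x y. x \<in> U \<union> set S \<Longrightarrow> y \<in> U \<Longrightarrow> {x, y} \<in> G \<longleftrightarrow> {x, y} \<in> H"
  shows "nfs_trace G U S = nfs_trace H U S"
  using assms
proof (induction rule: nfs_state_induct[where G = G])
  case (root U)
  hence fin: "finite U" by (simp add: nfs_state_def)
  have "nfs_trace G (U - {Max U}) [Max U] = nfs_trace H (U - {Max U}) [Max U]"
    using root(3,5) by (intro root(4)) auto
  then show ?case using root(2) by (simp add: trace_root fin)
next
  case (active U a S)
  hence fin: "finite U" by (simp add: nfs_state_def)
  have eq: "neighbours H a \<inter> U = neighbours G a \<inter> U"
    using active(3) by (auto simp: neighbours_def)
  hence eq': "U - neighbours H a = U - neighbours G a" by blast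
  show ?case unfolding trace_active[OF fin] eq eq'
    using active(2) active(3) fin by auto
qed auto

section \<open>The forest of search edges\<close>

definition tforest :: "edge_set \<Rightarrow> nat set \<Rightarrow> nat list \<Rightarrow> edge_set" where
  "tforest G U S = {{a, v} | v h a. (v, h, a) \<in> set (nfs_trace G U S) \<and> h > 0}"

lemma tforest_empty [simp]: "tforest G {} [] = {}"
  by (simp add: tforest_def)

lemma tforest_root: "finite U \<Longrightarrow> U \<noteq> {} \<Longrightarrow> tforest G U [] = tforest G (U - {Max U}) [Max U]"
  by (auto simp: tforest_def trace_root)

lemma tforest_active:
  assumes "finite U"
  shows "tforest G U (a # S) = {{a, v} | v. v \<in> neighbours G a \<inter> U} \<union>
    tforest G (U - neighbours G a) (rev (desc (neighbours G a \<inter> U)) @ S)"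
proof -
  have "{{b, v} | v h b. (v, h, b) \<in> set (child_entries a (Suc n) us) \<and> h > 0} = {{a, v} | v. v \<in> set us}" for us n
  proof -
    have "\<exists>h. (v, h, a) \<in> set (child_entries a (Suc n) us) \<and> h > 0" if "v \<in> set us" for v
    proof -
      from that obtain i where "i < length us" "us ! i = v" by (auto simp: in_set_conv_nth)
      thus ?thesis by (intro exI[of _ "Suc n + i"]) (auto simp: mem_child_entries)
    qed
    moreover have "v \<in> set us \<and> b = a" if "(v, h, b) \<in> set (child_entries a (Suc n) us)" for v h b
      using that by (auto simp: mem_child_entries intro!: nth_mem)
    ultimately show ?thesis by blast
  qed
  note * = this[of "length S" "desc (neighbours G a \<inter> U)"]
  have "tforest G U (a # S) = {{b, v} | v h b. (v, h, b) \<in> set (child_entries a (Suc (length S)) (desc (neighbours G a \<inter> U))) \<and> h > 0}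
     \<union> tforest G (U - neighbours G a) (rev (desc (neighbours G a \<inter> U)) @ S)"
    unfolding tforest_def trace_active[OF assms] set_append Un_iff by blast
  thus ?thesis unfolding * using assms by simp
qed

lemma tforest_subset: "nfs_state U S \<Longrightarrow> tforest G U S \<subseteq> G"
  by (force simp: tforest_def in_set_conv_decomp dest: trace_parent)

lemma tforest_edge_nodes:
  assumes "nfs_state U S" "{x, y} \<in> tforest G U S"
  shows "x \<in> U \<union> set S" "y \<in> U \<union> set S" 
proof -
  from assms(2) obtain v h a where *: "{x,y} = {a,v}" "(v,h,a) \<in> set (nfs_trace G U S)" "h > 0"
    by (auto simp: tforest_def)
  then obtain xs ys where e: "nfs_trace G U S = xs @ (v,h,a) # ys" by (auto simp: in_set_conv_decomp)
  have "fst ` set (nfs_trace G U S) = U" using trace_nodes assms by blast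
  hence "v \<in> U" "fst ` set xs \<subseteq> U" using e by auto
  with trace_parent[OF assms(1) e *(3)] have "v \<in> U \<union> set S" "a \<in> U \<union> set S" by auto
  with * show "x \<in> U \<union> set S" "y \<in> U \<union> set S" by (auto simp: doubleton_eq_iff)
qed

lemma nfs_state_not_mem:
  "nfs_state U (a # S) \<Longrightarrow> a \<notin> (U - neighbours G a) \<union> set (rev (desc (neighbours G a \<inter> U)) @ S)"
  by (auto simp: nfs_state_def)

lemma nfs_state_nodes:
  "nfs_state U (a # S) \<Longrightarrow> (U - neighbours G a) \<union> set (rev (desc (neighbours G a \<inter> U)) @ S) = U \<union> set S"
  by (auto simp: nfs_state_def)

text \<open>The active node \<open>a\<close> belongs neither to the new stack nor to the nodes still
  unvisited, so no later search edge touches it, and its star is all that \<open>F\<close> contains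
  at \<open>a\<close>.\<close>

lemma tforest_tforest_aux:
  assumes st: "nfs_state U (a # S)"
    and F: "F = {{a, v} | v. v \<in> neighbours G a \<inter> U} \<union> F'"
    and F': "F' = tforest G (U - neighbours G a) (rev (desc (neighbours G a \<inter> U)) @ S)"
  shows "neighbours F a \<inter> U = neighbours G a \<inter> U" "U - neighbours F a = U - neighbours G a"
proof -
  have "{a, v} \<notin> F'" for v
    using tforest_edge_nodes(1)[OF nfs_state_active[OF st, of G], of a v G] nfs_state_not_mem[OF st, of G] F' by blast
  thus "neighbours F a \<inter> U = neighbours G a \<inter> U"
    unfolding F neighbours_def by (auto simp: doubleton_eq_iff)
  thus "U - neighbours F a = U - neighbours G a" by blast
qed

text \<open>The forest keeps all edges through which nodes are discovered, and the star at
  \<open>a\<close> is invisible to the remaining search by \<open>trace_cong\<close>. Consequently a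
  trace can be recomputed from its own forest, and every search forest is its own search
  forest.\<close>

lemma trace_tforest:
  assumes "nfs_state U S"
  shows "nfs_trace (tforest G U S) U S = nfs_trace G U S"
  using assms
proof (induction rule: nfs_state_induct[where G = G])
  case (root U)
  hence "finite U" by (simp add: nfs_state_def)
  then show ?case using root by (simp add: trace_root tforest_root)
next
  case (active U a S)
  hence fin: "finite U" by (simp add: nfs_state_def)
  define U' S' where "U' = U - neighbours G a" and "S' = rev (desc (neighbours G a \<inter> U)) @ S"
  define F' where "F' = tforest G U' S'"
  define F where "F = tforest G U (a # S)"
  have F: "F = {{a, v} | v. v \<in> neighbours G a \<inter> U} \<union> F'"
    unfolding F_def F'_def U'_def S'_def by (rule tforest_active[OF fin])
  note eq = tforest_tforest_aux[OF active(1) F F'_def[unfolded U'_def S'_def]]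
  have st': "nfs_state U' S'" unfolding U'_def S'_def by (rule nfs_state_active[OF active(1)])
  have "nfs_trace F U' S' = nfs_trace F' U' S'"
  proof (rule trace_cong[OF st'])
    fix x y assume "x \<in> U' \<union> set S'" "y \<in> U'"
    with nfs_state_not_mem[OF active(1), of G] have "x \<noteq> a" "y \<noteq> a" by (auto simp: U'_def S'_def)
    thus "{x, y} \<in> F \<longleftrightarrow> {x, y} \<in> F'" unfolding F by (auto simp: doubleton_eq_iff)
  qed
  also have "\<dots> = nfs_trace G U' S'" using active(2) by (simp add: F'_def U'_def S'_def)
  finally show ?case
    unfolding F_def[symmetric] by (simp add: trace_active[OF fin] eq U'_def S'_def)
qed simp

text \<open>Replaces the condition \<Phi>(G) = \<Phi>(H) by equality of traces, which can be
  analysed one activation at a time.\<close>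

lemma tforest_eq_iff:
  assumes "nfs_state U S"
  shows "tforest G U S = tforest H U S \<longleftrightarrow> nfs_trace G U S = nfs_trace H U S"
proof
  assume "tforest G U S = tforest H U S"
  thus "nfs_trace G U S = nfs_trace H U S"
    by (subst (1 2) trace_tforest[OF assms, symmetric]) (rule arg_cong[where f = "\<lambda>F. nfs_trace F U S"])
qed (simp add: tforest_def)

lemma tforest_nsets:
  assumes "nfs_state U S"
  shows "tforest G U S \<subseteq> nsets (U \<union> set S) 2"
proof
  fix d assume "d \<in> tforest G U S"
  then obtain v h a where d: "d = {a, v}" "(v, h, a) \<in> set (nfs_trace G U S)" "h > 0"
    by (auto simp: tforest_def)
  then obtain xs ys where e: "nfs_trace G U S = xs @ (v,h,a) # ys" by (auto simp: in_set_conv_decomp)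
  have "distinct (map fst (nfs_trace G U S))" "fst ` set (nfs_trace G U S) = U"
    using trace_nodes[OF assms] by blast+
  hence "v \<in> U" "v \<notin> fst ` set xs" using e by auto
  moreover have "a \<in> set S \<union> fst ` set xs" using trace_parent[OF assms e d(3)] by blast
  ultimately have "a \<noteq> v" using assms by (auto simp: nfs_state_def)
  moreover have "{a, v} \<in> tforest G U S" using \<open>d \<in> _\<close> d(1) by simp
  ultimately show "d \<in> nsets (U \<union> set S) 2"
    using tforest_edge_nodes[OF assms, of a v G] d(1) by (simp add: doubleton_in_nsets_2)
qed

abbreviation adjacency :: "edge_set \<Rightarrow> (nat \<times> nat) set" where
  "adjacency E \<equiv> {(a, b). {a, b} \<in> E}"

text \<open>The stack stands for the part of the component found earlier, so its nodes count as
  connected with each other; this is the relation \<open>set S \<times> set S\<close>. After an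
  activation all nodes of the new stack are joined through \<open>a\<close>. With an empty stack the
  lemma says that the ends of an edge are connected in the search forest.\<close>

lemma edge_connected_tforest:
  assumes "nfs_state U S" and "x \<in> U \<union> set S" and "y \<in> U \<union> set S" and "{x, y} \<in> G"
  shows "(x, y) \<in> (adjacency (tforest G U S) \<union> set S \<times> set S)\<^sup>*"
  using assms
proof (induction rule: nfs_state_induct[where G = G])
  case (root U)
  hence fin: "finite U" by (simp add: nfs_state_def)
  have "(x, y) \<in> (adjacency (tforest G U []) \<union> {Max U} \<times> {Max U})\<^sup>*"
    using root fin by (auto simp: tforest_root)
  moreover have "(adjacency (tforest G U []) \<union> {Max U} \<times> {Max U})\<^sup>* \<subseteq> (adjacency (tforest G U []))\<^sup>*"
    by (rule rtrancl_subset_rtrancl) auto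
  ultimately show ?case by auto
next
  case (active U a S)
  hence fin: "finite U" by (simp add: nfs_state_def)
  define D where "D = neighbours G a \<inter> U"
  have finD: "finite D" using fin by (simp add: D_def)
  define U' S' where "U' = U - neighbours G a" and "S' = rev (desc D) @ S"
  define F F' where "F = tforest G U (a # S)" and "F' = tforest G U' S'"
  define R where "R = adjacency F \<union> set (a # S) \<times> set (a # S)"
  have F: "F = {{a, v} | v. v \<in> D} \<union> F'"
    unfolding F_def F'_def U'_def S'_def D_def by (rule tforest_active[OF fin])
  have nodes: "U' \<union> set S' = U \<union> set S"
    unfolding U'_def S'_def D_def by (rule nfs_state_nodes[OF active(1)])
  have star: "(a, s) \<in> R" "(s, a) \<in> R" if "s \<in> set (a # S) \<union> D" for s
    using that F by (auto simp: R_def insert_commute)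
  have "adjacency F' \<union> set S' \<times> set S' \<subseteq> R\<^sup>*"
  proof -
    have "set S' \<subseteq> set (a # S) \<union> D" using finD by (auto simp: S'_def)
    have "(s, s') \<in> R\<^sup>*" if "s \<in> set S'" "s' \<in> set S'" for s s'
    proof -
      from that \<open>set S' \<subseteq> _\<close> star have "(s, a) \<in> R" "(a, s') \<in> R" by blast+
      thus ?thesis by (rule converse_rtrancl_into_rtrancl[OF _ r_into_rtrancl])
    qed
    hence "set S' \<times> set S' \<subseteq> R\<^sup>*" by blast
    moreover have "adjacency F' \<subseteq> R" using F by (auto simp: R_def)
    ultimately show ?thesis by blast
  qed
  hence sub: "(adjacency F' \<union> set S' \<times> set S')\<^sup>* \<subseteq> R\<^sup>*" by (rule rtrancl_subset_rtrancl)
  have ay: "(a, y) \<in> R" "(y, a) \<in> R" if "{a, y} \<in> G" "y \<in> U \<union> set (a # S)" for y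
    using that star by (auto simp: D_def neighbours_def)
  show ?case
  proof (cases "x = a \<or> y = a")
    case True
    then show ?thesis using ay active(3-5)
      unfolding R_def[symmetric] F_def[symmetric] by (auto simp: insert_commute)
  next
    case False
    with active(3,4) nodes have "x \<in> U' \<union> set S'" "y \<in> U' \<union> set S'" by auto
    with active(2)[OF _ _ active(5)] sub show ?thesis
      unfolding R_def[symmetric] F_def[symmetric] F'_def U'_def S'_def D_def by blast
  qed
qed simp

section \<open>Traces encoded by labels and heights\<close>

definition entry_code :: "nfs_entry \<Rightarrow> nat \<times> nat" where
  "entry_code = (\<lambda>(v, h, a). (v, h))"

text \<open>The children of the active node form the longest initial run of heights n + 1, n + 2,
  ...: the height after them is at most \<open>n + length us\<close>, which ends the run. So a code
  without parents still shows where the children stop.\<close>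

lemma child_entries_prefix_unique:
  assumes "map entry_code (child_entries a (Suc n) us) @ T = map entry_code (child_entries b (Suc n) ws) @ T'"
    and "T \<noteq> [] \<Longrightarrow> snd (hd T) \<le> n + length us" and "T' \<noteq> [] \<Longrightarrow> snd (hd T') \<le> n + length ws"
  shows "us = ws \<and> T = T'"
  using assms
proof (induction us arbitrary: n ws)
  case Nil
  then show ?case by (cases ws) (auto simp: entry_code_def)
next
  case (Cons u us)
  then show ?case
  proof (cases ws)
    case Nil
    then show ?thesis using Cons by (auto simp: entry_code_def)
  next
    case (Cons w ws')
    then show ?thesis using Cons.IH[of "Suc n" ws'] Cons.prems by (auto simp: entry_code_def)
  qed
qed

lemma trace_active_eqD:
  assumes st: "nfs_state U (a # S)"
    and eq: "map entry_code (nfs_trace G U (a # S)) = map entry_code (nfs_trace H U (a # S))"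
  shows "neighbours G a \<inter> U = neighbours H a \<inter> U"
    "map entry_code (nfs_trace G (U - neighbours G a) (rev (desc (neighbours G a \<inter> U)) @ S)) =
     map entry_code (nfs_trace H (U - neighbours G a) (rev (desc (neighbours G a \<inter> U)) @ S))"
proof -
  have fin: "finite U" using st by (simp add: nfs_state_def)
  let ?T = "\<lambda>G. map entry_code (nfs_trace G (U - neighbours G a) (rev (desc (neighbours G a \<inter> U)) @ S))"
  have hd: "?T G \<noteq> [] \<Longrightarrow> snd (hd (?T G)) \<le> length S + length (desc (neighbours G a \<inter> U))" for G
    using trace_successively(2)[OF nfs_state_active[OF st, of G], of G]
    by (auto simp: hd_map entry_code_def case_prod_unfold)
  have "desc (neighbours G a \<inter> U) = desc (neighbours H a \<inter> U) \<and> ?T G = ?T H"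
    using eq unfolding trace_active[OF fin] map_append
    by (rule child_entries_prefix_unique) (use hd in blast)+
  hence *: "desc (neighbours G a \<inter> U) = desc (neighbours H a \<inter> U)" "?T G = ?T H" by blast+
  from * show 1: "neighbours G a \<inter> U = neighbours H a \<inter> U"
    by (metis desc_simps(1) fin finite_Int)
  hence "U - neighbours G a = U - neighbours H a" by blast
  with 1 * show "map entry_code (nfs_trace G (U - neighbours G a) (rev (desc (neighbours G a \<inter> U)) @ S)) =
     map entry_code (nfs_trace H (U - neighbours G a) (rev (desc (neighbours G a \<inter> U)) @ S))" by simp
qed

text \<open>By \<open>trace_active_eqD\<close> equal codes force the same children at each
  activation, so the parents dropped by \<open>entry_code\<close> agree as well.\<close>

lemma trace_eq_if_code_eq:
  assumes "nfs_state U S" and "map entry_code (nfs_trace G U S) = map entry_code (nfs_trace H U S)"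
  shows "nfs_trace G U S = nfs_trace H U S"
  using assms
proof (induction rule: nfs_state_induct[where G = G])
  case (root U)
  hence "finite U" by (simp add: nfs_state_def)
  then show ?case using root by (simp add: trace_root)
next
  case (active U a S)
  hence fin: "finite U" by (simp add: nfs_state_def)
  note eq = trace_active_eqD[OF active(1,3)]
  from eq(1) have "U - neighbours G a = U - neighbours H a" by blast
  then show ?case using active(2)[OF eq(2)] eq(1) by (simp add: trace_active[OF fin])
qed simp

definition code_step :: "nat \<times> nat \<Rightarrow> nat \<times> nat \<Rightarrow> bool" where
  "code_step = (\<lambda>(v, h) (v', h'). h' \<le> Suc h \<and> (h' = Suc h \<longrightarrow> v' < v))"

text \<open>The counterpart for arbitrary codes: the maximal run is cut off, and its labels decrease
  because \<open>code_step\<close> demands this at every ascent.\<close>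

lemma child_entries_prefix_exists:
  assumes "successively code_step cs"
    and "cs \<noteq> [] \<Longrightarrow> snd (hd cs) \<le> Suc n"
  shows "\<exists>us T. cs = map entry_code (child_entries a (Suc n) us) @ T \<and> sorted_wrt (>) us \<and>
    (T \<noteq> [] \<longrightarrow> snd (hd T) \<le> n + length us)"
  using assms
proof (induction cs arbitrary: n)
  case (Cons c cs)
  obtain v h where c: "c = (v, h)" by fastforce
  show ?case
  proof (cases "h \<le> n")
    case True
    then show ?thesis by (intro exI[of _ "[]"] exI[of _ "c # cs"]) (simp add: c)
  next
    case False
    hence h: "h = Suc n" using Cons.prems(2) c by simp
    have s: "cs \<noteq> [] \<Longrightarrow> snd (hd cs) \<le> Suc (Suc n) \<and> (snd (hd cs) = Suc (Suc n) \<longrightarrow> fst (hd cs) < v)"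
      using Cons.prems(1) c h by (auto simp: successively_Cons code_step_def case_prod_unfold)
    obtain us T where *: "cs = map entry_code (child_entries a (Suc (Suc n)) us) @ T" "sorted_wrt (>) us"
      "T \<noteq> [] \<longrightarrow> snd (hd T) \<le> Suc n + length us"
      using Cons.IH[of "Suc n"] Cons.prems(1) s by (auto simp: successively_Cons)
    have "sorted_wrt (>) (v # us)"
    proof (cases us)
      case (Cons u us')
      with s * have "u < v" by (auto simp: entry_code_def)
      with * Cons show ?thesis by auto
    qed simp
    with * h c show ?thesis
      by (intro exI[of _ "v # us"] exI[of _ T]) (auto simp: entry_code_def)
  qed
qed simp

text \<open>No condition is put on the first height, so that validity passes to suffixes; the bound
  on it depends on the current stack and is stated where it is used.\<close>

definition valid_code :: "(nat \<times> nat) list \<Rightarrow> bool" where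
  "valid_code cs \<longleftrightarrow> distinct (map fst cs) \<and>
     successively code_step cs \<and>
     (\<forall>xs v ys. cs = xs @ (v, 0) # ys \<longrightarrow> (\<forall>c\<in>set ys. fst c < v))"

lemma valid_code_suffix: 
  assumes "valid_code (xs @ ys)" shows "valid_code ys"
proof -
  have "\<forall>c\<in>set ws. fst c < v" if "ys = us @ (v, 0) # ws" for us v ws
  proof -
    have "xs @ ys = (xs @ us) @ (v, 0) # ws" using that by simp
    with assms show ?thesis unfolding valid_code_def by blast
  qed
  with assms show ?thesis by (auto simp: valid_code_def successively_append_iff)
qed

text \<open>The graph is built from the end of the code: the initial run of siblings is the star of
  the active node, and the remaining code is realised by a graph for the next state.\<close>

lemma ex_trace_of_code:
  assumes "nfs_state U S" and "valid_code cs" and "fst ` set cs = U"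
    and "cs \<noteq> [] \<Longrightarrow> snd (hd cs) \<le> length S"
  shows "\<exists>G. map entry_code (nfs_trace G U S) = cs"
  using assms
proof (induction "2 * card U + length S" arbitrary: U S cs rule: less_induct)
  case less
  hence fin: "finite U" by (simp add: nfs_state_def)
  show ?case
  proof (cases S)
    case Nil
    show ?thesis
    proof (cases cs)
      case Nil
      then show ?thesis using \<open>S = []\<close> less by simp
    next
      case (Cons c cs')
      with less Nil obtain v where c: "c = (v, 0)" by (cases c) auto
      have v: "\<forall>c\<in>set cs'. fst c < v" using less(3) Cons c unfolding valid_code_def by blast
      have U: "U = insert v (fst ` set cs')" using less(4) Cons c by auto
      have M: "Max U = v" using fin U v by (intro Max_eqI) auto
      have d: "v \<notin> fst ` set cs'" using v by auto
      have "\<exists>G. map entry_code (nfs_trace G (U - {v}) [v]) = cs'"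
      proof (rule less(1))
        have "card (U - {v}) < card U" using fin U by (intro psubset_card_mono) auto
        then show "2 * card (U - {v}) + length [v] < 2 * card U + length S"
          using Nil by simp
        show "nfs_state (U - {v}) [v]" using less Nil by (intro nfs_state_root) auto
        show "valid_code cs'" using valid_code_suffix[of "[c]" cs'] less(3) Cons by simp
        show "fst ` set cs' = U - {v}" using U d by auto
        show "cs' \<noteq> [] \<Longrightarrow> snd (hd cs') \<le> length [v]"
          using less(3) Cons c by (auto simp: valid_code_def successively_Cons code_step_def case_prod_unfold)
      qed
      then show ?thesis using Cons M c U fin Nil by (auto simp: trace_root entry_code_def)
    qed
  next
    case (Cons a S')
    have "\<exists>us T. cs = map entry_code (child_entries a (Suc (length S')) us) @ T \<and> sorted_wrt (>) us \<and>
      (T \<noteq> [] \<longrightarrow> snd (hd T) \<le> length S' + length us)"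
      using less(3,5) Cons unfolding valid_code_def by (intro child_entries_prefix_exists) auto
    then obtain us T where cs: "cs = map entry_code (child_entries a (Suc (length S')) us) @ T"
      and us: "sorted_wrt (>) us" and T: "T \<noteq> [] \<Longrightarrow> snd (hd T) \<le> length S' + length us" by blast
    have [simp]: "fst \<circ> entry_code = fst" by (auto simp: entry_code_def)
    have m: "map fst cs = us @ map fst T" by (simp add: cs)
    have "set (map fst cs) = U" using less(4) by simp
    hence U: "U = set us \<union> fst ` set T" unfolding m by auto
    have "distinct (map fst cs)" using less(3) by (simp add: valid_code_def)
    hence "distinct us" "set us \<inter> fst ` set T = {}" unfolding m by auto
    with U have D: "set us \<subseteq> U" "fst ` set T = U - set us" "distinct us" by auto
    have st: "nfs_state U (a # S')" using less Cons by simp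
    define U' S2 where "U' = U - set us" and "S2 = rev us @ S'"
    have st': "nfs_state U' S2"
      using st D by (auto simp: nfs_state_def U'_def S2_def)
    have "\<exists>G. map entry_code (nfs_trace G U' S2) = T"
    proof (rule less(1)[OF _ st'])
      have "card U' + length us = card U" using D fin
        by (metis U'_def card_Diff_subset card_mono distinct_card finite_set le_add_diff_inverse2)
      then show "2 * card U' + length S2 < 2 * card U + length S"
        using Cons by (simp add: S2_def)
      show "valid_code T" using less(3) valid_code_suffix cs by blast
      show "T \<noteq> [] \<Longrightarrow> snd (hd T) \<le> length S2" using T by (simp add: S2_def)
    qed (use D in \<open>simp add: U'_def\<close>)
    then obtain H where H: "map entry_code (nfs_trace H U' S2) = T" ..
    \<comment> \<open>\<open>H\<close> may have edges at \<open>a\<close>, its search forest has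
      none, and both have the same trace from the next state on.\<close>
    define G where "G = {{a, v} | v. v \<in> set us} \<union> tforest H U' S2"
    have a: "a \<notin> U' \<union> set S2" using st D by (auto simp: nfs_state_def U'_def S2_def)
    have "neighbours G a = set us" 
      using tforest_edge_nodes(1)[OF st', of a _ H] a
      by (auto simp: neighbours_def G_def doubleton_eq_iff)
    hence n: "neighbours G a \<inter> U = set us" "U - neighbours G a = U'" using D by (auto simp: U'_def)
    have "nfs_trace G U' S2 = nfs_trace (tforest H U' S2) U' S2"
      using a by (intro trace_cong[OF st']) (auto simp: G_def doubleton_eq_iff)
    also have "\<dots> = nfs_trace H U' S2" by (rule trace_tforest[OF st'])
    finally have "map entry_code (nfs_trace G U S) = cs"
      unfolding Cons trace_active[OF fin] n desc_unique[OF us] cs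
      using H by (simp add: S2_def)
    then show ?thesis by blast
  qed
qed

section \<open>Graphs with a given search trace\<close>

text \<open>A node of height h > 0 has h - 1 nodes below it on the stack when it becomes active,
  each offering one optional edge. Roots have none, and truncated subtraction gives 0 for
  them.\<close>

definition total_level :: "nfs_entry list \<Rightarrow> nat" where
  "total_level es = (\<Sum>(v, h, a)\<leftarrow>es. h - 1)"

lemma total_level_append [simp]: "total_level (xs @ ys) = total_level xs + total_level ys"
  by (simp add: total_level_def)

text \<open>The children contribute n + (n + 1) + ..., a difference of two triangular numbers.
  \<open>n choose 2\<close> counts the pairs of nodes on a stack of size n; the additive form avoids
  truncated subtraction.\<close>

lemma total_level_child_entries:
  "total_level (child_entries a (Suc n) us) + (n choose 2) = (n + length us) choose 2"
proof (induction us arbitrary: n)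
  case (Cons u us)
  have "Suc n choose 2 = n + (n choose 2)" by (simp add: numeral_2_eq_2)
  then show ?case using Cons[of "Suc n"] by (simp add: total_level_def)
qed (simp add: total_level_def)

lemma sum_power_card_Pow:
  fixes t :: "'a::comm_semiring_1"
  assumes "finite A"
  shows "(\<Sum>B\<in>Pow A. t ^ card B) = (1 + t) ^ card A"
  using assms
proof (induction rule: finite_induct)
  case (insert x A)
  have "(\<Sum>B\<in>Pow (insert x A). t ^ card B) = (\<Sum>B\<in>Pow A. t ^ card B) + (\<Sum>B\<in>insert x ` Pow A. t ^ card B)"
    unfolding Pow_insert using insert by (intro sum.union_disjoint) auto
  also have "(\<Sum>B\<in>insert x ` Pow A. t ^ card B) = (\<Sum>B\<in>Pow A. t ^ card (insert x B))"
    using insert by (subst sum.reindex) (auto simp: inj_on_def)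
  also have "\<dots> = (\<Sum>B\<in>Pow A. t * t ^ card B)"
  proof (intro sum.cong refl)
    fix B assume "B \<in> Pow A"
    then have "finite B" "x \<notin> B" using insert by (auto intro: finite_subset)
    then show "t ^ card (insert x B) = t * t ^ card B" by simp
  qed
  finally show ?case using insert by (simp add: sum_distrib_left[symmetric] algebra_simps)
qed simp

abbreviation star :: "nat \<Rightarrow> nat set \<Rightarrow> edge_set" where
  "star a B \<equiv> (\<lambda>v. {a, v}) ` B"

lemma card_star [simp]: "card (star a B) = card B"
  by (intro card_image) (auto simp: inj_on_def doubleton_eq_iff)

lemma graph_star_decomposition:
  assumes "G \<subseteq> nsets (insert a V) 2" "a \<notin> V"
  shows "G = star a (neighbours G a \<inter> V) \<union> (G \<inter> nsets V 2)"
proof -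
  have "d \<in> star a (neighbours G a \<inter> V) \<union> (G \<inter> nsets V 2)" if d: "d \<in> G" for d
  proof -
    from d assms(1) obtain x y where xy: "d = {x, y}" "x \<in> insert a V" "y \<in> insert a V" "x \<noteq> y"
      by (meson nsets2_E subsetD)
    then show ?thesis using d
      by (cases "x = a"; cases "y = a")
         (auto simp: neighbours_def doubleton_in_nsets_2 insert_commute)
  qed
  then show ?thesis by (auto simp: neighbours_def)
qed

lemma trace_active_eq_iff:
  assumes st: "nfs_state U (a # S)"
  shows "nfs_trace G U (a # S) = nfs_trace H U (a # S) \<longleftrightarrow>
    neighbours G a \<inter> U = neighbours H a \<inter> U \<and>
    nfs_trace G (U - neighbours H a) (rev (desc (neighbours H a \<inter> U)) @ S) =
    nfs_trace H (U - neighbours H a) (rev (desc (neighbours H a \<inter> U)) @ S)" (is "?l \<longleftrightarrow> ?r1 \<and> ?r2")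
proof
  assume ?l
  then have *: "map entry_code (nfs_trace H U (a # S)) = map entry_code (nfs_trace G U (a # S))"
    by simp
  show "?r1 \<and> ?r2"
    using trace_active_eqD[OF st *] trace_eq_if_code_eq[OF nfs_state_active[OF st, of H]] by metis
next
  have fin: "finite U" using st by (simp add: nfs_state_def)
  assume r: "?r1 \<and> ?r2"
  then have "U - neighbours G a = U - neighbours H a" by blast
  with r show ?l by (simp add: trace_active[OF fin])
qed

text \<open>When a node is activated, its edges to the unvisited nodes are determined by the search, while
  its edges to the nodes that are still on the stack can be chosen freely.\<close>

lemma trace_fiber_sum:
  fixes t :: "'a::comm_semiring_1"
  assumes "nfs_state U S"
  shows "(\<Sum>G | G \<subseteq> nsets (U \<union> set S) 2 \<and> nfs_trace G U S = nfs_trace H U S. t ^ card G) =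
    t ^ card (tforest H U S) * (1 + t) ^ (total_level (nfs_trace H U S) + (length S choose 2))"
  using assms
proof (induction rule: nfs_state_induct[where G = H])
  case empty
  have "{G. G \<subseteq> nsets ({} \<union> set []) 2 \<and> nfs_trace G {} [] = nfs_trace H {} []} = {{}}"
    by (auto simp: nsets_def)
  then show ?case by (simp add: total_level_def binomial_eq_0)
next
  case (root U)
  then have fin: "finite U" by (simp add: nfs_state_def)
  have "(U - {Max U}) \<union> set [Max U] = U \<union> set []" using root by auto
  then show ?case using root fin by (simp add: trace_root tforest_root total_level_def binomial_eq_0)
next
  case (active U a S)
  then have fin: "finite U" "finite (set S)" and aU: "a \<notin> U" and aS: "a \<notin> set S"
    and US: "set S \<inter> U = {}" and dS: "card (set S) = length S"
    by (auto simp: nfs_state_def distinct_card)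
  define D where "D = neighbours H a \<inter> U"
  define U' S' where "U' = U - neighbours H a" and "S' = rev (desc D) @ S"
  have finD: "finite D" using fin by (simp add: D_def)
  have st': "nfs_state U' S'" unfolding U'_def S'_def D_def by (rule nfs_state_active[OF active(1)])
  have nodes: "U' \<union> set S' = U \<union> set S"
    unfolding U'_def S'_def D_def by (rule nfs_state_nodes[OF active(1)])
  define V where "V = U \<union> set S"
  have aV: "a \<notin> V" using aU aS by (simp add: V_def)
  have finV: "finite V" using fin by (simp add: V_def)
  have finE: "finite E" if "E \<subseteq> nsets V 2" for E
    using that finV finite_imp_finite_nsets finite_subset by blast
  define A where "A = {G. G \<subseteq> nsets V 2 \<and> nfs_trace G U' S' = nfs_trace H U' S'}"
  have finA: "finite A" using finV by (auto simp: A_def finite_imp_finite_nsets)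
  have U'V: "U' \<union> set S' = V" using nodes by (simp add: V_def)
  have not_V: "{a, v} \<notin> G" if "G \<subseteq> nsets V 2" for v G
    using that aV doubleton_in_nsets_2[of a v V] by blast
  have disj: "star a B \<inter> G = {}" if "G \<subseteq> nsets V 2" for B G
    using not_V[OF that] by auto
  have trace_local: "nfs_trace (E \<union> G) U' S' = nfs_trace G U' S'" if "E \<subseteq> star a UNIV" for E G
  proof (rule trace_cong[OF st'])
    fix x y assume "x \<in> U' \<union> set S'" "y \<in> U'"
    hence "x \<noteq> a" "y \<noteq> a" using aV U'V by auto
    hence "{x, y} \<notin> star a UNIV" by (auto simp: doubleton_eq_iff)
    hence "{x, y} \<notin> E" using that by blast
    thus "{x, y} \<in> E \<union> G \<longleftrightarrow> {x, y} \<in> G" by blast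
  qed
  have trace_eq: "nfs_trace G U (a # S) = nfs_trace H U (a # S) \<longleftrightarrow>
    neighbours G a \<inter> U = D \<and> nfs_trace G U' S' = nfs_trace H U' S'" for G
    unfolding U'_def S'_def D_def by (rule trace_active_eq_iff[OF active(1)])
  \<comment> \<open>A graph of the fibre splits into the star from \<open>a\<close> to the forced
    set \<open>D\<close> and to a free subset \<open>B\<close> of the stack, and its part on
    \<open>V\<close>, which lies in the fibre of the next state.\<close>
  have "(\<Sum>G | G \<subseteq> nsets (U \<union> set (a # S)) 2 \<and> nfs_trace G U (a # S) = nfs_trace H U (a # S). t ^ card G) =
      (\<Sum>(B, G)\<in>Pow (set S) \<times> A. t ^ card (star a (D \<union> B) \<union> G))"
  proof (rule sum.reindex_bij_witness[where i = "\<lambda>(B, G). star a (D \<union> B) \<union> G"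
        and j = "\<lambda>G. (neighbours G a \<inter> set S, G \<inter> nsets V 2)"], goal_cases)
    case (1 G)
    then have "G \<subseteq> nsets (insert a V) 2" "neighbours G a \<inter> U = D" by (auto simp: V_def trace_eq)
    moreover have "neighbours G a \<inter> V = (neighbours G a \<inter> U) \<union> (neighbours G a \<inter> set S)" by (auto simp: V_def)
    ultimately have "star a (D \<union> (neighbours G a \<inter> set S)) \<union> (G \<inter> nsets V 2) = G"
      using graph_star_decomposition[OF _ aV] by metis
    then show ?case by (simp only: prod.case)
  next
    case (2 G)
    then have G: "G \<subseteq> nsets (insert a V) 2" "neighbours G a \<inter> U = D" "nfs_trace G U' S' = nfs_trace H U' S'"
      by (auto simp: V_def trace_eq)
    have "nfs_trace (star a (neighbours G a \<inter> V) \<union> (G \<inter> nsets V 2)) U' S' = nfs_trace (G \<inter> nsets V 2) U' S'"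
      by (rule trace_local) auto
    with G(3) graph_star_decomposition[OF G(1) aV] show ?case by (auto simp: A_def)
  next
    case (3 p)
    then obtain B G where p: "p = (B, G)" "B \<subseteq> set S" "G \<subseteq> nsets V 2" by (auto simp: A_def)
    then have "neighbours (star a (D \<union> B) \<union> G) a = D \<union> B"
      using not_V by (auto simp: neighbours_def doubleton_eq_iff)
    moreover have "(D \<union> B) \<inter> set S = B" using p US by (auto simp: D_def)
    moreover have "star a (D \<union> B) \<inter> nsets V 2 = {}" by (rule disj) simp
    ultimately show ?case using p by auto
  next
    case (4 p)
    then obtain B G where p: "p = (B, G)" "B \<subseteq> set S" "G \<subseteq> nsets V 2" "nfs_trace G U' S' = nfs_trace H U' S'"
      by (auto simp: A_def)
    then have "neighbours (star a (D \<union> B) \<union> G) a = D \<union> B"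
      using not_V by (auto simp: neighbours_def doubleton_eq_iff)
    moreover have "(D \<union> B) \<inter> U = D" using p US by (auto simp: D_def)
    moreover have "nfs_trace (star a (D \<union> B) \<union> G) U' S' = nfs_trace G U' S'"
      by (rule trace_local) auto
    moreover have "star a (D \<union> B) \<union> G \<subseteq> nsets (U \<union> set (a # S)) 2"
    proof -
      have "D \<union> B \<subseteq> V" using p by (auto simp: D_def V_def)
      hence "star a (D \<union> B) \<subseteq> nsets (insert a V) 2" using aV by (auto simp: doubleton_in_nsets_2)
      moreover have "G \<subseteq> nsets (insert a V) 2" using p(3) nsets_mono[of V "insert a V" 2] by blast
      ultimately show ?thesis by (simp add: V_def)
    qed
    ultimately show ?case using p by (simp add: trace_eq)
  next
    case (5 G)
    then have "G \<subseteq> nsets (insert a V) 2" "neighbours G a \<inter> U = D" by (auto simp: V_def trace_eq)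
    moreover have "neighbours G a \<inter> V = (neighbours G a \<inter> U) \<union> (neighbours G a \<inter> set S)" by (auto simp: V_def)
    ultimately have "star a (D \<union> (neighbours G a \<inter> set S)) \<union> (G \<inter> nsets V 2) = G"
      using graph_star_decomposition[OF _ aV] by metis
    then show ?case by (simp only: prod.case)
  qed
  also have "\<dots> = (\<Sum>(B, G)\<in>Pow (set S) \<times> A. t ^ card D * (t ^ card B * t ^ card G))"
  proof (intro sum.cong refl, clarify)
    fix B G assume BG: "B \<subseteq> set S" "G \<in> A"
    then have G: "G \<subseteq> nsets V 2" by (simp add: A_def)
    have "finite B" using BG fin finite_subset by blast
    have "card (star a (D \<union> B) \<union> G) = card (star a (D \<union> B)) + card G"
      using finE[OF G] finD \<open>finite B\<close> disj[OF G] by (intro card_Un_disjoint) auto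
    also have "card (star a (D \<union> B)) = card D + card B"
      unfolding card_star using BG US finD \<open>finite B\<close> by (intro card_Un_disjoint) (auto simp: D_def)
    finally show "t ^ card (star a (D \<union> B) \<union> G) = t ^ card D * (t ^ card B * t ^ card G)"
      by (simp add: power_add mult.assoc)
  qed
  also have "\<dots> = t ^ card D * ((\<Sum>B\<in>Pow (set S). t ^ card B) * (\<Sum>G\<in>A. t ^ card G))"
  proof -
    have "(\<Sum>B\<in>Pow (set S). t ^ card B) * (\<Sum>G\<in>A. t ^ card G) =
        (\<Sum>(B, G)\<in>Pow (set S) \<times> A. t ^ card B * t ^ card G)"
      unfolding sum_product by (rule sum.cartesian_product)
    then show ?thesis by (simp add: sum_distrib_left case_prod_unfold)
  qed
  also have "(\<Sum>B\<in>Pow (set S). t ^ card B) = (1 + t) ^ length S"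
    using sum_power_card_Pow[OF fin(2)] dS by simp
  also have "(\<Sum>G\<in>A. t ^ card G) = t ^ card (tforest H U' S') *
      (1 + t) ^ (total_level (nfs_trace H U' S') + (length S' choose 2))"
    using active(2) unfolding A_def V_def nodes[symmetric] U'_def S'_def D_def by simp
  also have "t ^ card D * ((1 + t) ^ length S * (t ^ card (tforest H U' S') *
      (1 + t) ^ (total_level (nfs_trace H U' S') + (length S' choose 2)))) =
    t ^ (card D + card (tforest H U' S')) *
      (1 + t) ^ (length S + total_level (nfs_trace H U' S') + (length S' choose 2))"
    by (simp add: power_add ac_simps)
  also have "card D + card (tforest H U' S') = card (tforest H U (a # S))"
  proof -
    have "tforest H U' S' \<subseteq> nsets V 2" using tforest_nsets[OF st'] U'V by simp
    then have "card (star a D \<union> tforest H U' S') = card (star a D) + card (tforest H U' S')"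
      using finD finE disj by (intro card_Un_disjoint) auto
    moreover have "tforest H U (a # S) = star a D \<union> tforest H U' S'"
      by (auto simp: tforest_active[OF fin(1)] D_def U'_def S'_def)
    ultimately show ?thesis by simp
  qed
  \<comment> \<open>\<open>choose 2\<close> counts the pairs on the stack, whose edges are still
    undecided. Popping \<open>a\<close> settles its \<open>length S\<close> pairs, and pushing the
    children adds as many pairs as \<open>total_level\<close> gives for their entries.\<close>
  also have "length S + total_level (nfs_trace H U' S') + (length S' choose 2) =
      total_level (nfs_trace H U (a # S)) + (length (a # S) choose 2)"
  proof -
    have "total_level (child_entries a (Suc (length S)) (desc D)) + (length S choose 2) = length S' choose 2"
      by (subst total_level_child_entries) (simp add: S'_def finD add.commute)
    moreover have "length (a # S) choose 2 = length S + (length S choose 2)" by (simp add: numeral_2_eq_2)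
    ultimately show ?thesis
      by (simp add: trace_active[OF fin(1)] D_def U'_def S'_def)
  qed
  finally show ?case .
qed

section \<open>Search within components\<close>

definition comp_trace :: "edge_set \<Rightarrow> nat set \<Rightarrow> nat list \<Rightarrow> nfs_entry list" where
  "comp_trace G U S = takeWhile (\<lambda>(v, h, a). h > 0) (nfs_trace G U S)"

lemma comp_trace_Nil [simp]: "comp_trace G U [] = []"
proof (cases "finite U")
  case True
  then show ?thesis by (cases "U = {}") (auto simp: comp_trace_def trace_root)
next
  case False
  then show ?thesis unfolding comp_trace_def by (subst nfs_trace.simps) simp
qed

lemma takeWhile_child_entries:
  "takeWhile (\<lambda>(v, h, a). h > 0) (child_entries a (Suc n) us @ T) =
     child_entries a (Suc n) us @ takeWhile (\<lambda>(v, h, a). h > 0) T"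
  by (rule takeWhile_append2) (auto simp: mem_child_entries)

lemma comp_trace_active:
  "finite U \<Longrightarrow> comp_trace G U (a # S) =
     child_entries a (Suc (length S)) (desc (neighbours G a \<inter> U))
      @ comp_trace G (U - neighbours G a) (rev (desc (neighbours G a \<inter> U)) @ S)"
  by (simp add: comp_trace_def trace_active takeWhile_child_entries)

lemma trace_split_component:
  assumes "nfs_state U S"
  shows "nfs_trace G U S = comp_trace G U S @ nfs_trace G (U - fst ` set (comp_trace G U S)) []"
  using assms
proof (induction rule: nfs_state_induct[where G = G])
  case (active U a S)
  then have fin: "finite U" by (simp add: nfs_state_def)
  define C where "C = fst ` set (comp_trace G (U - neighbours G a) (rev (desc (neighbours G a \<inter> U)) @ S))"
  have "U - (neighbours G a \<inter> U \<union> C) = U - neighbours G a - C" by blast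
  then show ?case
    using active(2) fin by (simp add: trace_active comp_trace_active image_Un C_def)
qed auto

lemma comp_trace_nodes: "nfs_state U S \<Longrightarrow> fst ` set (comp_trace G U S) \<subseteq> U"
  using trace_nodes(1)[of U S G] unfolding comp_trace_def by (auto dest!: set_takeWhileD)

lemma comp_trace_closed:
  assumes "nfs_state U S" and "x \<in> fst ` set (comp_trace G U S) \<union> set S"
    and "{x, y} \<in> G" and "y \<in> U"
  shows "y \<in> fst ` set (comp_trace G U S)"
  using assms
proof (induction rule: nfs_state_induct[where G = G])
  case (active U a S)
  then have fin: "finite U" by (simp add: nfs_state_def)
  show ?case using active by (auto simp: comp_trace_active fin image_Un neighbours_def)
qed auto

lemma comp_trace_reachable:
  assumes "nfs_state U S" and "v \<in> fst ` set (comp_trace G U S)"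
  shows "\<exists>s\<in>set S. (s, v) \<in> (adjacency G)\<^sup>*"
  using assms
proof (induction rule: nfs_state_induct[where G = G])
  case (active U a S)
  then have fin: "finite U" by (simp add: nfs_state_def)
  have *: "(a, w) \<in> (adjacency G)\<^sup>*" if "w \<in> neighbours G a" for w
    using that by (auto simp: neighbours_def)
  consider "v \<in> neighbours G a" | "v \<in> fst ` set (comp_trace G (U - neighbours G a) (rev (desc (neighbours G a \<inter> U)) @ S))"
    using active(3) by (auto simp: comp_trace_active fin image_Un)
  then show ?case
  proof cases
    case 2
    with active(2) obtain s where "s \<in> neighbours G a \<inter> U \<union> set S" "(s, v) \<in> (adjacency G)\<^sup>*"
      using fin by auto
    then show ?thesis using * by (auto intro: rtrancl_trans)
  qed (use * in auto)
qed auto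

text \<open>Compares a search in which earlier components have been removed with one in which all
  other nodes are still unvisited; without edges to the additional nodes the search never sees
  them.\<close>

lemma comp_trace_cong:
  assumes "nfs_state U S" and "nfs_state W S" and "U \<subseteq> W"
    and "\<And>x y. x \<in> U \<union> set S \<Longrightarrow> y \<in> W - U \<Longrightarrow> {x, y} \<notin> G"
  shows "comp_trace G W S = comp_trace G U S"
  using assms
proof (induction arbitrary: W rule: nfs_state_induct[where G = G])
  case (active U a S)
  then have fin: "finite U" "finite W" by (simp_all add: nfs_state_def)
  have eq: "neighbours G a \<inter> W = neighbours G a \<inter> U"
    using active(4,5) by (auto simp: neighbours_def)
  have "comp_trace G (W - neighbours G a) (rev (desc (neighbours G a \<inter> U)) @ S) =
      comp_trace G (U - neighbours G a) (rev (desc (neighbours G a \<inter> U)) @ S)"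
  proof (rule active(2))
    show "nfs_state (W - neighbours G a) (rev (desc (neighbours G a \<inter> U)) @ S)"
      using nfs_state_active[OF active(3), of G] by (simp add: eq)
    show "{x, y} \<notin> G" if "x \<in> U - neighbours G a \<union> set (rev (desc (neighbours G a \<inter> U)) @ S)"
      "y \<in> W - neighbours G a - (U - neighbours G a)" for x y
      using that active(5)[of x y] fin by auto
  qed (use active in auto)
  then show ?case by (simp add: comp_trace_active fin eq)
qed auto

text \<open>The stack is the list of visited but not yet activated nodes in reverse order of visit,
  with the active node on top. The invariant \<open>I\<close> and the function \<open>new\<close>
  are left open so that the lemma serves both the search of a graph by unvisited neighbours and the
  search of a forest by children. Each step activates a node until the component is exhausted, so
  \<open>card U + length S\<close> steps suffice.\<close>

lemma nfs_step_simulation: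
  assumes "nfs_state U S"
    and new: "\<And>U a S X. I U (a # S) X \<Longrightarrow> nfs_state U (a # S) \<Longrightarrow> new a X = neighbours G a \<inter> U"
    and step: "\<And>U a S X. I U (a # S) X \<Longrightarrow> nfs_state U (a # S) \<Longrightarrow>
      I (U - neighbours G a) (rev (desc (neighbours G a \<inter> U)) @ S) (X \<union> (neighbours G a \<inter> U))"
    and "S = a # S'" and "I U S (set vs)" and "distinct vs" and "set (a # as) \<subseteq> set vs"
    and "set vs \<inter> U = {}" and "filter (\<lambda>v. v \<notin> set (a # as)) vs = rev S'"
    and "card U + length S \<le> m"
  shows "fst ((nfs_step new ^^ m) (vs, a # as, T)) = vs @ map fst (comp_trace G U S) \<and>
    snd (snd ((nfs_step new ^^ m) (vs, a # as, T))) =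
      T \<union> {{b, v} | v h b. (v, h, b) \<in> set (comp_trace G U S)}"
  using assms(1,4-)
proof (induction arbitrary: a S' vs as T m rule: nfs_state_induct[where G = G])
  case (active U a0 S0)
  have [simp]: "a0 = a" "S0 = S'" using active(3) by auto
  have fin: "finite U" and st: "nfs_state U (a # S')" using active(1) by (auto simp: nfs_state_def)
  define D where "D = neighbours G a \<inter> U"
  have finD: "finite D" using fin by (simp add: D_def)
  define us where "us = desc D"
  have us: "set us = D" "distinct us" "length us = card D" using finD by (simp_all add: us_def)
  define U2 S2 where "U2 = U - neighbours G a" and "S2 = rev us @ S'"
  have new_a: "new a (set vs) = D" unfolding D_def using new active(4) st by simp
  have us_vs: "set us \<inter> set vs = {}" using active(7) us by (auto simp: D_def)
  obtain m' where m: "m = Suc m'" using active(9) by (cases m) auto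
  have card: "card U2 + length S2 \<le> m'"
  proof -
    have "card U2 + card D = card U"
      unfolding U2_def D_def
      using fin by (metis Int_commute card_Diff_subset_Int card_mono finite_Int inf_le1 le_add_diff_inverse2)
    then show ?thesis using active(9) m us by (simp add: S2_def)
  qed
  have ws: "filter (\<lambda>v. v \<notin> set (a # as)) (vs @ us) = rev S' @ us"
  proof -
    have "filter (\<lambda>v. v \<notin> set (a # as)) us = us"
      using active(6) us_vs by (intro filter_True) auto
    then show ?thesis using active(8) by simp
  qed
  define T2 where "T2 = T \<union> {{a, u} | u. u \<in> set us}"
  have step_eq: "nfs_step new (vs, a # as, T) = (vs @ us,
      (if us \<noteq> [] then last us # a # as else if S' \<noteq> [] then hd S' # a # as else a # as), T2)"
  proof -
    have "us = [] \<Longrightarrow> filter (\<lambda>v. v \<notin> set (a # as)) vs = rev S'" by (rule active(8))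
    then show ?thesis
      unfolding nfs_step_def T2_def Let_def prod.case list.sel new_a desc_def[symmetric] us_def[symmetric] ws
      by (auto simp: last_rev)
  qed
  have child: "{{b, v} | v h b. (v, h, b) \<in> set (child_entries a (Suc n) us)} = {{a, u} | u. u \<in> set us}" for n
  proof -
    have "\<exists>h. (v, h, a) \<in> set (child_entries a (Suc n) us)" if "v \<in> set us" for v
    proof -
      from that obtain i where "i < length us" "us ! i = v" by (auto simp: in_set_conv_nth)
      thus ?thesis by (intro exI[of _ "Suc n + i"]) (auto simp: mem_child_entries)
    qed
    moreover have "v \<in> set us \<and> b = a" if "(v, h, b) \<in> set (child_entries a (Suc n) us)" for v h b
      using that by (auto simp: mem_child_entries intro!: nth_mem)
    ultimately show ?thesis by blast
  qed
  have ct: "comp_trace G U (a # S') = child_entries a (Suc (length S')) us @ comp_trace G U2 S2"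
    by (simp add: comp_trace_active fin us_def D_def U2_def S2_def)
  have ct_edges: "{{b, v} | v h b. (v, h, b) \<in> set (comp_trace G U (a # S'))} =
      {{a, u} | u. u \<in> set us} \<union> {{b, v} | v h b. (v, h, b) \<in> set (comp_trace G U2 S2)}"
    unfolding ct child[of "length S'", symmetric] set_append by blast
  show ?case
  proof (cases "S2 = []")
    case True
    then have e: "us = []" "S' = []" by (simp_all add: S2_def)
    then have T2: "T2 = T" by (simp add: T2_def)
    \<comment> \<open>An empty stack after the step means that the component is exhausted; the state
      is then a fixed point and the remaining iterations do nothing.\<close>
    have fixp: "nfs_step new (vs, a # as, T) = (vs, a # as, T)" using step_eq e T2 by simp
    have "(nfs_step new ^^ k) (vs, a # as, T) = (vs, a # as, T)" for k
      by (induction k) (auto simp: fixp)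
    moreover have "comp_trace G U (a # S') = []" using ct e True by simp
    ultimately show ?thesis using e by simp
  next
    case False
    define a2 S3 where "a2 = hd S2" and "S3 = tl S2"
    have S2: "S2 = a2 # S3" using False by (simp add: a2_def S3_def)
    have a2: "us \<noteq> [] \<Longrightarrow> a2 = last us" "us = [] \<Longrightarrow> a2 = hd S'"
      by (simp_all add: a2_def S2_def hd_append hd_rev)
    have step_eq': "nfs_step new (vs, a # as, T) = (vs @ us, a2 # a # as, T2)"
      using step_eq False a2 by (auto simp: S2_def)
    have a2_mem: "a2 \<in> set (vs @ us)"
    proof (cases "us = []")
      case True
      then have "S' \<noteq> []" using False by (simp add: S2_def)
      then have "hd S' \<in> set (rev S')" by simp
      then have "hd S' \<in> set vs" using active(8) by (metis filter_is_subset subsetD)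
      then show ?thesis using True a2 by simp
    qed (use a2 in simp)
    have filt: "filter (\<lambda>v. v \<notin> set (a2 # a # as)) (vs @ us) = rev S3"
    proof -
      have "filter (\<lambda>v. v \<notin> set (a2 # a # as)) (vs @ us) =
          filter (\<lambda>v. v \<noteq> a2) (filter (\<lambda>v. v \<notin> set (a # as)) (vs @ us))"
        by (simp add: conj_commute)
      also have "\<dots> = filter (\<lambda>v. v \<noteq> a2) (rev S2)"
        unfolding ws by (simp add: S2_def)
      also have "\<dots> = filter (\<lambda>v. v \<noteq> a2) (rev S3)" by (simp add: S2)
      also have "\<dots> = rev S3"
      proof -
        have "distinct S2" using nfs_state_active[OF st, of G] 
          by (simp add: nfs_state_def S2_def us_def D_def)
        then show ?thesis unfolding S2 by (intro filter_True) auto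
      qed
      finally show ?thesis .
    qed
    have "fst ((nfs_step new ^^ m') (vs @ us, a2 # a # as, T2)) = (vs @ us) @ map fst (comp_trace G U2 S2) \<and>
      snd (snd ((nfs_step new ^^ m') (vs @ us, a2 # a # as, T2))) =
        T2 \<union> {{b, v} | v h b. (v, h, b) \<in> set (comp_trace G U2 S2)}"
    proof (rule active(2)[unfolded \<open>a0 = a\<close> \<open>S0 = S'\<close>, folded D_def, folded us_def, folded S2_def U2_def])
      show "S2 = a2 # S3" by (rule S2)
      show "I U2 S2 (set (vs @ us))"
        using step[of U a S' "set vs"] active(4) st
        by (simp add: U2_def S2_def us_def D_def finD[unfolded D_def])
      show "distinct (vs @ us)" using active(5) us us_vs by auto
      show "set (a2 # a # as) \<subseteq> set (vs @ us)" using a2_mem active(6) by auto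
      show "set (vs @ us) \<inter> U2 = {}" using active(7) us by (auto simp: U2_def D_def)
      show "filter (\<lambda>v. v \<notin> set (a2 # a # as)) (vs @ us) = rev S3" by (rule filt)
      show "card U2 + length S2 \<le> m'" by (rule card)
    qed
    moreover have "(nfs_step new ^^ m) (vs, a # as, T) = (nfs_step new ^^ m') (vs @ us, a2 # a # as, T2)"
      unfolding m funpow_Suc_right comp_apply step_eq' ..
    moreover have "vs @ map fst (comp_trace G U (a # S')) = (vs @ us) @ map fst (comp_trace G U2 S2)"
      by (simp add: ct)
    ultimately show ?thesis unfolding \<open>a0 = a\<close> \<open>S0 = S'\<close> ct_edges by (simp add: T2_def Un_assoc)
  qed
qed auto

lemma component_refl [simp]: "v \<in> component E v"
  by (simp add: component_def)

lemma adjacency_sym: "sym (adjacency E)"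
  by (auto simp: sym_def insert_commute)

lemma component_eq:
  assumes "u \<in> component E v" shows "component E u = component E v"
proof -
  have "(v, u) \<in> (adjacency E)\<^sup>*" using assms by (simp add: component_def)
  moreover from this have "(u, v) \<in> (adjacency E)\<^sup>*"
    using sym_rtrancl[OF adjacency_sym] by (rule symD[rotated])
  ultimately show ?thesis unfolding component_def by (auto intro: rtrancl_trans)
qed

lemma component_subset:
  assumes "\<And>x y. x \<in> A \<Longrightarrow> {x, y} \<in> E \<Longrightarrow> y \<in> A" and "v \<in> A"
  shows "component E v \<subseteq> A"
proof
  fix u assume "u \<in> component E v"
  then have "(v, u) \<in> (adjacency E)\<^sup>*" by (simp add: component_def)
  then show "u \<in> A" by (induction rule: rtrancl_induct) (use assms in auto)
qed

lemma component_comp_trace: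
  assumes "finite U" and "\<And>x y. x \<in> U \<Longrightarrow> {x, y} \<in> G \<Longrightarrow> y \<in> U" and "r \<in> U"
  shows "component G r = insert r (fst ` set (comp_trace G (U - {r}) [r]))"
proof
  have st: "nfs_state (U - {r}) [r]" using assms by (simp add: nfs_state_def)
  let ?C = "fst ` set (comp_trace G (U - {r}) [r])"
  show "component G r \<subseteq> insert r ?C"
  proof (rule component_subset)
    fix x y assume x: "x \<in> insert r ?C" and xy: "{x, y} \<in> G"
    have "x \<in> U" using x comp_trace_nodes[OF st, of G] assms(3) by blast
    then have "y \<in> U" using assms(2) xy by blast
    then show "y \<in> insert r ?C" using comp_trace_closed[OF st, of x G y] x xy by auto
  qed simp
  show "insert r ?C \<subseteq> component G r"
    using comp_trace_reachable[OF st, of _ G] by (auto simp: component_def)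
qed

lemma desc_insert:
  assumes "finite B" "\<And>b. b \<in> B \<Longrightarrow> b < r" shows "desc (insert r B) = r # desc B"
proof -
  have "sorted_wrt (>) (r # desc B)" using assms sorted_desc by auto
  from desc_unique[OF this] show ?thesis using assms by simp
qed

text \<open>Each round removes the component of \<open>Max U\<close> from \<open>U\<close>, which
  leaves a set closed under edges, while the search of a single component is always described
  relative to the full set \<open>W\<close>. The maximum of \<open>U\<close> is also the maximum of
  its component, so the roots appear in decreasing order.\<close>

lemma trace_components:
  assumes "finite W" and "\<And>x y. x \<in> W \<Longrightarrow> {x, y} \<in> G \<Longrightarrow> y \<in> W"
    and "U \<subseteq> W" and "\<And>x y. x \<in> U \<Longrightarrow> {x, y} \<in> G \<Longrightarrow> y \<in> U"
  shows "nfs_trace G U [] =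
    concat (map (\<lambda>r. (r, 0, r) # comp_trace G (W - {r}) [r]) (desc (Max ` component G ` U)))"
  using assms(3,4)
proof (induction "card U" arbitrary: U rule: less_induct)
  case less
  have fin: "finite U" using less assms finite_subset by blast
  show ?case
  proof (cases "U = {}")
    case False
    define r where "r = Max U"
    have r: "r \<in> U" using fin False by (simp add: r_def)
    define A where "A = component G r"
    define C where "C = comp_trace G (U - {r}) [r]"
    have st: "nfs_state (U - {r}) [r]" using fin by (simp add: nfs_state_def)
    have A: "A = insert r (fst ` set C)"
      unfolding A_def C_def by (rule component_comp_trace[OF fin less(3) r])
    have AU: "A \<subseteq> U" unfolding A_def by (rule component_subset) (use less(3) r in auto)
    have CW: "comp_trace G (W - {r}) [r] = C"
      unfolding C_def
    proof (rule comp_trace_cong)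
      show "nfs_state (W - {r}) [r]" using assms by (simp add: nfs_state_def)
      show "{x, y} \<notin> G" if "x \<in> U - {r} \<union> set [r]" "y \<in> W - {r} - (U - {r})" for x y
        using that less(3)[of x y] r by auto
    qed (use st less in auto)
    define U2 where "U2 = U - A"
    have closed: "y \<in> U2" if "x \<in> U2" "{x, y} \<in> G" for x y
    proof -
      have "y \<in> U" using that less(3) by (auto simp: U2_def)
      moreover have "y \<notin> A"
      proof
        assume "y \<in> A"
        then have "component G y = A" by (simp add: A_def component_eq)
        moreover have "x \<in> component G y" using that by (auto simp: component_def insert_commute)
        ultimately show False using that by (simp add: U2_def)
      qed
      ultimately show ?thesis by (simp add: U2_def)
    qed
    have "card U2 < card U" using fin r by (intro psubset_card_mono) (auto simp: U2_def A)
    then have IH: "nfs_trace G U2 [] = concat (map (\<lambda>r. (r, 0, r) # comp_trace G (W - {r}) [r])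
      (desc (Max ` component G ` U2)))"
      by (rule less(1)) (use less(2) U2_def closed in blast)+
    have "U - {r} - fst ` set C = U2" by (auto simp: U2_def A)
    then have T: "nfs_trace G U [] = (r, 0, r) # C @ nfs_trace G U2 []"
      using trace_split_component[OF st, of G] fin False
      by (simp add: trace_root C_def[symmetric] r_def[symmetric])
    have "U = A \<union> U2" using AU by (auto simp: U2_def)
    moreover have "component G ` A = {A}" using r by (auto simp: A_def component_eq intro!: image_eqI[of _ _ r])
    moreover have "Max A = r"
      using AU fin A by (intro Max_eqI) (auto simp: r_def intro: finite_subset)
    ultimately have img: "Max ` component G ` U = insert r (Max ` component G ` U2)"
      by (simp add: image_Un)
    have "desc (Max ` component G ` U) = r # desc (Max ` component G ` U2)"
      unfolding img
    proof (rule desc_insert)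
      fix b assume "b \<in> Max ` component G ` U2"
      then obtain v where v: "v \<in> U2" "b = Max (component G v)" by blast
      have sub: "component G v \<subseteq> U2" by (rule component_subset) (use closed v in auto)
      then have "finite (component G v)" using fin finite_subset by (fastforce simp: U2_def)
      then have "b \<in> U2" using v sub Max_in[of "component G v"] component_refl[of v G] by blast
      then show "b < r" using fin by (auto simp: U2_def A r_def less_le)
    qed (use fin in \<open>simp add: U2_def\<close>)
    then show ?thesis using T IH CW by simp
  qed (auto)
qed

section \<open>Forests given by parent pointers\<close>

text \<open>Links forests given by parents to the path-based notions of root, parent and cane path.
  \<open>rank\<close> decreases towards the roots and excludes cycles; \<open>root_larger\<close>
  makes each root the maximum of its component. The intended rank is the position in the search
  order.\<close>

locale parent_forest =
  fixes V R :: "nat set" and par rank :: "nat \<Rightarrow> nat" and F :: edge_set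
  assumes finite_V: "finite V"
    and roots_subset: "R \<subseteq> V"
    and par_mem: "\<And>v. v \<in> V - R \<Longrightarrow> par v \<in> V"
    and rank_par: "\<And>v. v \<in> V - R \<Longrightarrow> rank (par v) < rank v"
    and edges: "F = {{par v, v} | v. v \<in> V - R}"
    and root_larger: "\<And>r v. r \<in> R \<Longrightarrow> v \<in> V \<Longrightarrow> rank r < rank v \<Longrightarrow> v < r"
begin

lemma edge_iff: "{x, y} \<in> F \<longleftrightarrow> (x \<in> V - R \<and> y = par x) \<or> (y \<in> V - R \<and> x = par y)"
  unfolding edges by (auto simp: doubleton_eq_iff)

text \<open>On a cycle, take a node of maximal rank: both of its neighbours on the cycle must be its
  parent, so they coincide, which is impossible for at least three distinct nodes.\<close>

lemma no_cycle: "\<not> is_cycle F p"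
proof
  assume c: "is_cycle F p"
  define n where "n = length p"
  have n: "n \<ge> 3" and d: "distinct p" using c by (auto simp: is_cycle_def is_path_def n_def)
  then have "p \<noteq> []" by (auto simp: n_def)
  have e: "{p ! i, p ! (Suc i mod n)} \<in> F" if "i < n" for i
  proof (cases "Suc i = n")
    case True
    then have "length p - 1 = i" by (simp add: n_def)
    then have "p ! i = last p" "p ! (Suc i mod n) = hd p"
      using \<open>p \<noteq> []\<close> True by (simp_all add: last_conv_nth hd_conv_nth)
    then show ?thesis using c by (simp add: is_cycle_def)
  next
    case False
    then show ?thesis using that c
      by (auto simp: is_cycle_def is_path_def successively_conv_nth n_def)
  qed
  have "Max (rank ` set p) \<in> rank ` set p" using \<open>p \<noteq> []\<close> by (intro Max_in) auto
  then obtain i where i: "i < n" "rank (p ! i) = Max (rank ` set p)"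
    by (auto simp: in_set_conv_nth n_def)
  have par_eq: "y = par (p ! i)" if "{p ! i, y} \<in> F" "y \<in> set p" for y
  proof -
    have "rank y \<le> rank (p ! i)" using that i by simp
    then show ?thesis using that(1) rank_par[of y] by (auto simp: edge_iff)
  qed
  \<comment> \<open>The cyclic predecessor of \<open>i\<close>; adding \<open>n - 1\<close> avoids a
    subtraction below 0.\<close>
  define j where "j = (i + (n - 1)) mod n"
  have j: "j < n" "Suc j mod n = i"
  proof -
    show "j < n" using n by (simp add: j_def)
    have "Suc j mod n = (i + n) mod n" using n by (simp add: j_def mod_Suc_eq)
    then show "Suc j mod n = i" using i by simp
  qed
  have k: "Suc i mod n < n" using n by simp
  have "p ! (Suc i mod n) = par (p ! i)" using e[OF i(1)] k by (intro par_eq) (auto simp: n_def)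
  moreover have "p ! j = par (p ! i)"
    using e[OF j(1)] j by (intro par_eq) (auto simp: n_def insert_commute)
  ultimately have "p ! (Suc i mod n) = p ! j" by simp
  then have "Suc i mod n = j" using d j k by (simp add: nth_eq_iff_index_eq n_def)
  then have "Suc (Suc i mod n) mod n = i" using j by simp
  then have "Suc (Suc i) mod n = i" by (simp add: mod_Suc_eq)
  then show False using i(1) n by (simp add: mod_Suc split: if_splits)
qed

function root :: "nat \<Rightarrow> nat" where
  "root v = (if v \<in> V - R then root (par v) else v)"
  by auto
termination by (relation "Wellfounded.measure rank") (use rank_par in auto)

declare root.simps [simp del]

lemma root_root [simp]: "v \<in> R \<Longrightarrow> root v = v"
  by (subst root.simps) auto

lemma root_par: "v \<in> V - R \<Longrightarrow> root v = root (par v)"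
  by (subst root.simps) auto

lemma rank_induct [consumes 1, case_names root par]:
  assumes "v \<in> V" and "\<And>v. v \<in> R \<Longrightarrow> P v"
    and "\<And>v. v \<in> V - R \<Longrightarrow> P (par v) \<Longrightarrow> P v"
  shows "P v"
  using assms(1)
proof (induction "rank v" arbitrary: v rule: less_induct)
  case less
  then show ?case using assms(2,3) rank_par par_mem by (cases "v \<in> R") auto
qed

lemma root_mem: "v \<in> V \<Longrightarrow> root v \<in> R"
  by (induction rule: rank_induct) (simp, subst root_par)

lemma rank_root: "v \<in> V \<Longrightarrow> rank (root v) \<le> rank v"
proof (induction rule: rank_induct)
  case (par v)
  then show ?case using rank_par[OF par(1)] by (simp add: root_par[OF par(1)])
qed simp

lemma root_ge: 
  assumes "v \<in> V" shows "v \<le> root v"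
proof (cases "v \<in> R")
  case False
  with assms have v: "v \<in> V - R" by blast
  then have "rank (root v) < rank v"
    using rank_par[OF v] rank_root[OF par_mem[OF v]] root_par[OF v] by simp
  then show ?thesis using root_larger[OF root_mem[OF assms] assms] by simp
qed simp

lemma up_path:
  assumes "v \<in> V"
  shows "\<exists>ps. is_path F (v # ps) \<and> last (v # ps) = root v \<and> (\<forall>u\<in>set ps. rank u < rank v)"
  using assms
proof (induction rule: rank_induct)
  case (root v)
  then show ?case by (intro exI[of _ "[]"]) (simp add: is_path_def)
next
  case (par v)
  then obtain ps where ps: "is_path F (par v # ps)" "last (par v # ps) = root (par v)"
    "\<forall>u\<in>set ps. rank u < rank (par v)" by blast
  have "is_path F (v # par v # ps)"
    using ps rank_par[OF par(1)] par(1) by (auto simp: is_path_def edge_iff)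
  then show ?case
    using ps rank_par[OF par(1)] root_par[OF par(1)] by (intro exI[of _ "par v # ps"]) auto
qed

text \<open>All nodes of a component share the value of \<open>root\<close>, and by
  \<open>root_ge\<close> none of them exceeds it.\<close>

lemma root_of_eq:
  assumes "v \<in> V" shows "root_of F v = root v"
proof -
  have sub: "component F v \<subseteq> {u \<in> V. root u = root v}"
    by (rule component_subset) (use assms par_mem root_par in \<open>auto simp: edge_iff\<close>)
  have "(v, root v) \<in> (adjacency F)\<^sup>*"
    using assms
  proof (induction rule: rank_induct)
    case (par v)
    then have "(v, par v) \<in> adjacency F" by (simp add: edge_iff)
    then show ?case using par root_par by (auto intro: converse_rtrancl_into_rtrancl)
  qed simp
  then have "root v \<in> component F v" by (simp add: component_def)
  moreover have "y \<le> root v" if "y \<in> component F v" for y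
  proof -
    from that sub have "y \<in> V" "root y = root v" by auto
    then show ?thesis using root_ge[of y] by simp
  qed
  moreover have "finite (component F v)" using sub finite_V by (auto intro: finite_subset)
  ultimately show ?thesis unfolding root_of_def by (intro Max_eqI) auto
qed

text \<open>After one step down a path keeps descending: the only way up from a node is its parent,
  which the path has just left. Hence a path that starts towards a child cannot end at the root, the
  fact behind \<open>is_parent_iff\<close>.\<close>

lemma down_path:
  assumes "is_path F (x # y # ps)" "y \<in> V - R" "x = par y"
  shows "rank y \<le> rank (last (y # ps))"
  using assms
proof (induction ps arbitrary: x y)
  case (Cons z ps)
  then have "{y, z} \<in> F" "z \<noteq> par y" "is_path F (y # z # ps)" by (simp_all add: is_path_def)
  then have z: "z \<in> V - R" "y = par z" by (simp_all add: edge_iff)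
  have "rank z \<le> rank (last (z # ps))"
    using Cons.IH[OF \<open>is_path F (y # z # ps)\<close> z] .
  then show ?case using rank_par[OF z(1)] z(2) by simp
qed simp

lemma is_parent_iff: "is_parent F p v \<longleftrightarrow> v \<in> V - R \<and> p = par v"
proof
  assume "is_parent F p v"
  then obtain ps where ps: "is_path F (v # p # ps)" "last (p # ps) = root_of F v"
    by (auto simp: is_parent_def)
  then have vp: "{v, p} \<in> F" by (simp add: is_path_def)
  show "v \<in> V - R \<and> p = par v"
  proof (rule ccontr)
    assume "\<not> (v \<in> V - R \<and> p = par v)"
    with vp have p: "p \<in> V - R" "v = par p" by (auto simp: edge_iff)
    then have v: "v \<in> V" using par_mem by blast
    have "rank p \<le> rank (root v)" using down_path[OF ps(1) p] ps(2) root_of_eq[OF v] by simp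
    then show False using rank_root[OF v] rank_par[OF p(1)] p by simp
  qed
next
  assume v: "v \<in> V - R \<and> p = par v"
  then obtain ps where ps: "is_path F (par v # ps)" "last (par v # ps) = root (par v)"
    "\<forall>u\<in>set ps. rank u < rank (par v)" using up_path[OF par_mem] by blast
  have "v \<noteq> par v" "v \<notin> set ps" using ps(3) rank_par[of v] v by auto
  moreover have "{v, par v} \<in> F" using v by (simp add: edge_iff)
  ultimately have "is_path F (v # par v # ps)" using ps(1) by (simp add: is_path_def)
  moreover have "last (par v # ps) = root_of F v"
    using ps(2) root_par[of v] root_of_eq[of v] v by (simp del: last.simps)
  ultimately show "is_parent F p v" unfolding is_parent_def using v by blast
qed

lemma children_eq: "children F a = {v \<in> V - R. par v = a}"
  by (auto simp: children_def is_parent_iff)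

section \<open>Recursive count of cane paths\<close>

lemma cane_path_3: "is_cane_path F [v, a, w] \<longleftrightarrow> is_parent F a v \<and> is_parent F a w \<and> v < w"
  by (auto simp: is_cane_path_def)

lemma cane_path_Cons:
  assumes "length p \<ge> 3"
  shows "is_cane_path F (v # p) \<longleftrightarrow> is_parent F (hd p) v \<and> is_cane_path F p"
proof -
  define m where "m = length p - 3"
  have m: "length p = Suc (Suc (Suc m))" using assms by (simp add: m_def)
  then have "hd p = p ! 0" by (cases p) auto
  with m show ?thesis by (simp add: is_cane_path_def All_less_Suc2)
qed

definition canes :: "nat \<Rightarrow> nat list set" where
  "canes v = {p. is_cane_path F p \<and> hd p = v}"

lemma canes_length: "p \<in> canes v \<Longrightarrow> length p \<ge> 3"
  by (auto simp: canes_def is_cane_path_def)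

lemma cane_path_cases:
  assumes "is_cane_path F p"
  obtains v a w where "p = [v, a, w]" | v p' where "p = v # p'" "length p' \<ge> 3"
proof -
  have "length p \<ge> 3" using assms by (simp add: is_cane_path_def)
  then obtain v a w ps where p: "p = v # a # w # ps"
    by (auto simp: numeral_3_eq_3 Suc_le_length_iff)
  then show ?thesis using that(1)[of v a w] that(2)[of v "a # w # ps"]
    by (cases ps) (auto simp: Suc_le_eq)
qed

lemma cane_path_hd:
  assumes "is_cane_path F p" shows "hd p \<in> V - R"
  using assms
proof (cases rule: cane_path_cases)
  case (1 v a w)
  with assms show ?thesis by (auto simp: cane_path_3 is_parent_iff)
next
  case (2 v p')
  with assms show ?thesis by (auto simp: cane_path_Cons is_parent_iff)
qed

lemma canes_root: "v \<notin> V - R \<Longrightarrow> canes v = {}"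
  using cane_path_hd by (auto simp: canes_def)

text \<open>The first step of a cane path from \<open>v\<close> is forced to lead to
  \<open>par v\<close>; a list of length 3 turns down there, and a longer one goes on upwards as a
  cane path of \<open>par v\<close>.\<close>

lemma canes_par:
  assumes "v \<in> V - R"
  shows "canes v = (\<lambda>w. [v, par v, w]) ` {w \<in> children F (par v). v < w} \<union> (#) v ` canes (par v)"
    (is "_ = ?B")
proof
  show "canes v \<subseteq> ?B"
  proof
    fix p assume p: "p \<in> canes v"
    then have "is_cane_path F p" by (simp add: canes_def)
    then show "p \<in> ?B"
    proof (cases rule: cane_path_cases)
      case (1 u a w)
      with p show ?thesis by (auto simp: canes_def cane_path_3 children_eq is_parent_iff)
    next
      case (2 u p')
      with p show ?thesis by (auto simp: canes_def cane_path_Cons is_parent_iff)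
    qed
  qed
  show "?B \<subseteq> canes v"
  proof
    fix p assume "p \<in> ?B"
    then consider w where "p = [v, par v, w]" "w \<in> children F (par v)" "v < w"
      | p' where "p = v # p'" "p' \<in> canes (par v)" by auto
    then show "p \<in> canes v"
    proof cases
      case 1
      then show ?thesis using assms by (auto simp: canes_def cane_path_3 children_eq is_parent_iff)
    next
      case (2 p')
      then show ?thesis using assms cane_path_Cons[OF canes_length[OF 2(2)], of v]
        by (auto simp: canes_def is_parent_iff)
    qed
  qed
qed

lemma finite_canes: "finite (canes v)"
proof (cases "v \<in> V")
  case True
  then show ?thesis
  proof (induction rule: rank_induct)
    case (par v)
    then show ?case using finite_V by (subst canes_par) (auto simp: children_eq)
  qed (simp add: canes_root)
qed (simp add: canes_root)

lemma num_canes_root: "v \<notin> V - R \<Longrightarrow> num_cane_paths_from F v = 0"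
  using canes_root[of v] unfolding num_cane_paths_from_def canes_def by (metis card.empty)

lemma num_canes_par:
  assumes "v \<in> V - R"
  shows "num_cane_paths_from F v =
    card {w \<in> children F (par v). v < w} + num_cane_paths_from F (par v)"
proof -
  have "finite {w \<in> children F (par v). v < w}" using finite_V by (simp add: children_eq)
  moreover have "(\<lambda>w. [v, par v, w]) ` A \<inter> (#) v ` canes (par v) = {}" for A
    using canes_length[of _ "par v"] by fastforce
  ultimately have "card (canes v) = card ((\<lambda>w. [v, par v, w]) ` {w \<in> children F (par v). v < w}) +
      card ((#) v ` canes (par v))"
    unfolding canes_par[OF assms] by (intro card_Un_disjoint) (auto simp: finite_canes)
  also have "card ((\<lambda>w. [v, par v, w]) ` {w \<in> children F (par v). v < w}) = card {w \<in> children F (par v). v < w}"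
    by (intro card_image) (auto simp: inj_on_def)
  also have "card ((#) v ` canes (par v)) = card (canes (par v))"
    by (intro card_image) (auto simp: inj_on_def)
  finally show ?thesis by (simp add: num_cane_paths_from_def canes_def)
qed

lemma num_cane_paths_eq: "num_cane_paths F = (\<Sum>v\<in>V. num_cane_paths_from F v)"
proof -
  have "{p. is_cane_path F p} = (\<Union>v\<in>V. canes v)"
    using cane_path_hd by (auto simp: canes_def)
  then have "num_cane_paths F = card (\<Union>v\<in>V. canes v)" by (simp add: num_cane_paths_def)
  also have "\<dots> = (\<Sum>v\<in>V. card (canes v))"
    using finite_V finite_canes by (intro card_UN_disjoint) (auto simp: canes_def)
  finally show ?thesis by (simp add: num_cane_paths_from_def canes_def)
qed

end

section \<open>Search forests of labeled graphs\<close>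

abbreviation full_trace :: "nat \<Rightarrow> edge_set \<Rightarrow> nfs_entry list" where
  "full_trace N G \<equiv> nfs_trace G {1..N} []"

lemma nfs_state_full [simp]: "nfs_state {1..N} []"
  by (simp add: nfs_state_def)

lemma labeled_graph_edge:
  assumes "G \<in> labeled_graphs N" and "{x, y} \<in> G"
  shows "x \<in> {1..N}" "y \<in> {1..N}" "x \<noteq> y"
proof -
  have "{x, y} \<in> nsets {1..N} 2" using assms unfolding labeled_graphs_def complete_graph_def by blast
  then show "x \<in> {1..N}" "y \<in> {1..N}" "x \<noteq> y" unfolding doubleton_in_nsets_2 by blast+
qed

lemma component_labeled_graph:
  assumes "G \<in> labeled_graphs N" and "v \<in> {1..N}"
  shows "component G v \<subseteq> {1..N}"
  by (rule component_subset) (use assms labeled_graph_edge in blast)+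

lemma roots_subset:
  assumes "G \<in> labeled_graphs N"
  shows "set (roots N G) \<subseteq> {1..N}"
proof -
  have "Max (component G v) \<in> {1..N}" if "v \<in> {1..N}" for v
  proof -
    have "finite (component G v)"
      using component_labeled_graph[OF assms that] finite_subset by blast
    then have "Max (component G v) \<in> component G v"
      using component_refl[of v G] by (intro Max_in) blast+
    then show ?thesis using component_labeled_graph[OF assms that] by blast
  qed
  then show ?thesis by (auto simp: roots_def components_def)
qed

lemma full_trace_components:
  assumes "G \<in> labeled_graphs N"
  shows "full_trace N G =
    concat (map (\<lambda>r. (r, 0, r) # comp_trace G ({1..N} - {r}) [r]) (roots N G))"
  unfolding roots_def components_def desc_def[symmetric]
  by (rule trace_components) (use assms labeled_graph_edge in blast)+

lemma comp_trace_pos: "(v, h, a) \<in> set (comp_trace G U S) \<Longrightarrow> h > 0"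
  unfolding comp_trace_def by (auto dest: set_takeWhileD)

lemma roots_full_trace:
  assumes "G \<in> labeled_graphs N"
  shows "roots N G = map fst (filter (\<lambda>(v, h, a). h = 0) (full_trace N G))"
proof -
  have "filter (\<lambda>(v, h, a). h = 0) (comp_trace G U S) = []" for U S
    using comp_trace_pos by (auto simp: filter_empty_conv)
  then show ?thesis unfolding full_trace_components[OF assms]
    by (simp add: filter_concat map_concat comp_def)
qed

lemma num_components_full_trace:
  assumes "G \<in> labeled_graphs N"
  shows "num_components N G = length (filter (\<lambda>(v, h, a). h = 0) (full_trace N G))"
proof -
  have "inj_on Max (components N G)"
  proof (rule inj_onI)
    fix A B assume AB: "A \<in> components N G" "B \<in> components N G" "Max A = Max B"
    then obtain a b where ab: "A = component G a" "B = component G b" "a \<in> {1..N}" "b \<in> {1..N}"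
      by (auto simp: components_def)
    have "finite A" "finite B"
      using ab component_labeled_graph[OF assms] finite_subset by blast+
    then have "Max A \<in> A" "Max B \<in> B"
      using ab component_refl by (metis Max_in empty_iff)+
    then have "component G (Max A) = component G a" "component G (Max B) = component G b"
      unfolding ab(1,2) by (simp_all only: component_eq)
    then show "A = B" unfolding ab(1,2)[symmetric] AB(3) by (rule trans[OF sym])
  qed
  then have "num_components N G = card (Max ` components N G)"
    by (simp add: num_components_def card_image)
  also have "\<dots> = length (roots N G)"
    by (simp add: roots_def components_def flip: desc_def)
  finally show ?thesis by (simp add: roots_full_trace[OF assms])
qed

lemma search_forest_eq:
  assumes G: "G \<in> labeled_graphs N"
  shows "search_forest N G = tforest G {1..N} []"
proof -
  \<comment> \<open>Every neighbour of a node still to be activated is unvisited or visited in this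
    component, so discarding \<open>X\<close> and intersecting with \<open>U\<close> give the same
    set.\<close>
  define I where "I = (\<lambda>U S X. X \<inter> U = {} \<and> (\<forall>x\<in>U \<union> set S. neighbours G x \<subseteq> U \<union> X))"
  have T: "snd (snd (nfs_component (\<lambda>a X. neighbours G a - X) N r)) =
      {{b, v} | v h b. (v, h, b) \<in> set (comp_trace G ({1..N} - {r}) [r])}" if r: "r \<in> {1..N}" for r
  proof -
    have "fst ((nfs_step (\<lambda>a X. neighbours G a - X) ^^ N) ([r], [r], {})) =
        [r] @ map fst (comp_trace G ({1..N} - {r}) [r]) \<and>
      snd (snd ((nfs_step (\<lambda>a X. neighbours G a - X) ^^ N) ([r], [r], {}))) =
        {} \<union> {{b, v} | v h b. (v, h, b) \<in> set (comp_trace G ({1..N} - {r}) [r])}"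
    proof (rule nfs_step_simulation[where I = I])
      show "I ({1..N} - {r}) [r] (set [r])"
        using labeled_graph_edge[OF G] r by (auto simp: I_def neighbours_def)
      show "I (U - neighbours G a) (rev (desc (neighbours G a \<inter> U)) @ S) (X \<union> (neighbours G a \<inter> U))"
        if "I U (a # S) X" "nfs_state U (a # S)" for U a S X
        using that by (auto simp: I_def nfs_state_def)
      show "neighbours G a - X = neighbours G a \<inter> U" if "I U (a # S) X" for U a S X
        using that by (auto simp: I_def)
    qed (use r in \<open>auto simp: nfs_state_def\<close>)
    then show ?thesis by (simp add: nfs_component_def)
  qed
  have *: "(v, h, b) \<in> set (full_trace N G) \<and> h > 0 \<longleftrightarrow>
      (\<exists>r\<in>set (roots N G). (v, h, b) \<in> set (comp_trace G ({1..N} - {r}) [r]))" for v h b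
  proof -
    have "(v, h, b) \<in> set (full_trace N G) \<longleftrightarrow>
      (\<exists>r\<in>set (roots N G). (v, h, b) = (r, 0, r) \<or> (v, h, b) \<in> set (comp_trace G ({1..N} - {r}) [r]))"
      unfolding full_trace_components[OF G] set_concat set_map by simp
    then show ?thesis using comp_trace_pos[of v h b G] by (metis Pair_inject less_irrefl)
  qed
  have "tforest G {1..N} [] = (\<Union>r\<in>set (roots N G).
      {{b, v} | v h b. (v, h, b) \<in> set (comp_trace G ({1..N} - {r}) [r])})"
    unfolding tforest_def * by blast
  also have "\<dots> = search_forest N G"
    unfolding search_forest_def
    by (intro SUP_cong refl T[symmetric]) (use roots_subset[OF G] in blast)
  finally show ?thesis ..
qed

definition entry_parent :: "nfs_entry list \<Rightarrow> nat \<Rightarrow> nat" where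
  "entry_parent es v = (THE a. \<exists>h. (v, h, a) \<in> set es)"

definition entry_rank :: "nfs_entry list \<Rightarrow> nat \<Rightarrow> nat" where
  "entry_rank es v = length (takeWhile (\<lambda>u. u \<noteq> v) (map fst es))"

definition entry_roots :: "nfs_entry list \<Rightarrow> nat set" where
  "entry_roots es = {v. \<exists>a. (v, 0, a) \<in> set es}"

lemma entry_unique:
  assumes "distinct (map fst es)" "(v, h, a) \<in> set es" "(v, h', a') \<in> set es"
  shows "h' = h \<and> a' = a"
  using eq_key_imp_eq_value[OF assms] by simp

lemma entry_parent_eq:
  assumes "distinct (map fst es)" "(v, h, a) \<in> set es"
  shows "entry_parent es v = a"
  unfolding entry_parent_def
proof (rule the_equality)
  show "b = a" if "\<exists>h. (v, h, b) \<in> set es" for b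
    using that entry_unique[OF assms] by blast
qed (use assms(2) in blast)

lemma entry_roots_iff:
  assumes "distinct (map fst es)" "(v, h, a) \<in> set es"
  shows "v \<in> entry_roots es \<longleftrightarrow> h = 0"
proof
  assume "v \<in> entry_roots es"
  then obtain a' where "(v, 0, a') \<in> set es" by (auto simp: entry_roots_def)
  then show "h = 0" using entry_unique[OF assms, of 0 a'] by simp
qed (use assms(2) in \<open>auto simp: entry_roots_def\<close>)

lemma entry_rank_prefix:
  assumes "v \<in> fst ` set xs"
  shows "entry_rank (xs @ ys) v < length xs"
proof -
  have *: "length (takeWhile (\<lambda>u. u \<noteq> v) (us @ v # zs)) \<le> length us" for us zs :: "nat list"
    by (induction us) auto
  from assms obtain us e ws where "xs = us @ (v, e) # ws" by (auto simp: in_set_conv_decomp)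
  then show ?thesis
    using *[of "map fst us" "map fst (ws @ ys)"] by (simp add: entry_rank_def)
qed

lemma entry_rank_eq:
  "distinct (map fst (xs @ (v, e) # ys)) \<Longrightarrow> entry_rank (xs @ (v, e) # ys) v = length xs"
  unfolding entry_rank_def by (induction xs) auto

text \<open>The position in the trace is the rank: \<open>trace_parent\<close> places parents before
  their children, and \<open>trace_root_entry\<close> gives \<open>root_larger\<close>.\<close>

lemma parent_forest_full_trace:
  fixes N G
  defines "tr \<equiv> full_trace N G"
  shows "parent_forest {1..N} (entry_roots tr) (entry_parent tr) (entry_rank tr) (tforest G {1..N} [])"
proof
  have d: "distinct (map fst tr)" and nodes: "fst ` set tr = {1..N}"
    unfolding tr_def using trace_nodes[OF nfs_state_full] by blast+
  show "entry_roots tr \<subseteq> {1..N}" using nodes by (force simp: entry_roots_def)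
  have nonroot: "\<exists>h a xs ys. tr = xs @ (v, h, a) # ys \<and> h > 0 \<and> entry_parent tr v = a"
    if v: "v \<in> {1..N} - entry_roots tr" for v
  proof -
    from v nodes obtain h a where e: "(v, h, a) \<in> set tr" by (metis DiffD1 imageE prod.collapse)
    then have "h > 0" using v entry_roots_iff[OF d e] by auto
    moreover have "entry_parent tr v = a" by (rule entry_parent_eq[OF d e])
    moreover obtain xs ys where "tr = xs @ (v, h, a) # ys" using e by (auto simp: in_set_conv_decomp)
    ultimately show ?thesis by blast
  qed
  have par: "entry_parent tr v \<in> {1..N} \<and> entry_rank tr (entry_parent tr v) < entry_rank tr v"
    if v: "v \<in> {1..N} - entry_roots tr" for v
  proof -
    from nonroot[OF v] obtain h a xs ys where *: "tr = xs @ (v, h, a) # ys" "h > 0" "entry_parent tr v = a"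
      by blast
    then have "a \<in> fst ` set xs"
      using trace_parent[OF nfs_state_full, of G N xs v h a ys] by (simp add: tr_def)
    moreover have "fst ` set xs \<subseteq> {1..N}" using nodes * by auto
    ultimately show ?thesis
      using entry_rank_prefix[of a xs "(v, h, a) # ys"] entry_rank_eq[of xs v "(h, a)" ys] d * by auto
  qed
  show "entry_parent tr v \<in> {1..N}" "entry_rank tr (entry_parent tr v) < entry_rank tr v"
    if "v \<in> {1..N} - entry_roots tr" for v
    using par that by auto
  show "tforest G {1..N} [] = {{entry_parent tr v, v} | v. v \<in> {1..N} - entry_roots tr}"
  proof (intro subset_antisym subsetI)
    fix d' assume "d' \<in> tforest G {1..N} []"
    then obtain v h a where *: "d' = {a, v}" "(v, h, a) \<in> set tr" "h > 0"
      by (auto simp: tforest_def tr_def)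
    moreover have "v \<in> {1..N}" using * nodes by (metis fst_conv imageI)
    ultimately show "d' \<in> {{entry_parent tr v, v} | v. v \<in> {1..N} - entry_roots tr}"
      using entry_parent_eq[OF d *(2)] entry_roots_iff[OF d *(2)] by auto
  next
    fix d' assume "d' \<in> {{entry_parent tr v, v} | v. v \<in> {1..N} - entry_roots tr}"
    then obtain v where v: "d' = {entry_parent tr v, v}" "v \<in> {1..N} - entry_roots tr" by blast
    from nonroot[OF v(2)] obtain h where "(v, h, entry_parent tr v) \<in> set tr" "h > 0"
      by (metis in_set_conv_decomp)
    then show "d' \<in> tforest G {1..N} []" using v by (auto simp: tforest_def tr_def)
  qed
  show "v < r" if r: "r \<in> entry_roots tr" and v: "v \<in> {1..N}" "entry_rank tr r < entry_rank tr v" for r v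
  proof -
    from r obtain a xs ys where e: "tr = xs @ (r, 0, a) # ys"
      by (auto simp: entry_roots_def in_set_conv_decomp)
    then have "entry_rank tr r = length xs" using entry_rank_eq d by blast
    then have "v \<notin> fst ` set xs" using entry_rank_prefix[of v xs "(r, 0, a) # ys"] v e by auto
    moreover have "v \<noteq> r" using v by auto
    ultimately have "v \<in> fst ` set ys" using v nodes e by auto
    then show ?thesis using trace_root_entry[OF nfs_state_full, of G N xs r a ys] e by (auto simp: tr_def)
  qed
qed simp

lemma tforest_labeled_forest: "tforest G {1..N} [] \<in> labeled_forests N"
  using tforest_nsets[OF nfs_state_full, of G N] parent_forest.no_cycle[OF parent_forest_full_trace[of N G]]
  by (simp add: labeled_forests_def labeled_graphs_def complete_graph_def)

lemma connected_path:
  assumes "(x, y) \<in> (adjacency E)\<^sup>*"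
  shows "\<exists>p. is_path E p \<and> hd p = x \<and> last p = y"
  using assms
proof (induction rule: rtrancl_induct)
  case base
  then show ?case by (intro exI[of _ "[x]"]) (simp add: is_path_def)
next
  case (step y z)
  then obtain p where p: "is_path E p" "hd p = x" "last p = y" by blast
  show ?case
  proof (cases "z \<in> set p")
    case True
    \<comment> \<open>The walk returns to a node of the path; the path is cut there, which keeps it
      distinct.\<close>
    then obtain xs ys where e: "p = xs @ z # ys" by (auto simp: in_set_conv_decomp)
    have "is_path E (xs @ [z])" using p(1) e
      by (auto simp: is_path_def successively_append_iff)
    moreover have "hd (xs @ [z]) = x" using p(2) e by (cases xs) auto
    ultimately show ?thesis by (intro exI[of _ "xs @ [z]"]) auto
  next
    case False
    then have "is_path E (p @ [z])" using p step(2)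
      by (auto simp: is_path_def successively_append_iff)
    then show ?thesis using p by (intro exI[of _ "p @ [z]"]) (auto simp: is_path_def)
  qed
qed

text \<open>An edge missing from the search forest would close a cycle of \<open>F\<close> with the
  path that joins its ends inside the search forest. With \<open>tforest_labeled_forest\<close>, the
  labeled forests are exactly the fixed points of \<Phi>.\<close>

lemma tforest_of_forest:
  assumes F: "F \<in> labeled_forests N"
  shows "tforest F {1..N} [] = F"
proof
  show "tforest F {1..N} [] \<subseteq> F" by (rule tforest_subset[OF nfs_state_full])
  have FG: "F \<in> labeled_graphs N" and nc: "\<not> is_cycle F p" for p
    using F by (auto simp: labeled_forests_def)
  show "F \<subseteq> tforest F {1..N} []"
  proof
    fix d assume d: "d \<in> F"
    then obtain x y where xy: "d = {x, y}"
      using FG by (auto simp: labeled_graphs_def complete_graph_def elim!: nsets2_E dest!: subsetD)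
    show "d \<in> tforest F {1..N} []"
    proof (rule ccontr)
      assume n: "d \<notin> tforest F {1..N} []"
      have e: "x \<in> {1..N}" "y \<in> {1..N}" "x \<noteq> y" using labeled_graph_edge[OF FG] d xy by blast+
      have "(x, y) \<in> (adjacency (tforest F {1..N} []))\<^sup>*"
        using edge_connected_tforest[OF nfs_state_full, of x N y F] e d xy by simp
      then obtain p where p: "is_path (tforest F {1..N} []) p" "hd p = x" "last p = y"
        using connected_path by blast
      have "p \<noteq> []" using p by (simp add: is_path_def)
      obtain ps where ps: "p = x # ps" using p(2) \<open>p \<noteq> []\<close> by (cases p) auto
      have "length p \<ge> 3"
      proof (cases ps)
        case Nil
        then show ?thesis using ps p e by simp
      next
        case (Cons b qs)
        then show ?thesis using ps p n xy by (cases qs) (auto simp: is_path_def)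
      qed
      moreover have "is_path F p" using p(1) \<open>tforest F {1..N} [] \<subseteq> F\<close>
        by (auto simp: is_path_def intro: successively_mono)
      ultimately have "is_cycle F p" using p d xy by (simp add: is_cycle_def insert_commute)
      then show False using nc by blast
    qed
  qed
qed

context parent_forest
begin

text \<open>Under this invariant the unvisited neighbours of the active node are exactly its
  children, so the search of a forest by children and its search by neighbours run alike.\<close>

definition search_inv :: "nat set \<Rightarrow> nat list \<Rightarrow> bool" where
  "search_inv U S \<longleftrightarrow> (\<forall>x\<in>U \<union> set S. children F x \<subseteq> U) \<and> (\<forall>x\<in>set S. x \<in> V - R \<longrightarrow> par x \<notin> U)"

lemma neighbours_eq: "neighbours F a = children F a \<union> (if a \<in> V - R then {par a} else {})"
  by (auto simp: neighbours_def edge_iff children_eq)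

lemma search_inv_children: "search_inv U (a # S) \<Longrightarrow> children F a = neighbours F a \<inter> U"
  unfolding neighbours_eq by (auto simp: search_inv_def)

lemma search_inv_active:
  assumes st: "nfs_state U (a # S)" and inv: "search_inv U (a # S)"
  shows "search_inv (U - neighbours F a) (rev (desc (neighbours F a \<inter> U)) @ S)"
proof -
  have fin: "finite U" and a: "a \<notin> U" "a \<notin> set S" using st by (auto simp: nfs_state_def)
  have ch: "neighbours F a \<inter> U = children F a" using search_inv_children[OF inv] by simp
  have U: "U - neighbours F a = U - children F a" using ch by blast
  have S: "set (rev (desc (children F a)) @ S) = children F a \<union> set S"
    using fin by (simp add: flip: ch)
  have sub: "children F a \<subseteq> U" using ch by blast
  have "children F x \<subseteq> U - children F a" if "x \<in> U \<union> set S" for x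
  proof -
    have "x \<noteq> a" using that a by auto
    then have "children F x \<inter> children F a = {}" by (auto simp: children_eq)
    moreover have "children F x \<subseteq> U" using inv that by (auto simp: search_inv_def)
    ultimately show ?thesis by blast
  qed
  moreover have "par x \<notin> U" if "x \<in> children F a" for x using that a by (simp add: children_eq)
  ultimately show ?thesis
    using inv sub unfolding search_inv_def ch U S by auto
qed

lemma search_inv_root:
  assumes "search_inv U []" "r \<in> R" "r \<in> U"
  shows "search_inv (U - {r}) [r]"
  using assms by (auto simp: search_inv_def children_eq)

lemma card_greater_desc:
  assumes "sorted_wrt (>) us" "i < length us"
  shows "card {w \<in> set us. us ! i < (w :: nat)} = i"
proof -
  have d: "distinct us" using assms(1) by (induction us) auto
  have "{w \<in> set us. us ! i < w} = set (take i us)"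
  proof (intro subset_antisym subsetI)
    fix w assume "w \<in> {w \<in> set us. us ! i < w}"
    then obtain j where j: "j < length us" "w = us ! j" "us ! i < us ! j"
      by (auto simp: in_set_conv_nth)
    then have "j < i"
      using sorted_wrt_nth_less[OF assms(1), of i j] by (metis less_asym less_irrefl linorder_neqE_nat)
    then show "w \<in> set (take i us)" using j by (auto simp: in_set_conv_nth)
  next
    fix w assume "w \<in> set (take i us)"
    then obtain j where "j < i" "w = us ! j" by (auto simp: in_set_conv_nth)
    then show "w \<in> {w \<in> set us. us ! i < w}"
      using assms sorted_wrt_nth_less[OF assms(1), of j i] by auto
  qed
  then show ?thesis using d assms(2) by (simp add: distinct_card)
qed

text \<open>The nodes below an entry of the stack are the end points of the cane paths that start at
  that entry.\<close>

lemma num_canes_trace: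
  assumes "nfs_state U S" "search_inv U S"
    and "\<And>v a. (v, 0, a) \<in> set (nfs_trace F U S) \<Longrightarrow> v \<in> R"
    and "map (num_cane_paths_from F) S = rev [0..<length S]"
    and "(v, h, a) \<in> set (nfs_trace F U S)"
  shows "num_cane_paths_from F v = h - 1"
  using assms
proof (induction rule: nfs_state_induct[where G = F])
  case (root U)
  then have fin: "finite U" by (simp add: nfs_state_def)
  have tr: "nfs_trace F U [] = (Max U, 0, Max U) # nfs_trace F (U - {Max U}) [Max U]"
    using fin root(2) by (rule trace_root)
  have M: "Max U \<in> R" using root(6)[of "Max U" "Max U"] tr by simp
  then have 0: "num_cane_paths_from F (Max U) = 0" by (intro num_canes_root) simp
  show ?case
  proof (cases "(v, h, a) = (Max U, 0, Max U)")
    case False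
    show ?thesis
    proof (rule root(4))
      show "search_inv (U - {Max U}) [Max U]" by (rule search_inv_root[OF root(5) M root(3)])
    qed (use root(6,8) False tr 0 in auto)
  qed (use 0 in simp)
next
  case (active U b S)
  then have fin: "finite U" by (simp add: nfs_state_def)
  define us where "us = desc (neighbours F b \<inter> U)"
  have tr: "nfs_trace F U (b # S) = child_entries b (Suc (length S)) us @ nfs_trace F (U - neighbours F b) (rev us @ S)"
    unfolding us_def by (rule trace_active[OF fin])
  have us: "set us = children F b" using search_inv_children[OF active(3)] fin by (simp add: us_def)
  have b: "num_cane_paths_from F b = length S" using active(5) by simp
  \<comment> \<open>The sibling at index \<open>i\<close> has \<open>i\<close> siblings to its
    right, giving \<open>i\<close> cane paths that turn at \<open>b\<close>; the others pass through
    \<open>b\<close> and number \<open>length S\<close>.\<close>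
  have f: "num_cane_paths_from F (us ! i) = length S + i" if i: "i < length us" for i
  proof -
    have "us ! i \<in> children F b" using us i nth_mem by blast
    then have c: "us ! i \<in> V - R" "par (us ! i) = b" by (auto simp: children_eq)
    have "card {w \<in> set us. us ! i < w} = i"
      by (rule card_greater_desc) (use i in \<open>simp_all add: us_def sorted_desc\<close>)
    then show ?thesis using num_canes_par[OF c(1)] c(2) b us by simp
  qed
  have map_us: "map (num_cane_paths_from F) us = [length S..<length S + length us]"
    by (rule nth_equalityI) (auto simp: f)
  consider "(v, h, a) \<in> set (child_entries b (Suc (length S)) us)"
    | "(v, h, a) \<in> set (nfs_trace F (U - neighbours F b) (rev us @ S))"
    using active(6) tr by auto
  then show ?case
  proof cases
    case 1
    then show ?thesis using f[of "h - Suc (length S)"] by (auto simp: mem_child_entries)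
  next
    case 2
    show ?thesis
    proof (rule active(2)[folded us_def])
      show "search_inv (U - neighbours F b) (rev us @ S)"
        unfolding us_def by (rule search_inv_active[OF active(1,3)])
      have "map (num_cane_paths_from F) (rev us @ S) = rev [length S..<length S + length us] @ rev [0..<length S]"
        using active(5) map_us by (simp add: rev_map[symmetric])
      also have "\<dots> = rev [0..<length (rev us @ S)]"
        by (simp add: upt_add_eq_append[of 0 "length S" "length us", simplified] add.commute flip: rev_append)
      finally show "map (num_cane_paths_from F) (rev us @ S) = rev [0..<length (rev us @ S)]" .
    qed (use 2 active(4) tr in auto)
  qed
qed simp

end

definition root_step :: "(nat \<Rightarrow> nat) \<Rightarrow> nfs_entry \<Rightarrow> nfs_entry \<Rightarrow> bool" where
  "root_step f e e' \<longleftrightarrow> f (fst e') = (if fst (snd e') = 0 then fst e' else f (fst e))"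

lemma successively_root_step_constant:
  assumes "\<And>e. e \<in> set es \<Longrightarrow> fst (snd e) > 0 \<and> f (fst e) = r"
  shows "successively (root_step f) es"
  unfolding successively_conv_nth
proof (intro allI impI)
  fix i assume i: "Suc i < length es"
  then show "root_step f (es ! i) (es ! Suc i)"
    using assms[of "es ! i"] assms[of "es ! Suc i"] by (simp add: root_step_def)
qed

text \<open>\<open>f\<close> is meant to be the root function of the forest. All nodes on the stack
  lie in the current component and share the root \<open>r\<close>, and children inherit it, so the
  root changes only at entries of height 0. This makes the root of a position readable from the
  heights. The second conclusion carries \<open>r\<close> across the joint between children and
  later entries.\<close>

lemma trace_root_step:
  assumes "nfs_state U S" and "\<And>s. s \<in> set S \<Longrightarrow> f s = r"
    and "\<And>e. e \<in> set (nfs_trace G U S) \<Longrightarrow> f (fst e) = (if fst (snd e) = 0 then fst e else f (snd (snd e)))"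
  shows "successively (root_step f) (nfs_trace G U S)"
    "nfs_trace G U S \<noteq> [] \<Longrightarrow> fst (snd (hd (nfs_trace G U S))) > 0 \<Longrightarrow> f (fst (hd (nfs_trace G U S))) = r"
  using assms
proof (induction arbitrary: r rule: nfs_state_induct[where G = G])
  case (root U)
  then have fin: "finite U" by (simp add: nfs_state_def)
  let ?T = "nfs_trace G (U - {Max U}) [Max U]"
  have tr: "nfs_trace G U [] = (Max U, 0, Max U) # ?T" using fin root(2) by (rule trace_root)
  { case 1
    have e: "f (fst e) = (if fst (snd e) = 0 then fst e else f (snd (snd e)))"
      if "e \<in> set (nfs_trace G U [])" for e
      by (rule 1(2)[OF that])
    have M: "f (Max U) = Max U" using e[of "(Max U, 0, Max U)"] tr by simp
    have IH: "successively (root_step f) ?T"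
      "?T \<noteq> [] \<Longrightarrow> fst (snd (hd ?T)) > 0 \<Longrightarrow> f (fst (hd ?T)) = Max U"
      by (rule root(4)[of "Max U"] root(5)[of "Max U"]; use e M in \<open>simp add: tr\<close>)+
    have "root_step f (Max U, 0, Max U) (hd ?T)" if "?T \<noteq> []"
      using IH(2)[OF that] e[of "hd ?T"] that M by (auto simp: root_step_def tr)
    then show ?case unfolding tr using IH(1) by (auto simp: successively_Cons)
  next
    case 2
    then show ?case by (simp add: tr)
  }
next
  case (active U b S)
  then have fin: "finite U" by (simp add: nfs_state_def)
  let ?us = "desc (neighbours G b \<inter> U)"
  let ?C = "child_entries b (Suc (length S)) ?us"
  let ?T = "nfs_trace G (U - neighbours G b) (rev ?us @ S)"
  have tr: "nfs_trace G U (b # S) = ?C @ ?T" by (rule trace_active[OF fin])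
  have *: "successively (root_step f) (nfs_trace G U (b # S)) \<and>
    (nfs_trace G U (b # S) \<noteq> [] \<longrightarrow> fst (snd (hd (nfs_trace G U (b # S)))) > 0 \<longrightarrow>
      f (fst (hd (nfs_trace G U (b # S)))) = r)"
    if S': "\<forall>s\<in>set (b # S). f s = r"
      and e': "\<forall>e\<in>set (nfs_trace G U (b # S)).
        f (fst e) = (if fst (snd e) = 0 then fst e else f (snd (snd e)))" for r
  proof -
    note S = bspec[OF S'] and e = bspec[OF e']
    have C: "fst (snd e) > 0 \<and> f (fst e) = r" if "e \<in> set ?C" for e
    proof (cases e)
      case (fields v h a)
      then have "h > 0" "a = b" using that by (auto simp: mem_child_entries)
      then show ?thesis using e[of e] that S[of b] tr fields by simp
    qed
    have "f u = r" if "u \<in> neighbours G b \<inter> U" for u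
    proof -
      have "u \<in> fst ` set ?C" using that fin by simp
      then obtain e where "e \<in> set ?C" "u = fst e" by (elim imageE)
      then show ?thesis using C by blast
    qed
    then have S': "f s = r" if "s \<in> set (rev ?us @ S)" for s using that S fin by auto
    have e': "f (fst e) = (if fst (snd e) = 0 then fst e else f (snd (snd e)))" if "e \<in> set ?T" for e
      by (rule e) (use that tr in simp)
    note IH = active(2)[OF S' e'] active(3)[OF _ _ S' e']
    have C': "successively (root_step f) ?C"
      by (rule successively_root_step_constant[where r = r]) (rule C)
    have "root_step f (last ?C) (hd ?T)" if "?C \<noteq> []" "?T \<noteq> []"
      using C[of "last ?C"] IH(2) e'[of "hd ?T"] that last_in_set[OF that(1)] hd_in_set[OF that(2)]
      by (auto simp: root_step_def)
    then have "successively (root_step f) (?C @ ?T)"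
      unfolding successively_append_iff using C' IH(1) by blast
    moreover have "f (fst (hd (?C @ ?T))) = r" if "?C @ ?T \<noteq> []" "fst (snd (hd (?C @ ?T))) > 0"
    proof (cases "?C = []")
      case True
      then show ?thesis using IH(2) that by simp
    next
      case False
      then show ?thesis using C[OF hd_in_set[OF False]] by (simp only: hd_append if_False)
    qed
    ultimately show ?thesis unfolding tr by blast
  qed
  { case 1
    then have "\<forall>s\<in>set (b # S). f s = r" "\<forall>e\<in>set (nfs_trace G U (b # S)).
        f (fst e) = (if fst (snd e) = 0 then fst e else f (snd (snd e)))" by blast+
    then show ?case using * by blast
  next
    case 2
    then have "\<forall>s\<in>set (b # S). f s = r" "\<forall>e\<in>set (nfs_trace G U (b # S)).
        f (fst e) = (if fst (snd e) = 0 then fst e else f (snd (snd e)))" by blast+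
    then show ?case using * 2(1,2) by blast }
qed auto

lemma (in parent_forest) search_inv_full: "search_inv V []"
  by (auto simp: search_inv_def children_eq)

section \<open>Codings of forests by positions\<close>

definition nfs_label :: "nat \<Rightarrow> edge_set \<Rightarrow> nat \<Rightarrow> nat" where
  "nfs_label N F p = fst (full_trace N F ! p)"

definition nfs_height :: "nat \<Rightarrow> edge_set \<Rightarrow> nat \<Rightarrow> nat" where
  "nfs_height N F p = fst (snd (full_trace N F ! p))"

text \<open>The last zero of \<open>h\<close> up to \<open>p\<close>: components occupy consecutive
  positions, each starting with its root.\<close>

primrec root_pos :: "(nat \<Rightarrow> nat) \<Rightarrow> nat \<Rightarrow> nat" where
  "root_pos h 0 = 0"
| "root_pos h (Suc p) = (if h (Suc p) = 0 then Suc p else root_pos h p)"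

text \<open>The indexed form of \<open>valid_code\<close> with positions 0, ..., n. Labels and
  heights are total functions, constrained only up to position \<open>n\<close>.\<close>

definition nfs_coding :: "nat \<Rightarrow> (nat \<Rightarrow> nat) \<Rightarrow> (nat \<Rightarrow> nat) \<Rightarrow> bool" where
  "nfs_coding n v h \<longleftrightarrow> bij_betw v {..n} {1..n + 1} \<and> h 0 = 0 \<and>
     (\<forall>p<n. h (Suc p) \<le> Suc (h p) \<and> (h (Suc p) = Suc (h p) \<longrightarrow> v (Suc p) < v p)) \<and>
     (\<forall>p p'. p < p' \<and> p' \<le> n \<and> h p = 0 \<longrightarrow> v p' < v p)"

lemma full_trace_nodes:
  "distinct (map fst (full_trace N G))" "fst ` set (full_trace N G) = {1..N}"
  "length (full_trace N G) = N"
proof -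
  show d: "distinct (map fst (full_trace N G))" and s: "fst ` set (full_trace N G) = {1..N}"
    using trace_nodes[OF nfs_state_full] by blast+
  have "length (full_trace N G) = card (set (map fst (full_trace N G)))"
    using distinct_card[OF d] by simp
  also have "set (map fst (full_trace N G)) = {1..N}" unfolding set_map by (rule s)
  finally show "length (full_trace N G) = N" by simp
qed

lemma nfs_label_bij: "bij_betw (nfs_label N G) {..<N} {1..N}"
proof -
  have "bij_betw ((!) (map fst (full_trace N G))) {..<N} (set (map fst (full_trace N G)))"
    using full_trace_nodes(1,3)[of G N] by (intro bij_betw_nth) auto
  moreover have "set (map fst (full_trace N G)) = {1..N}" unfolding set_map by (rule full_trace_nodes)
  moreover have "bij_betw ((!) (map fst (full_trace N G))) {..<N} A \<longleftrightarrow> bij_betw (nfs_label N G) {..<N} A" for A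
    using full_trace_nodes(3)[of G N] by (intro bij_betw_cong) (simp add: nfs_label_def)
  ultimately show ?thesis by simp
qed

lemma full_trace_nth:
  "p < N \<Longrightarrow> \<exists>a. full_trace N G ! p = (nfs_label N G p, nfs_height N G p, a)"
  by (metis nfs_label_def nfs_height_def prod.collapse)

lemma nfs_coding_full_trace: "nfs_coding n (nfs_label (n + 1) G) (nfs_height (n + 1) G)"
proof -
  let ?tr = "full_trace (n + 1) G"
  have len: "length ?tr = n + 1" by (rule full_trace_nodes)
  have "?tr \<noteq> []" using len by auto
  then have "nfs_height (n + 1) G 0 = 0"
    using trace_successively(2)[OF nfs_state_full, of G "n + 1"] by (simp add: nfs_height_def hd_conv_nth)
  moreover have "bij_betw (nfs_label (n + 1) G) {..n} {1..n + 1}"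
    using nfs_label_bij[of "n + 1" G] by (simp add: lessThan_Suc_atMost)
  moreover have "nfs_height (n + 1) G (Suc p) \<le> Suc (nfs_height (n + 1) G p) \<and>
    (nfs_height (n + 1) G (Suc p) = Suc (nfs_height (n + 1) G p) \<longrightarrow>
      nfs_label (n + 1) G (Suc p) < nfs_label (n + 1) G p)" if "p < n" for p
  proof -
    have "entry_step (?tr ! p) (?tr ! Suc p)"
      using trace_successively(1)[OF nfs_state_full, of G "n + 1"] that len
      unfolding successively_conv_nth by simp
    then show ?thesis by (auto simp: entry_step_def nfs_height_def nfs_label_def case_prod_unfold)
  qed
  moreover have "nfs_label (n + 1) G p' < nfs_label (n + 1) G p"
    if p: "p < p'" "p' \<le> n" "nfs_height (n + 1) G p = 0" for p p'
  proof -
    obtain a where e: "?tr ! p = (nfs_label (n + 1) G p, 0, a)"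
      using full_trace_nth[of p "n + 1" G] p by auto
    then have "?tr = take p ?tr @ (nfs_label (n + 1) G p, 0, a) # drop (Suc p) ?tr"
      using id_take_nth_drop[of p ?tr] p len by simp
    from trace_root_entry[OF nfs_state_full this]
    have "\<forall>e\<in>set (drop (Suc p) ?tr). fst e < nfs_label (n + 1) G p" by blast
    moreover have "?tr ! p' \<in> set (drop (Suc p) ?tr)"
    proof -
      have "drop (Suc p) ?tr ! (p' - Suc p) = ?tr ! p'" using p len by simp
      moreover have "p' - Suc p < length (drop (Suc p) ?tr)" using p len by simp
      ultimately show ?thesis using nth_mem by metis
    qed
    ultimately show ?thesis by (simp add: nfs_label_def)
  qed
  ultimately show ?thesis unfolding nfs_coding_def by blast
qed

text \<open>\<open>ex_trace_of_code\<close> supplies some graph with the given code; its search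
  forest has the same trace. Together with \<open>nfs_coding_full_trace\<close> and
  \<open>forest_eqI\<close> this makes codings, restricted to positions up to \<open>n\<close>,
  correspond to labeled forests one to one.\<close>

lemma forest_of_coding:
  assumes "nfs_coding n v h"
  shows "\<exists>F\<in>labeled_forests (n + 1). \<forall>p\<le>n. nfs_label (n + 1) F p = v p \<and> nfs_height (n + 1) F p = h p"
proof -
  define cs where "cs = map (\<lambda>p. (v p, h p)) [0..<n + 1]"
  have len: "length cs = n + 1" by (simp add: cs_def)
  have nth: "cs ! p = (v p, h p)" if "p \<le> n" for p using that by (simp add: cs_def del: upt_Suc)
  have bij: "bij_betw v {..n} {1..n + 1}" using assms by (simp add: nfs_coding_def)
  have vc: "valid_code cs"
    unfolding valid_code_def
  proof (intro conjI allI impI)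
    have "{0..<n + 1} = {..n}" by auto
    then show "distinct (map fst cs)"
      using bij by (simp add: cs_def comp_def distinct_map bij_betw_def del: upt_Suc)
    show "successively code_step cs"
      unfolding successively_conv_nth using assms len nth
      by (auto simp: code_step_def nfs_coding_def)
    fix xs w ys assume e: "cs = xs @ (w, 0) # ys"
    have lx: "length xs \<le> n" using e len by simp
    have w: "w = v (length xs)" "h (length xs) = 0" using nth[OF lx] e by auto
    show "\<forall>c\<in>set ys. fst c < w"
    proof
      fix c assume "c \<in> set ys"
      then obtain i where i: "i < length ys" "c = ys ! i" by (auto simp: in_set_conv_nth)
      have le: "Suc (length xs + i) \<le> n" using e len i by simp
      have "cs ! Suc (length xs + i) = c" using e i by (simp add: nth_append)
      then have "c = (v (Suc (length xs + i)), h (Suc (length xs + i)))" using nth[OF le] by simp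
      moreover have "v (Suc (length xs + i)) < v (length xs)"
        using assms w(2) le unfolding nfs_coding_def by (metis le_add1 le_imp_less_Suc)
      ultimately show "fst c < w" using w by simp
    qed
  qed
  have "fst ` set cs = v ` {..n}" 
    by (auto simp: cs_def image_image atLeast0LessThan lessThan_Suc_atMost simp del: upt_Suc)
  then have img: "fst ` set cs = {1..n + 1}" using bij by (simp add: bij_betw_def)
  have "cs \<noteq> []" using len by auto
  then have "snd (hd cs) \<le> length []" using nth[of 0] assms by (simp add: hd_conv_nth nfs_coding_def)
  then obtain G where G: "map entry_code (full_trace (n + 1) G) = cs"
    using ex_trace_of_code[OF nfs_state_full vc img] by blast
  define F where "F = tforest G {1..n + 1} []"
  have "full_trace (n + 1) F = full_trace (n + 1) G"
    unfolding F_def by (rule trace_tforest[OF nfs_state_full])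
  with G have F: "map entry_code (full_trace (n + 1) F) = cs" by simp
  have "nfs_label (n + 1) F p = v p \<and> nfs_height (n + 1) F p = h p" if p: "p \<le> n" for p
  proof -
    have "entry_code (full_trace (n + 1) F ! p) = (v p, h p)"
      using nth[OF p] p full_trace_nodes(3)[of F "n + 1"] unfolding F[symmetric] by simp
    then show ?thesis by (simp add: nfs_label_def nfs_height_def entry_code_def case_prod_unfold)
  qed
  moreover have "F \<in> labeled_forests (n + 1)" unfolding F_def by (rule tforest_labeled_forest)
  ultimately show ?thesis by blast
qed

lemma forest_eqI:
  assumes "F \<in> labeled_forests (n + 1)" "F' \<in> labeled_forests (n + 1)"
    and "\<And>p. p \<le> n \<Longrightarrow> nfs_label (n + 1) F p = nfs_label (n + 1) F' p"
    and "\<And>p. p \<le> n \<Longrightarrow> nfs_height (n + 1) F p = nfs_height (n + 1) F' p"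
  shows "F = F'"
proof -
  have "map entry_code (full_trace (n + 1) F) = map entry_code (full_trace (n + 1) F')"
  proof (rule nth_equalityI)
    fix p assume "p < length (map entry_code (full_trace (n + 1) F))"
    then have p: "p \<le> n" using full_trace_nodes(3)[of F "n + 1"] by simp
    then show "map entry_code (full_trace (n + 1) F) ! p = map entry_code (full_trace (n + 1) F') ! p"
      using assms(3,4)[OF p] full_trace_nodes(3)[of _ "n + 1"]
      by (simp add: nfs_label_def nfs_height_def entry_code_def case_prod_unfold)
  qed (use full_trace_nodes(3) in simp)
  then have "full_trace (n + 1) F = full_trace (n + 1) F'"
    by (rule trace_eq_if_code_eq[OF nfs_state_full])
  then have "tforest F {1..n + 1} [] = tforest F' {1..n + 1} []" by (simp add: tforest_def)
  then show ?thesis using tforest_of_forest assms(1,2) by metis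
qed

lemma parent_forest_forest:
  assumes "F \<in> labeled_forests N"
  shows "parent_forest {1..N} (entry_roots (full_trace N F)) (entry_parent (full_trace N F))
    (entry_rank (full_trace N F)) F"
  using parent_forest_full_trace[of N F] unfolding tforest_of_forest[OF assms] .

lemma labeled_forest_graph: "F \<in> labeled_forests N \<Longrightarrow> F \<in> labeled_graphs N"
  by (simp add: labeled_forests_def)

lemma set_roots_forest:
  assumes "F \<in> labeled_forests N"
  shows "set (roots N F) = entry_roots (full_trace N F)"
  unfolding roots_full_trace[OF labeled_forest_graph[OF assms]] entry_roots_def
  by (force simp: case_prod_unfold)

lemma nfs_order_forest:
  assumes F: "F \<in> labeled_forests N"
  shows "nfs_order N F = map fst (full_trace N F)"
proof -
  interpret pf: parent_forest "{1..N}" "entry_roots (full_trace N F)" "entry_parent (full_trace N F)"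
    "entry_rank (full_trace N F)" F
    by (rule parent_forest_forest[OF F])
  have T: "fst (nfs_component (\<lambda>a X. children F a) N r) = r # map fst (comp_trace F ({1..N} - {r}) [r])"
    if r: "r \<in> set (roots N F)" for r
  proof -
    have rR: "r \<in> entry_roots (full_trace N F)" using r set_roots_forest[OF F] by simp
    then have rN: "r \<in> {1..N}" using pf.roots_subset by blast
    have "fst ((nfs_step (\<lambda>a X. children F a) ^^ N) ([r], [r], {})) =
        [r] @ map fst (comp_trace F ({1..N} - {r}) [r]) \<and>
      snd (snd ((nfs_step (\<lambda>a X. children F a) ^^ N) ([r], [r], {}))) =
        {} \<union> {{b, v} | v h b. (v, h, b) \<in> set (comp_trace F ({1..N} - {r}) [r])}"
    proof (rule nfs_step_simulation[where I = "\<lambda>U S X. pf.search_inv U S"])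
      show "pf.search_inv ({1..N} - {r}) [r]" by (rule pf.search_inv_root[OF pf.search_inv_full rR rN])
      show "children F a = neighbours F a \<inter> U" if "pf.search_inv U (a # S)" for U a S
        using that by (rule pf.search_inv_children)
      show "pf.search_inv (U - neighbours F a) (rev (desc (neighbours F a \<inter> U)) @ S)"
        if "pf.search_inv U (a # S)" "nfs_state U (a # S)" for U a S
        using that by (intro pf.search_inv_active)
    qed (use rN in \<open>auto simp: nfs_state_def\<close>)
    then show ?thesis by (simp add: nfs_component_def)
  qed
  have "map fst (full_trace N F) = concat (map (\<lambda>r. r # map fst (comp_trace F ({1..N} - {r}) [r])) (roots N F))"
    unfolding full_trace_components[OF labeled_forest_graph[OF F]] by (simp add: map_concat comp_def)
  also have "\<dots> = nfs_order N F"
    unfolding nfs_order_def using T by (intro arg_cong[where f = concat] map_cong) auto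
  finally show ?thesis ..
qed

lemma nfs_pos_forest:
  assumes F: "F \<in> labeled_forests N" and "p < N"
  shows "nfs_pos N F (nfs_label N F p) = p"
proof -
  let ?tr = "full_trace N F"
  obtain e where e: "?tr ! p = (nfs_label N F p, e)" by (metis nfs_label_def prod.collapse)
  have eq: "?tr = take p ?tr @ (nfs_label N F p, e) # drop (Suc p) ?tr"
    using id_take_nth_drop[of p ?tr] assms(2) full_trace_nodes(3)[of F N] e by simp
  have "entry_rank ?tr (nfs_label N F p) = length (take p ?tr)"
    by (subst eq, rule entry_rank_eq) (use full_trace_nodes(1)[of F N] eq in simp)
  then show ?thesis
    using assms(2) full_trace_nodes(3)[of F N] nfs_order_forest[OF F] by (simp add: entry_rank_def nfs_pos_def)
qed

lemma entry_roots_label: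
  assumes "p < N"
  shows "nfs_label N F p \<in> entry_roots (full_trace N F) \<longleftrightarrow> nfs_height N F p = 0"
proof -
  obtain a where "full_trace N F ! p = (nfs_label N F p, nfs_height N F p, a)"
    using full_trace_nth[OF assms] by blast
  then have "(nfs_label N F p, nfs_height N F p, a) \<in> set (full_trace N F)"
    using nth_mem[of p "full_trace N F"] assms full_trace_nodes(3)[of F N] by simp
  then show ?thesis by (rule entry_roots_iff[OF full_trace_nodes(1)])
qed

lemma num_canes_forest:
  assumes F: "F \<in> labeled_forests N" and "p < N"
  shows "num_cane_paths_from F (nfs_label N F p) = nfs_height N F p - 1"
proof -
  interpret pf: parent_forest "{1..N}" "entry_roots (full_trace N F)" "entry_parent (full_trace N F)"
    "entry_rank (full_trace N F)" F
    by (rule parent_forest_forest[OF F])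
  obtain a where "full_trace N F ! p = (nfs_label N F p, nfs_height N F p, a)"
    using full_trace_nth[OF assms(2)] by blast
  then have e: "(nfs_label N F p, nfs_height N F p, a) \<in> set (full_trace N F)"
    using nth_mem[of p "full_trace N F"] assms full_trace_nodes(3)[of F N] by simp
  show ?thesis
    by (rule pf.num_canes_trace[OF nfs_state_full pf.search_inv_full _ _ e]) (auto simp: entry_roots_def)
qed

lemma root_of_forest:
  assumes F: "F \<in> labeled_forests N" and "p < N"
  shows "root_of F (nfs_label N F p) = nfs_label N F (root_pos (nfs_height N F) p)"
proof -
  interpret pf: parent_forest "{1..N}" "entry_roots (full_trace N F)" "entry_parent (full_trace N F)"
    "entry_rank (full_trace N F)" F
    by (rule parent_forest_forest[OF F])
  let ?tr = "full_trace N F"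
  have e: "root_of F (fst e) = (if fst (snd e) = 0 then fst e else root_of F (snd (snd e)))"
    if "e \<in> set ?tr" for e
  proof -
    obtain v h a where eq: "e = (v, h, a)" using prod_cases3 by blast
    have vh: "(v, h, a) \<in> set ?tr" using that eq by simp
    have "v \<in> fst ` set ?tr" using vh by force
    then have v: "v \<in> {1..N}" using full_trace_nodes(2)[of F N] by simp
    have R: "v \<in> entry_roots ?tr \<longleftrightarrow> h = 0" by (rule entry_roots_iff[OF full_trace_nodes(1) vh])
    show ?thesis
    proof (cases "h = 0")
      case True
      then have "pf.root v = v" using R by (intro pf.root_root) simp
      then show ?thesis using True pf.root_of_eq[OF v] eq by (simp del: One_nat_def)
    next
      case False
      then have v': "v \<in> {1..N} - entry_roots ?tr" using v R by blast
      have "entry_parent ?tr v = a" by (rule entry_parent_eq[OF full_trace_nodes(1) vh])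
      then show ?thesis
        using False eq pf.root_of_eq[OF v] pf.root_of_eq[OF pf.par_mem[OF v']] pf.root_par[OF v'] by simp
    qed
  qed
  have step: "root_step (root_of F) (?tr ! p) (?tr ! Suc p)" if "Suc p < N" for p
    using trace_root_step(1)[OF nfs_state_full _ e, of undefined] that full_trace_nodes(3)[of F N]
    unfolding successively_conv_nth by simp
  show ?thesis using assms(2)
  proof (induction p)
    case 0
    then have "?tr \<noteq> []" using full_trace_nodes(3)[of F N] by auto
    then have "fst (snd (?tr ! 0)) = 0"
      using trace_successively(2)[OF nfs_state_full, of F N] by (simp add: hd_conv_nth)
    then show ?case using e[of "?tr ! 0"] \<open>?tr \<noteq> []\<close> by (simp add: nfs_label_def)
  next
    case (Suc p)
    then show ?case using step[of p] by (auto simp: root_step_def nfs_label_def nfs_height_def)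
  qed
qed

lemma sum_nfs_label:
  fixes f :: "nat \<Rightarrow> nat"
  shows "(\<Sum>v\<in>{1..N}. f v) = (\<Sum>p<N. f (nfs_label N F p))"
  using sum.reindex_bij_betw[OF nfs_label_bij, of f N F] by simp

lemma num_cane_paths_forest:
  assumes F: "F \<in> labeled_forests N"
  shows "num_cane_paths F = (\<Sum>p<N. nfs_height N F p - 1)"
proof -
  interpret pf: parent_forest "{1..N}" "entry_roots (full_trace N F)" "entry_parent (full_trace N F)"
    "entry_rank (full_trace N F)" F
    by (rule parent_forest_forest[OF F])
  show ?thesis unfolding pf.num_cane_paths_eq sum_nfs_label[where F = F]
    using num_canes_forest[OF F] by simp
qed

lemma num_components_graph:
  assumes "G \<in> labeled_graphs N"
  shows "num_components N G = card {p. p < N \<and> nfs_height N G p = 0}"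
  unfolding num_components_full_trace[OF assms] length_filter_conv_card full_trace_nodes(3)
  by (simp add: nfs_height_def case_prod_unfold)

lemma card_forest:
  assumes F: "F \<in> labeled_forests N"
  shows "card F = card {p. p < N \<and> nfs_height N F p > 0}"
proof -
  interpret pf: parent_forest "{1..N}" "entry_roots (full_trace N F)" "entry_parent (full_trace N F)"
    "entry_rank (full_trace N F)" F
    by (rule parent_forest_forest[OF F])
  let ?R = "entry_roots (full_trace N F)"
  have "inj_on (\<lambda>v. {entry_parent (full_trace N F) v, v}) ({1..N} - ?R)"
  proof (rule inj_onI)
    fix v w assume vw: "v \<in> {1..N} - ?R" "w \<in> {1..N} - ?R"
      "{entry_parent (full_trace N F) v, v} = {entry_parent (full_trace N F) w, w}"
    \<comment> \<open>Otherwise \<open>v\<close> and \<open>w\<close> would be parents of each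
      other, against the strict decrease of the rank.\<close>
    then show "v = w"
      using pf.rank_par[OF vw(1)] pf.rank_par[OF vw(2)] by (auto simp: doubleton_eq_iff)
  qed
  moreover have "F = (\<lambda>v. {entry_parent (full_trace N F) v, v}) ` ({1..N} - ?R)"
  proof -
    have "F = {{entry_parent (full_trace N F) v, v} | v. v \<in> {1..N} - ?R}" by (rule pf.edges)
    also have "\<dots> = (\<lambda>v. {entry_parent (full_trace N F) v, v}) ` ({1..N} - ?R)" by blast
    finally show ?thesis .
  qed
  ultimately have "card F = card ({1..N} - ?R)" by (metis card_image)
  also have "{1..N} - ?R = nfs_label N F ` {p. p < N \<and> nfs_height N F p > 0}"
  proof -
    have "{1..N} = nfs_label N F ` {..<N}" using nfs_label_bij[of N F] by (simp add: bij_betw_def)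
    then show ?thesis using entry_roots_label[of _ N F] by auto
  qed
  also have "card \<dots> = card {p. p < N \<and> nfs_height N F p > 0}"
    by (intro card_image inj_on_subset[OF bij_betw_imp_inj_on[OF nfs_label_bij]]) auto
  finally show ?thesis .
qed

lemma total_level_full_trace: "total_level (full_trace N F) = (\<Sum>p<N. nfs_height N F p - 1)"
  unfolding total_level_def sum_list_sum_nth
  using full_trace_nodes(3)[of F N] by (simp add: nfs_height_def case_prod_unfold atLeast0LessThan)

text \<open>By \<open>tforest_eq_iff\<close> the fibre of \<Phi> over \<open>F\<close> consists of
  the graphs with the trace of \<open>F\<close>. The number of components is the number of heights 0
  and thus constant on it, so only the powers of \<open>t\<close> are summed, by
  \<open>trace_fiber_sum\<close> with an empty stack; its exponent of \<open>1 + t\<close> is the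
  number of cane paths.\<close>

lemma search_forest_fiber_sum:
  fixes q t :: real
  assumes F: "F \<in> labeled_forests N"
  shows "(\<Sum>G | G \<in> labeled_graphs N \<and> search_forest N G = F. q ^ (num_components N G - 1) * t ^ card G) =
    q ^ (num_components N F - 1) * t ^ card F * (1 + t) ^ num_cane_paths F"
proof -
  have eq: "search_forest N G = F \<longleftrightarrow> full_trace N G = full_trace N F" if "G \<in> labeled_graphs N" for G
    using tforest_eq_iff[OF nfs_state_full[of N], of G F] search_forest_eq[OF that] tforest_of_forest[OF F] by simp
  have "(\<Sum>G | G \<in> labeled_graphs N \<and> search_forest N G = F. q ^ (num_components N G - 1) * t ^ card G) =
      (\<Sum>G | G \<in> labeled_graphs N \<and> full_trace N G = full_trace N F. q ^ (num_components N F - 1) * t ^ card G)"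
    using eq num_components_full_trace num_components_full_trace[OF labeled_forest_graph[OF F]]
    by (intro sum.cong) auto
  also have "\<dots> = q ^ (num_components N F - 1) *
      (\<Sum>G | G \<in> labeled_graphs N \<and> full_trace N G = full_trace N F. t ^ card G)"
    by (simp add: sum_distrib_left)
  also have "(\<Sum>G | G \<in> labeled_graphs N \<and> full_trace N G = full_trace N F. t ^ card G) =
      t ^ card F * (1 + t) ^ num_cane_paths F"
    using trace_fiber_sum[OF nfs_state_full[of N], where H = F and t = t] tforest_of_forest[OF F]
      total_level_full_trace[of F N] num_cane_paths_forest[OF F]
    by (simp add: labeled_graphs_def complete_graph_def binomial_eq_0)
  finally show ?thesis by simp
qed

section \<open>Simplices as affine preimages\<close>

text \<open>Triangularity is expressed by an injective rank of the indices, as no order on the index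
  type is given. A permutation that never raises the rank preserves it, because the sum of the ranks
  does not change, and is the identity; every other one picks a zero entry.\<close>

lemma det_triangular_rank:
  fixes A :: "'a::comm_ring_1 ^ 'n ^ 'n" and r :: "'n \<Rightarrow> nat"
  assumes "inj r" and "\<And>i j. r i < r j \<Longrightarrow> A $ i $ j = 0"
  shows "det A = (\<Prod>i\<in>UNIV. A $ i $ i)"
proof -
  let ?P = "{p. p permutes (UNIV :: 'n set)}"
  have "(\<Prod>i\<in>UNIV. A $ i $ p i) = 0" if p: "p permutes UNIV" "p \<noteq> id" for p
  proof -
    have "\<exists>i. r i < r (p i)"
    proof (rule ccontr)
      assume "\<nexists>i. r i < r (p i)"
      then have le: "r (p i) \<le> r i" for i by (meson not_le)
      have "(\<Sum>i\<in>UNIV. r (p i)) = (\<Sum>i\<in>UNIV. r i)"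
        using sum.permute[OF p(1), of r] by (simp add: comp_def)
      then have "r (p i) = r i" for i
        using sum_mono_inv[of "\<lambda>i. r (p i)" UNIV r i] le by simp
      then have "p i = i" for i using assms(1) by (simp add: inj_eq)
      then show False using p(2) by auto
    qed
    then obtain i where "A $ i $ p i = 0" using assms(2) by blast
    then show ?thesis by (intro prod_zero) auto
  qed
  then have "det A = (\<Sum>p\<in>{id}. of_int (sign p) * (\<Prod>i\<in>UNIV. A $ i $ p i))"
    unfolding det_def
    by (intro sum.mono_neutral_right) (auto simp: permutes_id finite_permutations)
  then show ?thesis by simp
qed

lemma abs_det_involution:
  fixes f :: "real ^ 'n \<Rightarrow> real ^ 'n"
  assumes "linear f" and "\<And>x. f (f x) = x"
  shows "\<bar>det (matrix f)\<bar> = 1"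
proof -
  have "f \<circ> f = id" using assms(2) by auto
  then have "matrix f ** matrix f = mat 1"
    using matrix_compose[OF assms(1,1)] by (simp add: matrix_id_mat_1)
  then have "det (matrix f) * det (matrix f) = 1"
    using det_mul[of "matrix f" "matrix f"] by simp
  then show ?thesis using square_eq_1_iff by fastforce
qed

lemma measure_linear_image_unimodular:
  fixes f :: "real ^ 'n \<Rightarrow> real ^ 'n"
  assumes "linear f" and "\<bar>det (matrix f)\<bar> = 1"
    and "\<And>a b. measure lebesgue (f ` cbox a b) = measure lebesgue (cbox a b)"
  shows "\<forall>S\<in>lmeasurable. f ` S \<in> lmeasurable \<and>
    measure lebesgue (f ` S) = \<bar>det (matrix f)\<bar> * measure lebesgue S"
proof
  fix S :: "(real ^ 'n) set" assume S: "S \<in> lmeasurable"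
  have "measure lebesgue (f ` cbox a b) = 1 * measure lebesgue (cbox a b)" for a b
    unfolding assms(3) by (rule mult_1[symmetric])
  from measure_linear_sufficient[OF assms(1) S this]
  show "f ` S \<in> lmeasurable \<and> measure lebesgue (f ` S) = \<bar>det (matrix f)\<bar> * measure lebesgue S"
    unfolding assms(2) by (simp only: eq_commute)
qed

text \<open>The library has this only for index types that are well-ordered. The order is used there for
  the determinants of transvections; these are products of two involutions.\<close>

lemma measure_linear_image_cart:
  fixes f :: "real ^ 'n \<Rightarrow> real ^ 'n"
  assumes "linear f" and "S \<in> lmeasurable"
  shows "measure lebesgue (f ` S) = \<bar>det (matrix f)\<bar> * measure lebesgue S"
proof -
  have "\<forall>S\<in>lmeasurable. f ` S \<in> lmeasurable \<and>
      measure lebesgue (f ` S) = \<bar>det (matrix f)\<bar> * measure lebesgue S"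
    using assms(1)
  proof (rule induct_linear_elementary)
    fix f g :: "real ^ 'n \<Rightarrow> real ^ 'n"
    assume fg: "linear f" "linear g"
      "\<forall>S\<in>lmeasurable. f ` S \<in> lmeasurable \<and> measure lebesgue (f ` S) = \<bar>det (matrix f)\<bar> * measure lebesgue S"
      "\<forall>S\<in>lmeasurable. g ` S \<in> lmeasurable \<and> measure lebesgue (g ` S) = \<bar>det (matrix g)\<bar> * measure lebesgue S"
    have "det (matrix (f \<circ> g)) = det (matrix f) * det (matrix g)"
      by (simp only: matrix_compose[OF fg(2,1)] det_mul)
    then show "\<forall>S\<in>lmeasurable. (f \<circ> g) ` S \<in> lmeasurable \<and>
        measure lebesgue ((f \<circ> g) ` S) = \<bar>det (matrix (f \<circ> g))\<bar> * measure lebesgue S"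
      unfolding image_comp[symmetric] using fg(3,4) by (simp add: abs_mult del: image_image)
  next
    fix f :: "real ^ 'n \<Rightarrow> real ^ 'n" and i
    assume f: "linear f" "\<And>x. f x $ i = 0"
    have "\<not> surj f"
    proof
      assume "surj f"
      then obtain x where "f x = axis i 1" by (metis surjD)
      then show False using f(2)[of x] by simp
    qed
    then have "\<not> inj f" using linear_injective_imp_surjective[OF f(1)] by blast
    then have "det (matrix f) = 0" "negligible (f ` S)" for S
      using det_nz_iff_inj[OF f(1)] negligible_linear_singular_image[OF f(1)] by blast+
    then show "\<forall>S\<in>lmeasurable. f ` S \<in> lmeasurable \<and>
        measure lebesgue (f ` S) = \<bar>det (matrix f)\<bar> * measure lebesgue S"
      by (simp add: negligible_iff_measure)
  next
    fix c :: "'n \<Rightarrow> real"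
    have "det (matrix (\<lambda>x :: real ^ 'n. \<chi> i. c i * x $ i)) = prod c UNIV"
      by (subst det_diagonal) (auto simp: matrix_def axis_def)
    then show "\<forall>S\<in>lmeasurable. (\<lambda>x. \<chi> i. c i * x $ i) ` S \<in> lmeasurable \<and> measure lebesgue ((\<lambda>x. \<chi> i. c i * x $ i) ` S) =
        \<bar>det (matrix (\<lambda>x :: real ^ 'n. \<chi> i. c i * x $ i))\<bar> * measure lebesgue S"
      by (simp add: measurable_stretch measure_stretch)
  next
    fix m n :: 'n
    let ?f = "\<lambda>x :: real ^ 'n. \<chi> i. x $ Transposition.transpose m n i"
    have lin: "linear ?f" by (rule linearI) (simp_all add: vec_eq_iff)
    have inv: "?f (?f x) = x" for x by (simp add: vec_eq_iff)
    have meas: "measure lebesgue (?f ` cbox a b) = measure lebesgue (cbox a b)" for a b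
    proof -
      have "?f ` cbox a b = cbox (?f a) (?f b)"
      proof (intro subset_antisym subsetI)
        fix y assume y: "y \<in> cbox (?f a) (?f b)"
        have "?f y \<in> cbox a b" unfolding mem_box_cart
        proof
          fix i
          show "a $ i \<le> ?f y $ i \<and> ?f y $ i \<le> b $ i"
            using y[unfolded mem_box_cart, rule_format, of "Transposition.transpose m n i"] by simp
        qed
        then have "?f (?f y) \<in> ?f ` cbox a b" by (rule imageI)
        then show "y \<in> ?f ` cbox a b" by (simp only: inv)
      qed (auto simp: mem_box_cart)
      moreover have "(\<Prod>i\<in>UNIV. ?f b $ i - ?f a $ i) = (\<Prod>i\<in>UNIV. b $ i - a $ i)"
        using prod.permute[OF permutes_swap_id, of m UNIV n "\<lambda>i. b $ i - a $ i"] by (simp add: comp_def)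
      moreover have "cbox (?f a) (?f b) = {} \<longleftrightarrow> cbox a b = {}"
        using \<open>?f ` cbox a b = cbox (?f a) (?f b)\<close> by (metis image_is_empty)
      ultimately show ?thesis by (simp add: content_cbox_if_cart)
    qed
    show "\<forall>S\<in>lmeasurable. ?f ` S \<in> lmeasurable \<and>
        measure lebesgue (?f ` S) = \<bar>det (matrix ?f)\<bar> * measure lebesgue S"
      by (rule measure_linear_image_unimodular[OF lin abs_det_involution[OF lin inv] meas])
  next
    fix m n :: 'n assume mn: "m \<noteq> n"
    let ?f = "\<lambda>x :: real ^ 'n. \<chi> i. if i = m then x $ m + x $ n else x $ i"
    let ?d = "\<lambda>x :: real ^ 'n. \<chi> i. if i = n then - (x $ i) else x $ i"
    have lin: "linear ?f" and lind: "linear ?d"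
      by (rule linearI; simp add: vec_eq_iff algebra_simps)+
    \<comment> \<open>The sign change \<open>?d\<close> of coordinate \<open>n\<close> is an
      involution, and so is the shear composed with it.\<close>
    have "\<bar>det (matrix (?f \<circ> ?d))\<bar> = 1"
      by (rule abs_det_involution[OF linear_compose[OF lind lin]]) (use mn in \<open>auto simp: vec_eq_iff\<close>)
    moreover have "\<bar>det (matrix ?d)\<bar> = 1" by (rule abs_det_involution[OF lind]) (simp add: vec_eq_iff)
    ultimately have det: "\<bar>det (matrix ?f)\<bar> = 1"
      unfolding matrix_compose[OF lind lin] det_mul by (simp add: abs_mult)
    have meas: "measure lebesgue (?f ` cbox a b) = measure lebesgue (cbox a b)" for a b
    proof (cases "cbox a b = {}")
      case False
      \<comment> \<open>The translation moves the lower end in coordinate \<open>n\<close> to 0, as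
        \<open>measure_shear_interval\<close> is stated for a nonnegative one.\<close>
      define w where "w = axis n (- a $ n)"
      have ne: "cbox (w + a) (w + b) \<noteq> {}" using False by (simp add: cbox_translation)
      have "?f ` cbox (w + a) (w + b) = (\<lambda>x. ?f w + x) ` ?f ` cbox a b"
        unfolding cbox_translation image_image by (intro image_cong refl linear_add[OF lin])
      then have "measure lebesgue (?f ` cbox a b) = measure lebesgue (?f ` cbox (w + a) (w + b))"
        by (simp only: measure_translation)
      also have "\<dots> = measure lebesgue (cbox (w + a) (w + b))"
        by (rule measure_shear_interval[OF mn ne]) (simp add: w_def)
      finally show ?thesis by (simp only: cbox_translation measure_translation)
    qed simp
    show "\<forall>S\<in>lmeasurable. ?f ` S \<in> lmeasurable \<and>
        measure lebesgue (?f ` S) = \<bar>det (matrix ?f)\<bar> * measure lebesgue S"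
      by (rule measure_linear_image_unimodular[OF lin det meas])
  qed
  then show ?thesis using assms(2) by blast
qed

text \<open>The substitution y = (f x + b) / a turns the conditions into those of the standard
  simplex, so \<open>S\<close> is a translate of its image under \<open>h\<close>, which scales by
  \<open>a\<close> and then inverts \<open>f\<close>. The volume 1 / n! is multiplied by the
  absolute determinant of \<open>h\<close>, found from the fact that \<open>f \<circ> h\<close> is
  the scaling by \<open>a\<close>.\<close>

lemma affine_simplex:
  fixes f :: "real ^ 'n \<Rightarrow> real ^ 'n"
  assumes f: "linear f" and d: "det (matrix f) \<noteq> 0" and a: "a > 0"
    and S: "S = {x. (\<forall>i. 0 \<le> f x $ i + b $ i) \<and> (\<Sum>i\<in>UNIV. f x $ i + b $ i) \<le> a}"
  shows "int CARD('n) simplex S"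
    and "measure lebesgue S = a ^ CARD('n) / (fact CARD('n) * \<bar>det (matrix f)\<bar>)"
proof -
  obtain g where g: "linear g" "\<And>x. g (f x) = x" "\<And>x. f (g x) = x"
  proof -
    obtain B where B: "matrix f ** B = mat 1" "B ** matrix f = mat 1"
      using d invertible_det_nz[of "matrix f"] unfolding invertible_def by blast
    have mf: "f x = matrix f *v x" for x
      using fun_cong[OF matrix_vector_mul(2)[OF f], of x] by (rule sym)
    have "B *v f x = x" "f (B *v x) = x" for x
      by (simp_all only: mf matrix_vector_mul_assoc B matrix_vector_mul_lid)
    then show thesis using that[of "(*v) B"] matrix_vector_mul_linear by blast
  qed
  define h where "h = (\<lambda>y. g (a *\<^sub>R y))"
  have h: "linear h" unfolding h_def using g(1) linear_compose[OF linear_scaleR g(1), of a]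
    by (simp add: comp_def)
  have injh: "inj h"
  proof (rule injI)
    fix x y assume "h x = h y"
    then have "f (g (a *\<^sub>R x)) = f (g (a *\<^sub>R y))" by (simp add: h_def)
    then show "x = y" using a by (simp add: g(3))
  qed
  define std :: "(real ^ 'n) set" where "std = convex hull (insert 0 Basis)"
  have mem_std: "y \<in> std \<longleftrightarrow> (\<forall>i. 0 \<le> y $ i) \<and> (\<Sum>i\<in>UNIV. y $ i) \<le> 1" for y
  proof -
    have "y \<in> std \<longleftrightarrow> (\<forall>i\<in>Basis. 0 \<le> y \<bullet> i) \<and> sum ((\<bullet>) y) Basis \<le> 1"
      unfolding std_def std_simplex by auto
    also have "sum ((\<bullet>) y) Basis = (\<Sum>i\<in>UNIV. y $ i)"
    proof -
      have B: "(Basis :: (real ^ 'n) set) = (\<lambda>i. axis i 1) ` UNIV" by (auto simp: Basis_vec_def)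
      have "inj (\<lambda>i. axis i 1 :: real ^ 'n)" by (auto simp: inj_on_def axis_eq_axis)
      then have "sum ((\<bullet>) y) ((\<lambda>i. axis i 1) ` UNIV) = (\<Sum>i\<in>UNIV. y \<bullet> axis i 1)"
        by (subst sum.reindex) simp_all
      then show ?thesis unfolding B[symmetric] by (simp add: cart_eq_inner_axis)
    qed
    also have "(\<forall>i\<in>Basis. 0 \<le> y \<bullet> i) \<longleftrightarrow> (\<forall>i. 0 \<le> y $ i)"
      by (auto simp: Basis_vec_def cart_eq_inner_axis[symmetric])
    finally show ?thesis .
  qed
  have S_eq: "S = (\<lambda>x. g (- b) + x) ` h ` std"
  proof (intro subset_antisym subsetI)
    fix x assume x: "x \<in> S"
    define y where "y = (1 / a) *\<^sub>R (f x + b)"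
    have "y \<in> std"
      using x a unfolding mem_std S y_def by (simp add: divide_simps flip: sum_divide_distrib)
    moreover have "g (- b) + h y = x"
    proof -
      have "h y = g (f x + b)" using a by (simp add: h_def y_def)
      then have "g (- b) + h y = g (- b + (f x + b))" using linear_add[OF g(1)] by metis
      then show ?thesis by (simp add: g(2))
    qed
    ultimately show "x \<in> (\<lambda>x. g (- b) + x) ` h ` std" by (metis imageI)
  next
    fix x assume "x \<in> (\<lambda>x. g (- b) + x) ` h ` std"
    then obtain y where y: "y \<in> std" "x = g (- b) + h y" by blast
    have "f x = - b + a *\<^sub>R y" using y(2) by (simp add: linear_add[OF f] g(3) h_def)
    then have "f x $ i + b $ i = a * y $ i" for i by simp
    then show "x \<in> S" using y(1) a unfolding S mem_std
      by (simp flip: sum_distrib_left)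
  qed
  define C where "C = (\<lambda>x. g (- b) + x) ` h ` insert 0 Basis"
  have "independent (h ` Basis)"
    using linear_independent_injective_image[OF h independent_Basis] injh by (auto intro: inj_on_subset)
  moreover have h0: "h 0 = 0" by (rule linear_0[OF h])
  moreover have "0 \<notin> h ` Basis"
  proof
    assume "0 \<in> h ` Basis"
    then obtain x where "x \<in> Basis" "h x = h 0" using h0 by auto
    then show False using injD[OF injh, of x 0] nonzero_Basis by auto
  qed
  ultimately have "\<not> affine_dependent (h ` insert 0 Basis)"
    using affine_dependent_iff_dependent[of 0 "h ` Basis"] by simp
  then have "\<not> affine_dependent C" unfolding C_def
    using affine_dependent_translation_eq[of "h ` insert 0 Basis" "g (- b)"] by simp
  moreover have "card C = CARD('n) + 1"
  proof -
    have "card C = card (insert 0 (Basis :: (real ^ 'n) set))"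
      unfolding C_def image_image using injh by (intro card_image) (auto simp: inj_on_def inj_def)
    then show ?thesis by simp
  qed
  moreover have "S = convex hull C"
    unfolding S_eq C_def std_def convex_hull_translation convex_hull_linear_image[OF h] ..
  ultimately show "int CARD('n) simplex S" unfolding simplex_def by auto
  have "std \<in> lmeasurable" unfolding std_def by (intro lmeasurable_compact compact_convex_hull finite_imp_compact) auto
  then have "measure lebesgue S = \<bar>det (matrix h)\<bar> * measure lebesgue std"
    unfolding S_eq measure_translation by (rule measure_linear_image_cart[OF h])
  also have "measure lebesgue std = 1 / fact CARD('n)"
  proof -
    have "std \<in> sets borel" unfolding std_def by (intro borel_compact compact_convex_hull finite_imp_compact) auto
    then have "measure lebesgue std = measure lborel std" by simp
    then show ?thesis unfolding std_def by (simp add: content_std_simplex)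
  qed
  also have "det (matrix h) * det (matrix f) = a ^ CARD('n)"
  proof -
    have "f \<circ> h = (*\<^sub>R) a" by (auto simp: h_def g(3))
    then have "matrix f ** matrix h = matrix ((*\<^sub>R) a)" using matrix_compose[OF h f] by simp
    then have "det (matrix f) * det (matrix h) = a ^ CARD('n)"
      using det_mul[of "matrix f" "matrix h"] by (simp add: det_matrix_scaleR)
    then show ?thesis by (simp add: mult.commute)
  qed
  then have "det (matrix h) = a ^ CARD('n) / det (matrix f)" using d by (simp add: field_simps)
  then have "\<bar>det (matrix h)\<bar> = a ^ CARD('n) / \<bar>det (matrix f)\<bar>" using a by (simp add: abs_divide)
  finally show "measure lebesgue S = a ^ CARD('n) / (fact CARD('n) * \<bar>det (matrix f)\<bar>)" by simp
qed

section \<open>Tutte inequalities and codings\<close>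

text \<open>In the coordinates \<open>z i = x i - 1 + q\<close> the defining inequalities of the Tutte polytope take the
  following form.\<close>

definition tutte_seq :: "nat \<Rightarrow> real \<Rightarrow> real \<Rightarrow> (nat \<Rightarrow> real) \<Rightarrow> bool" where
  "tutte_seq n q t z \<longleftrightarrow> 0 \<le> z n \<and>
     (\<forall>l p. l \<le> p \<and> p < n \<longrightarrow> q * z (Suc p) \<le> q * (1 + t) * z p + t * (1 - q) * z l)"

text \<open>\<open>c_value\<close> indexed by position and written in the coordinates z; for a
  non-root \<open>h p - 1\<close> is the number of cane paths from the node at \<open>p\<close>, and
  \<open>root_pos h p\<close> is the position of its root.\<close>

definition c_pos :: "real \<Rightarrow> real \<Rightarrow> (nat \<Rightarrow> nat) \<Rightarrow> (nat \<Rightarrow> real) \<Rightarrow> nat \<Rightarrow> real" where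
  "c_pos q t h z p = (if h p = 0 then t * z p
     else (q * z p + (1 - q) * z (root_pos h p)) / (1 + t) ^ (h p - 1) - z (root_pos h p))"

lemma root_pos_le: "root_pos h p \<le> p"
  by (induction p) auto

lemma root_pos_root: "h 0 = 0 \<Longrightarrow> h (root_pos h p) = 0"
  by (induction p) auto

lemma root_pos_eq: "h p = 0 \<Longrightarrow> root_pos h p = p"
  by (cases p) auto

context
  fixes n :: nat and q t :: real
  assumes q: "0 < q" "q \<le> 1" and t: "t > 0"
begin

lemma c_pos_bounds_iff:
  assumes "h p > 0"
  shows "0 \<le> c_pos q t h z p \<longleftrightarrow>
      (1 + t) ^ (h p - 1) * z (root_pos h p) \<le> q * z p + (1 - q) * z (root_pos h p)"
    and "c_pos q t h z p \<le> t * z (root_pos h p) \<longleftrightarrow>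
      q * z p + (1 - q) * z (root_pos h p) \<le> (1 + t) ^ h p * z (root_pos h p)"
    and "0 < c_pos q t h z p \<longleftrightarrow>
      (1 + t) ^ (h p - 1) * z (root_pos h p) < q * z p + (1 - q) * z (root_pos h p)"
    and "c_pos q t h z p < t * z (root_pos h p) \<longleftrightarrow>
      q * z p + (1 - q) * z (root_pos h p) < (1 + t) ^ h p * z (root_pos h p)"
proof -
  obtain k where k: "h p = Suc k" using assms by (cases "h p") auto
  define Y where "Y = q * z p + (1 - q) * z (root_pos h p)"
  have pos: "(1 + t) ^ k > 0" using t by simp
  have c: "c_pos q t h z p = Y / (1 + t) ^ k - z (root_pos h p)"
    by (simp add: c_pos_def k Y_def)
  show "0 \<le> c_pos q t h z p \<longleftrightarrow> (1 + t) ^ (h p - 1) * z (root_pos h p) \<le> Y"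
    "0 < c_pos q t h z p \<longleftrightarrow> (1 + t) ^ (h p - 1) * z (root_pos h p) < Y"
    using pos by (simp_all add: c k pos_le_divide_eq pos_less_divide_eq mult.commute)
  have "c_pos q t h z p \<le> t * z (root_pos h p) \<longleftrightarrow> Y / (1 + t) ^ k \<le> (1 + t) * z (root_pos h p)"
    "c_pos q t h z p < t * z (root_pos h p) \<longleftrightarrow> Y / (1 + t) ^ k < (1 + t) * z (root_pos h p)"
    by (auto simp: c algebra_simps)
  then show "c_pos q t h z p \<le> t * z (root_pos h p) \<longleftrightarrow> Y \<le> (1 + t) ^ h p * z (root_pos h p)"
    "c_pos q t h z p < t * z (root_pos h p) \<longleftrightarrow> Y < (1 + t) ^ h p * z (root_pos h p)"
    using pos by (simp_all add: k pos_divide_le_eq pos_divide_less_eq ac_simps)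
qed

lemma z_le_iff: "q * z l + (1 - q) * z l \<le> q * z p + (1 - q) * z l \<longleftrightarrow> (z l :: real) \<le> z p"
  using q by simp

text \<open>For fixed \<open>p\<close> the inequality with \<open>l = root_pos h p\<close> is the
  strongest, as no earlier value lies below the value of the current root. It says that Y grows by
  at most the factor 1 + t. At a new root the value drops; at an ascent the label drops and with it
  the c-value; otherwise the height does not grow and the powers of \<open>1 + t\<close> around Y
  give the bound.\<close>

lemma tutte_seq_of_coding:
  assumes code: "nfs_coding n v h"
    and nonneg: "\<And>p. p \<le> n \<Longrightarrow> 0 \<le> c_pos q t h z p"
    and mono: "\<And>p p'. p \<le> n \<Longrightarrow> p' \<le> n \<Longrightarrow> v p < v p' \<Longrightarrow> c_pos q t h z p \<le> c_pos q t h z p'"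
  shows "tutte_seq n q t z"
proof -
  define l where "l = root_pos h"
  define Y where "Y = (\<lambda>p. q * z p + (1 - q) * z (l p))"
  have h0: "h 0 = 0" and step: "\<And>p. p < n \<Longrightarrow> h (Suc p) \<le> Suc (h p)"
    and sib: "\<And>p. p < n \<Longrightarrow> h (Suc p) = Suc (h p) \<Longrightarrow> v (Suc p) < v p"
    and root: "\<And>p p'. p < p' \<Longrightarrow> p' \<le> n \<Longrightarrow> h p = 0 \<Longrightarrow> v p' < v p"
    using code unfolding nfs_coding_def by blast+
  have l: "l p \<le> p" "h (l p) = 0" for p
    using root_pos_le root_pos_root h0 by (auto simp: l_def)
  have ll: "c_pos q t h z (l p) = t * z (l p)" for p using l(2) by (simp add: c_pos_def)
  have zl: "0 \<le> z (l p)" if "p \<le> n" for p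
    using nonneg[of "l p"] that l(1)[of p] ll t by (auto simp: zero_le_mult_iff)
  \<comment> \<open>The root has the largest label of its component, so its c-value t z_l bounds
    those of the others.\<close>
  have upper: "c_pos q t h z p \<le> t * z (l p)" if "p \<le> n" for p
  proof (cases "l p = p")
    case False
    then have "v p < v (l p)" using root[of "l p" p] l[of p] that by simp
    then show ?thesis using mono[of p "l p"] that l(1)[of p] ll by simp
  qed (use ll[of p] in simp)
  have Yl: "z (l p) \<le> Y p" if p: "p \<le> n" for p
  proof (cases "h p = 0")
    case True
    then show ?thesis using root_pos_eq[of h p] by (simp add: Y_def l_def algebra_simps)
  next
    case False
    have "1 * z (l p) \<le> (1 + t) ^ (h p - 1) * z (l p)"
      using zl[OF p] t by (intro mult_right_mono one_le_power) auto
    then show ?thesis using c_pos_bounds_iff(1)[of h p z] nonneg[OF p] False by (simp add: Y_def l_def)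
  qed
  have A: "z (l p) \<le> z p" if "p \<le> n" for p
    using Yl[OF that] z_le_iff[of z "l p" p] by (simp add: Y_def algebra_simps)
  have B: "z (l (Suc p)) \<le> z (l p)" if p: "Suc p \<le> n" for p
  proof (cases "h (Suc p) = 0")
    case True
    then have lS: "l (Suc p) = Suc p" by (simp add: l_def)
    have "v (Suc p) < v (l p)" using root[of "l p" "Suc p"] l[of p] p by simp
    then have "c_pos q t h z (Suc p) \<le> t * z (l p)"
      using mono[of "Suc p" "l p"] p l(1)[of p] ll by simp
    then show ?thesis using t True lS by (simp add: c_pos_def)
  qed (simp add: l_def)
  have C: "z (l p) \<le> z (l p')" if "p' \<le> p" "p \<le> n" for p p'
    using that
  proof (induction p rule: dec_induct)
    case (step p)
    then show ?case using B[of p] by simp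
  qed simp
  have "q * z (Suc p) \<le> q * (1 + t) * z p + t * (1 - q) * z l'" if p: "l' \<le> p" "p < n" for l' p
  proof -
    have zz: "z (l p) \<le> z l'" using C[of l' p] A[of l'] p by simp
    have main: "q * z (Suc p) + (1 - q) * z (l p) \<le> (1 + t) * Y p"
    proof (cases "h (Suc p) = 0")
      case True
      have "l (Suc p) = Suc p" using True by (simp add: l_def)
      then have "z (Suc p) \<le> z p" using B[of p] A[of p] p by simp
      then have "q * z (Suc p) + (1 - q) * z (l p) \<le> Y p" using q by (simp add: Y_def)
      also have "\<dots> \<le> (1 + t) * Y p" using Yl[of p] zl[of p] p t by (simp add: algebra_simps)
      finally show ?thesis .
    next
      case False
      then have lS: "l (Suc p) = l p" by (simp add: l_def)
      then have YS: "Y (Suc p) = q * z (Suc p) + (1 - q) * z (l p)" by (simp add: Y_def)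
      have US: "Y (Suc p) \<le> (1 + t) ^ h (Suc p) * z (l p)"
        using c_pos_bounds_iff(2)[of h "Suc p" z] False upper[of "Suc p"] p
        by (simp only: Y_def lS flip: l_def)
      show ?thesis
      proof (cases "h p = 0")
        case True
        then have "l p = p" using root_pos_eq by (simp add: l_def)
        then have "Y p = z (l p)" by (simp add: Y_def algebra_simps)
        moreover have "h (Suc p) = 1" using False step[of p] True p by simp
        ultimately show ?thesis using US YS by simp
      next
        case hp: False
        have LP: "(1 + t) ^ (h p - 1) * z (l p) \<le> Y p"
          using c_pos_bounds_iff(1)[of h p z] hp nonneg[of p] p by (simp add: Y_def l_def)
        show ?thesis
        proof (cases "h (Suc p) = Suc (h p)")
          case True
          then have "c_pos q t h z (Suc p) \<le> c_pos q t h z p" using mono sib p by simp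
          then have "Y (Suc p) / (1 + t) ^ h p \<le> Y p / (1 + t) ^ (h p - 1)"
            using True hp lS by (simp add: c_pos_def Y_def l_def)
          moreover obtain k where k: "h p = Suc k" using hp by (cases "h p") auto
          moreover have pos: "(1 + t) ^ k > 0" using t by simp
          ultimately have "Y (Suc p) / (1 + t) \<le> Y p" by (simp add: divide_simps split: if_splits)
          then show ?thesis using t YS by (simp add: pos_divide_le_eq mult.commute)
        next
          case False
          then have "h (Suc p) \<le> h p" using step[of p] p by simp
          then have "(1 + t) ^ h (Suc p) * z (l p) \<le> (1 + t) ^ h p * z (l p)"
            using t zl[of p] p by (intro mult_right_mono power_increasing) auto
          also have "\<dots> = (1 + t) * ((1 + t) ^ (h p - 1) * z (l p))" using hp by (cases "h p") auto
          also have "\<dots> \<le> (1 + t) * Y p" using LP t by (intro mult_left_mono) auto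
          finally show ?thesis using US YS by simp
        qed
      qed
    qed
    have "q * z (Suc p) \<le> q * (1 + t) * z p + t * (1 - q) * z (l p)"
      using main by (simp add: Y_def algebra_simps)
    also have "\<dots> \<le> q * (1 + t) * z p + t * (1 - q) * z l'"
      using zz q t by (intro add_left_mono mult_left_mono) auto
    finally show ?thesis .
  qed
  moreover have "0 \<le> z n" using A[of n] zl[of n] by simp
  ultimately show ?thesis by (simp add: tutte_seq_def)
qed

text \<open>The heights are recovered by induction on the position: once the current root is known,
  z shows whether a new root follows, and otherwise Y lies strictly between consecutive multiples (1
  + t)^k z_l, which fixes the height. With equal heights the c-values coincide, and their strict
  order fixes the labels.\<close>

lemma coding_determined:
  assumes code: "nfs_coding n v h" and code': "nfs_coding n v' h'"
    and pos: "\<And>p. p \<le> n \<Longrightarrow> 0 < c_pos q t h z p"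
    and mono: "\<And>p p'. p \<le> n \<Longrightarrow> p' \<le> n \<Longrightarrow> v p < v p' \<Longrightarrow> c_pos q t h z p < c_pos q t h z p'"
    and pos': "\<And>p. p \<le> n \<Longrightarrow> 0 < c_pos q t h' z p"
    and mono': "\<And>p p'. p \<le> n \<Longrightarrow> p' \<le> n \<Longrightarrow> v' p < v' p' \<Longrightarrow> c_pos q t h' z p < c_pos q t h' z p'"
    and p: "p \<le> n"
  shows "h p = h' p \<and> v p = v' p"
proof -
  have type: "h (Suc p) = 0 \<and> z (Suc p) < z (root_pos h p) \<or>
      h (Suc p) > 0 \<and> z (Suc p) > z (root_pos h p) \<and>
      (1 + t) ^ (h (Suc p) - 1) * z (root_pos h p) < q * z (Suc p) + (1 - q) * z (root_pos h p) \<and>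
      q * z (Suc p) + (1 - q) * z (root_pos h p) < (1 + t) ^ h (Suc p) * z (root_pos h p)"
    and zpos: "z (root_pos h p) > 0"
    if code: "nfs_coding n v h" and pos: "\<And>p. p \<le> n \<Longrightarrow> 0 < c_pos q t h z p"
      and mono: "\<And>p p'. p \<le> n \<Longrightarrow> p' \<le> n \<Longrightarrow> v p < v p' \<Longrightarrow> c_pos q t h z p < c_pos q t h z p'"
      and p: "Suc p \<le> n" for v h p
  proof -
    let ?l = "root_pos h p"
    have l: "?l \<le> p" "h ?l = 0" using root_pos_le root_pos_root code by (auto simp: nfs_coding_def)
    have cl: "c_pos q t h z ?l = t * z ?l" using l by (simp add: c_pos_def)
    show zl: "z ?l > 0" using pos[of ?l] l p cl t by (simp add: zero_less_mult_iff)
    have "v (Suc p) < v ?l" using code l p unfolding nfs_coding_def by (meson le_imp_less_Suc)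
    then have up: "c_pos q t h z (Suc p) < t * z ?l" using mono[of "Suc p" ?l] l p cl by simp
    show "h (Suc p) = 0 \<and> z (Suc p) < z (root_pos h p) \<or>
      h (Suc p) > 0 \<and> z (Suc p) > z (root_pos h p) \<and>
      (1 + t) ^ (h (Suc p) - 1) * z (root_pos h p) < q * z (Suc p) + (1 - q) * z (root_pos h p) \<and>
      q * z (Suc p) + (1 - q) * z (root_pos h p) < (1 + t) ^ h (Suc p) * z (root_pos h p)"
    proof (cases "h (Suc p) = 0")
      case True
      then show ?thesis using up t by (simp add: c_pos_def)
    next
      case False
      then have lS: "root_pos h (Suc p) = ?l" by simp
      have 1: "(1 + t) ^ (h (Suc p) - 1) * z ?l < q * z (Suc p) + (1 - q) * z ?l"
        using c_pos_bounds_iff(3)[of h "Suc p" z] pos[OF p] False unfolding lS by blast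
      have 2: "q * z (Suc p) + (1 - q) * z ?l < (1 + t) ^ h (Suc p) * z ?l"
        using c_pos_bounds_iff(4)[of h "Suc p" z] up False unfolding lS by blast
      have "1 * z ?l \<le> (1 + t) ^ (h (Suc p) - 1) * z ?l"
        using zl t by (intro mult_right_mono one_le_power) auto
      then have "q * z ?l < q * z (Suc p)" using 1 by (simp add: algebra_simps)
      then have "z ?l < z (Suc p)" using q by simp
      then show ?thesis using False 1 2 by simp
    qed
  qed
  have hh: "h p = h' p \<and> root_pos h p = root_pos h' p" if "p \<le> n" for p
    using that
  proof (induction p)
    case 0
    then show ?case using code code' by (simp add: nfs_coding_def)
  next
    case (Suc p)
    then have l: "root_pos h' p = root_pos h p" and p: "Suc p \<le> n" by simp_all
    note T = type[OF code pos mono p] and T' = type[OF code' pos' mono' p, unfolded l]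
    have zl: "z (root_pos h p) > 0" by (rule zpos[OF code pos mono p])
    \<comment> \<open>Intervals between consecutive powers that share a point have the same
      exponent; this is one of the two inequalities.\<close>
    have exp: "a \<le> b" if "(1 + t) ^ (a - 1) * z (root_pos h p) < w" "w < (1 + t) ^ b * z (root_pos h p)"
      for a b w
    proof -
      have "(1 + t) ^ (a - 1) * z (root_pos h p) < (1 + t) ^ b * z (root_pos h p)" using that by simp
      then have "(1 + t) ^ (a - 1) < (1 + t) ^ b" using zl by simp
      then have "a - 1 < b" using t power_less_imp_less_exp[of "1 + t" "a - 1" b] by simp
      then show ?thesis by simp
    qed
    have "h (Suc p) = h' (Suc p)"
    proof (cases "h (Suc p) = 0")
      case True
      with T have "z (Suc p) < z (root_pos h p)" by simp
      with T' True show ?thesis by simp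
    next
      case False
      with T have *: "z (root_pos h p) < z (Suc p)"
        "(1 + t) ^ (h (Suc p) - 1) * z (root_pos h p) < q * z (Suc p) + (1 - q) * z (root_pos h p)"
        "q * z (Suc p) + (1 - q) * z (root_pos h p) < (1 + t) ^ h (Suc p) * z (root_pos h p)"
        by simp_all
      with T' have "(1 + t) ^ (h' (Suc p) - 1) * z (root_pos h p) < q * z (Suc p) + (1 - q) * z (root_pos h p)"
        "q * z (Suc p) + (1 - q) * z (root_pos h p) < (1 + t) ^ h' (Suc p) * z (root_pos h p)"
        by simp_all
      with * exp show ?thesis by (intro le_antisym) blast+
    qed
    then show ?case using l by simp
  qed
  have cc: "c_pos q t h z p = c_pos q t h' z p" if "p \<le> n" for p
    using hh[OF that] by (simp add: c_pos_def)
  \<comment> \<open>A label is the number of positions whose c-value is not larger, so it depends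
    only on the order of the c-values.\<close>
  have count: "v p = card {p' \<in> {..n}. c_pos q t h z p' \<le> c_pos q t h z p}"
    if code: "nfs_coding n v h''" and mono: "\<And>p p'. p \<le> n \<Longrightarrow> p' \<le> n \<Longrightarrow> v p < v p' \<Longrightarrow> c_pos q t h z p < c_pos q t h z p'"
      and p: "p \<le> n" for v h'' p
  proof -
    have bij: "bij_betw v {..n} {1..n + 1}" using code by (simp add: nfs_coding_def)
    have "c_pos q t h z p' \<le> c_pos q t h z p \<longleftrightarrow> v p' \<le> v p" if "p' \<le> n" for p'
    proof -
      have eq: "p' = p" if "v p' = v p"
        using bij that \<open>p' \<le> n\<close> p by (auto simp: bij_betw_def inj_on_def)
      consider "v p' < v p" | "v p' = v p" | "v p < v p'" by linarith
      then show ?thesis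
      proof cases
        case 1
        then show ?thesis using mono[OF that p] by simp
      next
        case 2
        then show ?thesis using eq by simp
      next
        case 3
        then show ?thesis using mono[OF p that] by simp
      qed
    qed
    then have "{p' \<in> {..n}. c_pos q t h z p' \<le> c_pos q t h z p} = {p' \<in> {..n}. v p' \<le> v p}" by auto
    moreover have "v ` {p' \<in> {..n}. v p' \<le> v p} = {1..v p}"
    proof -
      have "v p \<in> {1..n + 1}" using bij p by (auto simp: bij_betw_def)
      moreover have "v ` {p' \<in> {..n}. v p' \<le> v p} = {w \<in> v ` {..n}. w \<le> v p}" by blast
      moreover have "v ` {..n} = {1..n + 1}" using bij by (simp add: bij_betw_def)
      ultimately show ?thesis by auto
    qed
    moreover have "card (v ` {p' \<in> {..n}. v p' \<le> v p}) = card {p' \<in> {..n}. v p' \<le> v p}"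
      using bij by (intro card_image) (auto simp: bij_betw_def inj_on_def)
    ultimately show ?thesis by simp
  qed
  have "v p = card {p' \<in> {..n}. c_pos q t h z p' \<le> c_pos q t h z p}"
    by (rule count[OF code mono p])
  moreover have "v' p = card {p' \<in> {..n}. c_pos q t h z p' \<le> c_pos q t h z p}"
    by (rule count[OF code' _ p]) (use mono' cc in simp)
  ultimately show ?thesis using hh[OF p] by simp
qed

text \<open>Runs backwards from \<open>z n\<close>: for \<open>l = p\<close> the inequality becomes
  q z_(p+1) \<le> (q + t) z_p.\<close>

lemma tutte_seq_nonneg:
  assumes T: "tutte_seq n q t z" and "p \<le> n"
  shows "0 \<le> z p"
  using assms(2)
proof (induction p rule: inc_induct)
  case base
  then show ?case using T by (simp add: tutte_seq_def)
next
  case (step p)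
  then have "q * z (Suc p) \<le> q * (1 + t) * z p + t * (1 - q) * z p"
    using T by (simp add: tutte_seq_def)
  also have "\<dots> = (q + t) * z p" by (simp add: algebra_simps)
  finally have "0 \<le> (q + t) * z p" using step q by (meson order_trans mult_nonneg_nonneg less_imp_le)
  then show ?case using q t by (simp add: zero_le_mult_iff)
qed

text \<open>The term with \<open>z l\<close> vanishes, so values after \<open>l\<close> cannot rise
  above 0 again. Hence a position whose value exceeds that of its root has a root with positive
  value, which makes its height well defined.\<close>

lemma tutte_seq_zero:
  assumes T: "tutte_seq n q t z" and "z l = 0" and "l \<le> p" "p \<le> n"
  shows "z p \<le> 0"
  using assms(3,4)
proof (induction p rule: dec_induct)
  case (step p)
  then have "q * z (Suc p) \<le> q * (1 + t) * z p + t * (1 - q) * z l"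
    using T unfolding tutte_seq_def by (meson Suc_le_lessD)
  then have "q * z (Suc p) \<le> q * (1 + t) * z p" using assms(2) by simp
  also have "\<dots> \<le> 0" using step q t by (intro mult_nonneg_nonpos) auto
  finally show ?case using q by (simp add: mult_le_0_iff)
qed (use assms(2) in simp)

text \<open>Every point is reached: a position starts a new component iff \<open>z\<close> does not exceed its value at
  the current root \<open>l\<close>; otherwise its height is read off from the powers of \<open>1 + t\<close> between which
  \<open>(q z p + (1 - q) z l) / z l\<close> lies. Ties between \<open>c\<close>-values are broken by position.\<close>

lemma coding_of_tutte_seq:
  assumes T: "tutte_seq n q t z" and z0: "z 0 = q"
  obtains v h where "nfs_coding n v h" "\<And>p. p \<le> n \<Longrightarrow> 0 \<le> c_pos q t h z p"
    "\<And>p p'. p \<le> n \<Longrightarrow> p' \<le> n \<Longrightarrow> v p < v p' \<Longrightarrow> c_pos q t h z p \<le> c_pos q t h z p'"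
proof -
  define l where "l = rec_nat 0 (\<lambda>p l. if z (Suc p) \<le> z l then Suc p else l)"
  have l0: "l 0 = 0" and lS: "l (Suc p) = (if z (Suc p) \<le> z (l p) then Suc p else l p)" for p
    by (simp_all add: l_def)
  have l_le: "l p \<le> p" for p by (induction p) (auto simp: l0 lS)
  have l_min: "z (l p) \<le> z p'" if "p' \<le> p" for p p'
    using that
  proof (induction p)
    case (Suc p)
    then show ?case by (cases "p' = Suc p") (auto simp: lS)
  qed (simp add: l0)
  define Y where "Y = (\<lambda>p. q * z p + (1 - q) * z (l p))"
  have zn: "0 \<le> z p" if "p \<le> n" for p using tutte_seq_nonneg[OF T that] .
  have lp: "l p < p" "z (l p) < z p" if "l p \<noteq> p" for p
  proof -
    show "l p < p" using that l_le[of p] by simp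
    show "z (l p) < z p" using that by (cases p) (auto simp: l0 lS split: if_splits)
  qed
  have zlpos: "0 < z (l p)" if "p \<le> n" "l p \<noteq> p" for p
  proof (rule ccontr)
    assume "\<not> 0 < z (l p)"
    then have "z (l p) = 0" using zn[of "l p"] l_le[of p] that by simp
    then have "z p \<le> 0" using tutte_seq_zero[OF T _ l_le[of p]] that by simp
    then show False using lp(2)[OF that(2)] \<open>z (l p) = 0\<close> by simp
  qed
  \<comment> \<open>The interval for the height is open on the left and closed on the right. The
    strict lower bound is what limits the next height to \<open>Suc (h p)\<close>.\<close>
  define k where "k = (\<lambda>p. LEAST k. Y p \<le> (1 + t) ^ Suc k * z (l p))"
  define h where "h = (\<lambda>p. if l p = p then 0 else Suc (k p))"
  have root_pos: "root_pos h p = l p" for p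
  proof (induction p)
    case (Suc p)
    have "h (Suc p) = 0 \<longleftrightarrow> z (Suc p) \<le> z (l p)"
      using l_le[of p] by (auto simp: h_def lS)
    then show ?case using Suc by (simp add: lS)
  qed (simp add: l0)
  have Yl: "z (l p) < Y p" if "l p \<noteq> p" for p
  proof -
    have "q * z (l p) < q * z p" using lp(2)[OF that] q by simp
    then show ?thesis by (simp add: Y_def algebra_simps)
  qed
  have upper: "Y p \<le> (1 + t) ^ h p * z (l p)" and lower: "(1 + t) ^ (h p - 1) * z (l p) < Y p"
    if p: "p \<le> n" "l p \<noteq> p" for p
  proof -
    have zl: "0 < z (l p)" by (rule zlpos[OF p])
    obtain m where "Y p / z (l p) < (1 + t) ^ m" using real_arch_pow[of "1 + t"] t by auto
    also have "\<dots> \<le> (1 + t) ^ Suc m" using t by (intro power_increasing) auto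
    finally have "Y p \<le> (1 + t) ^ Suc m * z (l p)" using zl by (simp add: pos_divide_less_eq)
    then show "Y p \<le> (1 + t) ^ h p * z (l p)"
      unfolding h_def k_def if_not_P[OF p(2)] by (rule LeastI)
    show "(1 + t) ^ (h p - 1) * z (l p) < Y p"
    proof (cases "k p")
      case 0
      then show ?thesis using Yl[OF p(2)] p by (simp add: h_def)
    next
      case (Suc j)
      then have "\<not> Y p \<le> (1 + t) ^ Suc j * z (l p)" unfolding k_def by (intro not_less_Least) simp
      then show ?thesis using Suc p by (simp add: h_def)
    qed
  qed
  define c where "c = c_pos q t h z"
  have c_root: "c p = t * z p" if "l p = p" for p using that by (simp add: c_def c_pos_def h_def)
  have c_bounds: "0 \<le> c p" "c p \<le> t * z (l p)" if "p \<le> n" for p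
  proof -
    have "0 \<le> c p \<and> c p \<le> t * z (l p)"
    proof (cases "l p = p")
      case True
      then show ?thesis using c_root[OF True] zn[OF that] t by simp
    next
      case False
      then have "h p > 0" by (simp add: h_def)
      then show ?thesis
        using c_pos_bounds_iff(1,2)[of h p z] lower[OF that False] upper[OF that False]
        by (simp add: c_def root_pos Y_def)
    qed
    then show "0 \<le> c p" "c p \<le> t * z (l p)" by auto
  qed
  \<comment> \<open>Among equal c-values the later position gets the smaller label, so that ties at
    an ascent or with a root still satisfy the conditions on \<open>v\<close>.\<close>
  define below where "below = (\<lambda>p. {p' \<in> {..n}. c p' < c p \<or> c p' = c p \<and> p \<le> p'})"
  define v where "v = (\<lambda>p. card (below p))"
  have v_less: "v p < v p'" if "p \<le> n" "p' \<le> n" "c p < c p' \<or> c p = c p' \<and> p' < p" for p p'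
    unfolding v_def
  proof (rule psubset_card_mono)
    have "below p \<subseteq> below p'" using that(3) by (auto simp: below_def)
    moreover have "p' \<in> below p'" "p' \<notin> below p" using that by (auto simp: below_def)
    ultimately show "below p \<subset> below p'" by blast
  qed (simp add: below_def)
  have v_inj: "inj_on v {..n}"
  proof (rule inj_onI)
    fix p p' assume p: "p \<in> {..n}" "p' \<in> {..n}" "v p = v p'"
    show "p = p'"
    proof (rule ccontr)
      assume "p \<noteq> p'"
      then consider "c p < c p' \<or> c p = c p' \<and> p' < p" | "c p' < c p \<or> c p' = c p \<and> p < p'" by linarith
      then show False using v_less[of p p'] v_less[of p' p] p by cases auto
    qed
  qed
  have "v p \<in> {1..n + 1}" if "p \<le> n" for p
  proof -
    have "card (below p) \<le> card {..n}" by (intro card_mono) (auto simp: below_def)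
    moreover have "card (below p) > 0" using that by (auto simp: card_gt_0_iff below_def)
    ultimately show ?thesis by (simp add: v_def)
  qed
  then have "v ` {..n} \<subseteq> {1..n + 1}" by auto
  moreover have "card (v ` {..n}) = card {1..n + 1}" using card_image[OF v_inj] by simp
  ultimately have "v ` {..n} = {1..n + 1}" by (intro card_subset_eq) auto
  with v_inj have bij: "bij_betw v {..n} {1..n + 1}" by (simp add: bij_betw_def)
  have step: "h (Suc p) \<le> Suc (h p) \<and> (h (Suc p) = Suc (h p) \<longrightarrow> v (Suc p) < v p)" if p: "p < n" for p
  proof (cases "l (Suc p) = Suc p")
    case True
    then show ?thesis by (simp add: h_def)
  next
    case False
    then have lS': "l (Suc p) = l p" by (auto simp: lS split: if_splits)
    have zl: "0 < z (l p)" using zlpos[OF _ False] p lS' by simp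
    have low: "(1 + t) ^ (h (Suc p) - 1) * z (l p) < Y (Suc p)" using lower[OF _ False] p lS' by simp
    \<comment> \<open>The polytope inequality with the current root \<open>l p\<close>, which bounds
      the growth of Y.\<close>
    have "q * z (Suc p) \<le> q * (1 + t) * z p + t * (1 - q) * z (l p)"
      using T l_le[of p] p by (simp add: tutte_seq_def)
    then have YY: "Y (Suc p) \<le> (1 + t) * Y p" by (simp add: Y_def lS' algebra_simps)
    have Yup: "Y p \<le> (1 + t) ^ h p * z (l p)"
    proof (cases "l p = p")
      case True
      then show ?thesis by (simp add: Y_def h_def algebra_simps)
    qed (use upper p in simp)
    have "(1 + t) ^ (h (Suc p) - 1) * z (l p) < (1 + t) * ((1 + t) ^ h p * z (l p))"
      using low YY mult_left_mono[OF Yup, of "1 + t"] t by linarith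
    then have "(1 + t) ^ (h (Suc p) - 1) < (1 + t) ^ Suc (h p)" using zl by (simp flip: mult.assoc)
    then have "h (Suc p) - 1 < Suc (h p)" 
      using t power_less_imp_less_exp[of "1 + t" "h (Suc p) - 1" "Suc (h p)"] by simp
    moreover have "v (Suc p) < v p" if hS: "h (Suc p) = Suc (h p)"
    proof -
      have "c (Suc p) \<le> c p"
      proof (cases "l p = p")
        case True
        then show ?thesis using c_bounds(2)[of "Suc p"] p lS' c_root[OF True] by simp
      next
        case nr: False
        then obtain j where j: "h p = Suc j" by (simp add: h_def)
        have "c (Suc p) = Y (Suc p) / (1 + t) ^ Suc j - z (l p)"
          using hS j by (simp add: c_def c_pos_def root_pos lS' Y_def)
        also have "\<dots> \<le> (1 + t) * Y p / (1 + t) ^ Suc j - z (l p)"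
          using YY t by (intro diff_right_mono divide_right_mono) auto
        also have "(1 + t) * Y p / (1 + t) ^ Suc j = Y p / (1 + t) ^ j" using t by simp
        also have "Y p / (1 + t) ^ j - z (l p) = c p"
          using j by (simp add: c_def c_pos_def root_pos Y_def)
        finally show ?thesis .
      qed
      then show ?thesis using v_less[of "Suc p" p] p by linarith
    qed
    ultimately show ?thesis by simp
  qed
  have root: "v p' < v p" if "p < p'" "p' \<le> n" "h p = 0" for p p'
  proof -
    have "l p = p" using that(3) by (simp add: h_def split: if_splits)
    have "c p' \<le> t * z (l p')" using c_bounds(2) that by simp
    also have "\<dots> \<le> t * z p" using l_min[of p p'] that t by simp
    also have "\<dots> = c p" using c_root[OF \<open>l p = p\<close>] by simp
    finally show ?thesis using v_less[of p' p] that by linarith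
  qed
  have "nfs_coding n v h" using bij step root l0 unfolding nfs_coding_def by (simp add: h_def)
  moreover have "c p \<le> c p'" if "p \<le> n" "p' \<le> n" "v p < v p'" for p p'
    using v_less[of p' p] that by linarith
  ultimately show thesis using c_bounds(1) that by (auto simp: c_def)
qed

end

section \<open>The simplex of a coding\<close>

text \<open>Since \<open>f\<close> is onto, a small move from an interior point can lower or raise a
  single coordinate of \<open>f x\<close> and stays in the set. Where an inequality is an equality,
  one of these moves would violate it.\<close>

lemma interior_affine_simplex:
  fixes f :: "real ^ 'n \<Rightarrow> real ^ 'n"
  assumes f: "linear f" and d: "det (matrix f) \<noteq> 0"
    and S: "S = {x. (\<forall>i. 0 \<le> f x $ i + b $ i) \<and> (\<Sum>i\<in>UNIV. f x $ i + b $ i) \<le> a}"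
    and x: "x \<in> interior S"
  shows "0 < f x $ i + b $ i" and "(\<Sum>i\<in>UNIV. f x $ i + b $ i) < a"
proof -
  have "surj f" using d det_nz_iff_inj[OF f] linear_injective_imp_surjective[OF f] by blast
  have move: "\<exists>u>0. (\<forall>i. 0 \<le> f x $ i + u * y $ i + b $ i) \<and> (\<Sum>i\<in>UNIV. f x $ i + u * y $ i + b $ i) \<le> a" for y
  proof -
    obtain w where w: "f w = y" using \<open>surj f\<close> by (metis surjD)
    obtain r where r: "r > 0" "ball x r \<subseteq> S" using x by (auto simp: mem_interior)
    define m where "m = norm w + 1"
    have m: "m > 0" unfolding m_def by (simp add: add_nonneg_pos)
    define u where "u = r / (2 * m)"
    have u: "u > 0" using r m by (simp add: u_def)
    have "u * norm w \<le> u * m" using u by (simp add: m_def)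
    also have "\<dots> = r / 2" using m by (simp add: u_def)
    also have "\<dots> < r" using r by simp
    finally have "x + u *\<^sub>R w \<in> ball x r" using u by (simp add: dist_norm)
    then have "x + u *\<^sub>R w \<in> S" using r by blast
    then show ?thesis using u w unfolding S
      by (intro exI[of _ u]) (simp add: linear_add[OF f] linear_scale[OF f])
  qed
  show "0 < f x $ i + b $ i"
  proof -
    obtain u where "u > 0" "0 \<le> f x $ i + u * axis i (- 1) $ i + b $ i" using move by blast
    then show ?thesis by simp
  qed
  show "(\<Sum>i\<in>UNIV. f x $ i + b $ i) < a"
  proof -
    obtain u where u: "u > 0" "(\<Sum>j\<in>UNIV. f x $ j + u * axis i 1 $ j + b $ j) \<le> a" using move by blast
    have "(\<Sum>j\<in>UNIV. u * axis i 1 $ j) = u"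
      by (simp add: axis_def flip: sum_distrib_left)
    then have "(\<Sum>j\<in>UNIV. f x $ j + u * axis i 1 $ j + b $ j) = (\<Sum>j\<in>UNIV. f x $ j + b $ j) + u"
      by (simp add: sum.distrib)
    with u show ?thesis by simp
  qed
qed

lemma root_pos_cong: "(\<And>p'. p' \<le> p \<Longrightarrow> h p' = h' p') \<Longrightarrow> root_pos h p = root_pos h' p"
  by (induction p) auto

lemma c_pos_cong: "(\<And>p'. p' \<le> p \<Longrightarrow> h p' = h' p') \<Longrightarrow> c_pos q t h z p = c_pos q t h' z p"
  using root_pos_cong[of p h h'] by (simp add: c_pos_def)

lemma c_pos_add: "c_pos q t h (\<lambda>p. z p + w p) p = c_pos q t h z p + c_pos q t h w p"
  by (simp add: c_pos_def distrib_left add_divide_distrib)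

lemma c_pos_scale: "c_pos q t h (\<lambda>p. u * z p) p = u * c_pos q t h z p"
  by (simp add: c_pos_def algebra_simps)

lemma coding_label_0:
  assumes "nfs_coding n v h" shows "v 0 = n + 1"
proof -
  have bij: "bij_betw v {..n} {1..n + 1}" using assms by (simp add: nfs_coding_def)
  then obtain p where p: "p \<le> n" "v p = n + 1" by (force simp: bij_betw_def image_iff set_eq_iff)
  show ?thesis
  proof (cases "p = 0")
    case False
    then have "v p < v 0" using assms p unfolding nfs_coding_def by blast
    moreover have "v 0 \<in> {1..n + 1}" using bij by (auto simp: bij_betw_def)
    ultimately show ?thesis using p by simp
  qed (use p in simp)
qed

definition z_coord :: "(nat \<Rightarrow> 'n) \<Rightarrow> real \<Rightarrow> real ^ 'n \<Rightarrow> nat \<Rightarrow> real" where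
  "z_coord e q x p = coord e x p - 1 + q"

text \<open>The chain is required for all pairs of positions, the form that the criteria for codings
  use; \<open>coding_chain_iff\<close> translates it to consecutive labels.\<close>

definition coding_simplex ::
  "nat \<Rightarrow> (nat \<Rightarrow> 'n) \<Rightarrow> (nat \<Rightarrow> nat) \<Rightarrow> (nat \<Rightarrow> nat) \<Rightarrow> real \<Rightarrow> real \<Rightarrow> (real ^ 'n) set" where
  "coding_simplex n e v h q t = {x. (\<forall>p\<le>n. 0 \<le> c_pos q t h (z_coord e q x) p) \<and>
     (\<forall>p\<le>n. \<forall>p'\<le>n. v p < v p' \<longrightarrow> c_pos q t h (z_coord e q x) p \<le> c_pos q t h (z_coord e q x) p')}"

lemma tutte_polytope_iff: "x \<in> tutte_polytope n e q t \<longleftrightarrow> tutte_seq n q t (z_coord e q x)"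
proof -
  let ?z = "z_coord e q x" and ?x = "coord e x"
  have conv: "q * ?x (Suc p) \<le> q * (1 + t) * ?x p - t * (1 - q) * (1 - ?x l) \<longleftrightarrow>
      q * ?z (Suc p) \<le> q * (1 + t) * ?z p + t * (1 - q) * ?z l" for p l
    unfolding z_coord_def by (simp add: algebra_simps)
  have "(\<forall>i j. 1 \<le> j \<and> j \<le> i \<and> i \<le> n \<longrightarrow>
        q * ?x i \<le> q * (1 + t) * ?x (i - 1) - t * (1 - q) * (1 - ?x (j - 1))) \<longleftrightarrow>
      (\<forall>l p. l \<le> p \<and> p < n \<longrightarrow> q * ?z (Suc p) \<le> q * (1 + t) * ?z p + t * (1 - q) * ?z l)"
    (is "?A \<longleftrightarrow> (\<forall>l p. l \<le> p \<and> p < n \<longrightarrow> ?P l p)")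
  proof (intro iffI allI impI)
    fix l p assume ?A "l \<le> p \<and> p < n"
    then have "q * ?x (Suc p) \<le> q * (1 + t) * ?x p - t * (1 - q) * (1 - ?x l)"
      using \<open>?A\<close>[rule_format, of "Suc l" "Suc p"] by simp
    then show "?P l p" using conv by simp
  next
    fix i j assume *: "\<forall>l p. l \<le> p \<and> p < n \<longrightarrow> ?P l p" "1 \<le> j \<and> j \<le> i \<and> i \<le> n"
    then have "Suc (i - 1) = i" "j - 1 \<le> i - 1 \<and> i - 1 < n" by auto
    then show "q * ?x i \<le> q * (1 + t) * ?x (i - 1) - t * (1 - q) * (1 - ?x (j - 1))"
      using *(1) conv[of "i - 1" "j - 1"] by metis
  qed
  then show ?thesis by (auto simp: tutte_polytope_def tutte_seq_def z_coord_def)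
qed

lemma c_value_label:
  assumes F: "F \<in> labeled_forests (n + 1)" and p: "p \<le> n"
  shows "c_value n e F q t x (nfs_label (n + 1) F p) = c_pos q t (nfs_height (n + 1) F) (z_coord e q x) p"
proof -
  let ?v = "nfs_label (n + 1) F" and ?h = "nfs_height (n + 1) F"
  let ?l = "root_pos ?h p"
  have code: "nfs_coding n ?v ?h" by (rule nfs_coding_full_trace)
  have l: "?l \<le> p" "?h ?l = 0" using root_pos_le root_pos_root code by (auto simp: nfs_coding_def)
  have "inj_on ?v {..n}" using code by (simp add: nfs_coding_def bij_betw_def)
  then have eq: "?v p = ?v ?l \<longleftrightarrow> p = ?l" using p l(1) by (auto simp: inj_on_def)
  have eq': "p = ?l \<longleftrightarrow> ?h p = 0" using l(2) root_pos_eq[of ?h p] by metis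
  have root: "root_of F (?v p) = ?v ?l" using root_of_forest[OF F] p by simp
  have pos: "nfs_pos (n + 1) F (?v p) = p" "nfs_pos (n + 1) F (?v ?l) = ?l"
    using nfs_pos_forest[OF F] p l(1) by simp_all
  have canes: "num_cane_paths_from F (?v p) = ?h p - 1" using num_canes_forest[OF F] p by simp
  show ?thesis
  proof (cases "?h p = 0")
    case True
    then have "?l = p" using root_pos_eq by simp
    then show ?thesis using True unfolding c_value_def Let_def root pos canes
      by (simp add: c_pos_def z_coord_def)
  next
    case False
    then have "?v p \<noteq> ?v ?l" using eq eq' by simp
    moreover have "q * coord e x p - (1 - q) * (1 - coord e x ?l) =
        q * z_coord e q x p + (1 - q) * z_coord e q x ?l"
      by (simp add: z_coord_def algebra_simps)
    ultimately show ?thesis using False unfolding c_value_def Let_def root pos canes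
      by (simp add: c_pos_def) (simp add: z_coord_def)
  qed
qed

lemma coding_chain_iff:
  fixes C :: "nat \<Rightarrow> real"
  assumes bij: "bij_betw v {..n} {1..n + 1}" and C: "\<And>p. p \<le> n \<Longrightarrow> C (v p) = c p"
  shows "(\<forall>p\<le>n. 0 \<le> c p) \<and> (\<forall>p\<le>n. \<forall>p'\<le>n. v p < v p' \<longrightarrow> c p \<le> c p') \<longleftrightarrow>
      0 \<le> C 1 \<and> (\<forall>k\<in>{1..n}. C k \<le> C (k + 1))"
    and "0 < C 1 \<Longrightarrow> (\<And>k. k \<in> {1..n} \<Longrightarrow> C k < C (k + 1)) \<Longrightarrow>
      (\<forall>p\<le>n. 0 < c p) \<and> (\<forall>p\<le>n. \<forall>p'\<le>n. v p < v p' \<longrightarrow> c p < c p')"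
proof -
  have v: "v p \<in> {1..n + 1}" if "p \<le> n" for p using bij that by (auto simp: bij_betw_def)
  have ex: "\<exists>p\<le>n. v p = k" if "k \<in> {1..n + 1}" for k
  proof -
    have "k \<in> v ` {..n}" using that bij by (simp add: bij_betw_def)
    then show ?thesis by auto
  qed
  show "(\<forall>p\<le>n. 0 \<le> c p) \<and> (\<forall>p\<le>n. \<forall>p'\<le>n. v p < v p' \<longrightarrow> c p \<le> c p') \<longleftrightarrow>
      0 \<le> C 1 \<and> (\<forall>k\<in>{1..n}. C k \<le> C (k + 1))" (is "?L \<longleftrightarrow> ?R")
  proof
    assume L: ?L
    have "C k \<le> C (k + 1)" if k: "k \<in> {1..n}" for k
    proof -
      obtain p p' where "p \<le> n" "v p = k" "p' \<le> n" "v p' = k + 1" using ex[of k] ex[of "k + 1"] k by auto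
      then show ?thesis using L C[of p] C[of p'] by auto
    qed
    moreover have "0 \<le> C 1"
    proof -
      obtain p where "p \<le> n" "v p = 1" using ex[of 1] by auto
      then show ?thesis using L C[of p] by auto
    qed
    ultimately show ?R by blast
  next
    assume R: ?R
    have mono: "C a \<le> C b" if "1 \<le> a" "a \<le> b" "b \<le> n + 1" for a b
      using that(2,1,3)
    proof (induction b rule: dec_induct)
      case (step b)
      then have "C b \<le> C (b + 1)" using R by simp
      then show ?case using step by simp
    qed simp
    have "0 \<le> c p" if "p \<le> n" for p
      using mono[of 1 "v p"] v[OF that] R C[OF that] by auto
    moreover have "c p \<le> c p'" if "p \<le> n" "p' \<le> n" "v p < v p'" for p p'
      using mono[of "v p" "v p'"] v[OF that(1)] v[OF that(2)] that C by auto
    ultimately show ?L by blast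
  qed
  assume R: "0 < C 1" "\<And>k. k \<in> {1..n} \<Longrightarrow> C k < C (k + 1)"
  have mono: "C a < C b" if "1 \<le> a" "Suc a \<le> b" "b \<le> n + 1" for a b
    using that(2,1,3)
  proof (induction b rule: dec_induct)
    case base
    then show ?case using R(2)[of a] by simp
  next
    case (step b)
    then have "C b < C (b + 1)" using R(2)[of b] by simp
    then show ?case using step by simp
  qed
  have "0 < c p" if "p \<le> n" for p
    using mono[of 1 "v p"] v[OF that] R(1) C[OF that] by (cases "v p = 1") auto
  moreover have "c p < c p'" if "p \<le> n" "p' \<le> n" "v p < v p'" for p p'
    using mono[of "v p" "v p'"] v[OF that(1)] v[OF that(2)] that C by auto
  ultimately show "(\<forall>p\<le>n. 0 < c p) \<and> (\<forall>p\<le>n. \<forall>p'\<le>n. v p < v p' \<longrightarrow> c p < c p')" by blast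
qed

text \<open>Label \<open>n + 1\<close> sits at position 0 by \<open>coding_label_0\<close>, where z
  has the value q; this is the source of the top value q t. The rest is
  \<open>coding_chain_iff\<close>.\<close>

lemma forest_simplex_eq:
  assumes F: "F \<in> labeled_forests (n + 1)"
  shows "forest_simplex n e F q t = coding_simplex n e (nfs_label (n + 1) F) (nfs_height (n + 1) F) q t"
proof -
  let ?v = "nfs_label (n + 1) F" and ?h = "nfs_height (n + 1) F"
  have code: "nfs_coding n ?v ?h" by (rule nfs_coding_full_trace)
  then have bij: "bij_betw ?v {..n} {1..n + 1}" by (simp add: nfs_coding_def)
  have "c_value n e F q t x (n + 1) = q * t" for x
  proof -
    have "c_value n e F q t x (?v 0) = c_pos q t ?h (z_coord e q x) 0" by (rule c_value_label[OF F]) simp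
    then show ?thesis using code coding_label_0[OF code]
      by (simp add: c_pos_def nfs_coding_def z_coord_def coord_def mult.commute)
  qed
  moreover have "(\<forall>p\<le>n. 0 \<le> c_pos q t ?h (z_coord e q x) p) \<and>
      (\<forall>p\<le>n. \<forall>p'\<le>n. ?v p < ?v p' \<longrightarrow>
        c_pos q t ?h (z_coord e q x) p \<le> c_pos q t ?h (z_coord e q x) p') \<longleftrightarrow>
      0 \<le> c_value n e F q t x 1 \<and>
      (\<forall>k\<in>{1..n}. c_value n e F q t x k \<le> c_value n e F q t x (k + 1))" for x
    by (rule coding_chain_iff(1)[where C = "c_value n e F q t x", OF bij]) (rule c_value_label[OF F])
  ultimately show ?thesis unfolding forest_simplex_def coding_simplex_def by blast
qed

lemma prod_if_1:
  "finite A \<Longrightarrow> (\<Prod>x\<in>A. if P x then c else 1) = c ^ card {x \<in> A. P x}"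
  by (simp add: prod.inter_filter[symmetric])

context
  fixes n :: nat and q t :: real and e :: "nat \<Rightarrow> 'n::finite" and v h :: "nat \<Rightarrow> nat"
  assumes q: "0 < q" "q \<le> 1" and t: "t > 0"
    and e: "bij_betw e {1..n} (UNIV :: 'n set)" and code: "nfs_coding n v h"
begin

text \<open>Up to the constant \<open>b\<close>, the map \<open>f\<close> sends a point to the gaps
  between consecutive c-values in the order of labels. The order simplex then becomes: all gaps
  nonnegative and their sum, the c-value at label n, at most q t. For the determinant
  \<open>f\<close> is split into the c-values, triangular by position, and the differences,
  unitriangular by label.\<close>

lemma coding_simplex_affine:
  obtains f :: "real ^ 'n \<Rightarrow> real ^ 'n" and b :: "real ^ 'n" where "linear f"
    and "det (matrix f) = (\<Prod>p\<in>{1..n}. if h p = 0 then t else q / (1 + t) ^ (h p - 1))"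
    and "coding_simplex n e v h q t =
      {x. (\<forall>i. 0 \<le> f x $ i + b $ i) \<and> (\<Sum>i\<in>UNIV. f x $ i + b $ i) \<le> q * t}"
    and "\<forall>x. (\<forall>i. 0 < f x $ i + b $ i) \<and> (\<Sum>i\<in>UNIV. f x $ i + b $ i) < q * t \<longrightarrow>
      (\<forall>p\<le>n. 0 < c_pos q t h (z_coord e q x) p) \<and>
      (\<forall>p\<le>n. \<forall>p'\<le>n. v p < v p' \<longrightarrow> c_pos q t h (z_coord e q x) p < c_pos q t h (z_coord e q x) p')"
proof -
  define r where "r = inv_into {1..n} e"
  have r: "r i \<in> {1..n}" "e (r i) = i" for i
    using e inv_into_into[of i e "{1..n}"] f_inv_into_f[of i e "{1..n}"] by (auto simp: r_def bij_betw_def)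
  have re: "r (e p) = p" if "p \<in> {1..n}" for p
    using e that by (simp add: r_def bij_betw_def inv_into_f_f)
  have bij: "bij_betw v {..n} {1..n + 1}" using code by (simp add: nfs_coding_def)
  have h0: "h 0 = 0" using code by (simp add: nfs_coding_def)
  have v0: "v 0 = n + 1" by (rule coding_label_0[OF code])
  define u where "u = inv_into {..n} v"
  have uv: "u (v p) = p" if "p \<le> n" for p
    using bij that by (simp add: u_def bij_betw_def inv_into_f_f)
  have vu: "v (u k) = k" "u k \<le> n" if "k \<in> {1..n + 1}" for k
  proof -
    have "k \<in> v ` {..n}" using bij that by (simp add: bij_betw_def)
    then show "v (u k) = k" "u k \<le> n"
      using f_inv_into_f[of k v "{..n}"] inv_into_into[of k v "{..n}"] by (auto simp: u_def)
  qed
  have u1: "u k \<in> {1..n}" if "k \<in> {1..n}" for k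
  proof -
    have "u k \<noteq> 0"
    proof
      assume "u k = 0"
      then show False using vu(1)[of k] v0 that by simp
    qed
    then show ?thesis using vu[of k] that by auto
  qed
  have v1: "v p \<in> {1..n}" if "p \<in> {1..n}" for p
  proof -
    have "v p \<in> {1..n + 1}" using bij that by (auto simp: bij_betw_def)
    moreover have "v p \<noteq> n + 1" using uv[of p] uv[of 0] v0 that by auto
    ultimately show ?thesis by auto
  qed
  define pred where "pred = (\<lambda>g :: nat \<Rightarrow> real. \<lambda>i. g (r i) - (if v (r i) = 1 then 0 else g (u (v (r i) - 1))))"
  \<comment> \<open>The linear part of \<open>z_coord\<close>, with \<open>z0\<close> as the
    constant part; position 0 carries the constant value q and is no coordinate of
    \<open>x\<close>.\<close>
  define zl where "zl = (\<lambda>(x :: real ^ 'n) p. if p = 0 then 0 else x $ e p)"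
  define z0 where "z0 = (\<lambda>p :: nat. if p = 0 then q else q - 1)"
  define f where "f = (\<lambda>x. \<chi> i. pred (c_pos q t h (zl x)) i)"
  define b where "b = (\<chi> i. pred (c_pos q t h z0) i)"
  have zl_add: "zl (x + y) = (\<lambda>p. zl x p + zl y p)" and zl_scale: "zl (a *\<^sub>R x) = (\<lambda>p. a * zl x p)" for x y a
    by (auto simp: zl_def)
  have pred_add: "pred (\<lambda>p. g p + g' p) i = pred g i + pred g' i"
    and pred_scale: "pred (\<lambda>p. a * g p) i = a * pred g i" for g g' a i
    by (auto simp: pred_def algebra_simps)
  have c_add: "c_pos q t h (\<lambda>p. z p + w p) = (\<lambda>p. c_pos q t h z p + c_pos q t h w p)" for z w
    by (rule ext) (rule c_pos_add)
  have c_scale: "c_pos q t h (\<lambda>p. a * z p) = (\<lambda>p. a * c_pos q t h z p)" for z a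
    by (rule ext) (rule c_pos_scale)
  have lin: "linear f"
    by (rule linearI) (simp_all add: f_def vec_eq_iff zl_add zl_scale c_add c_scale pred_add pred_scale)
  have fb: "f x $ i + b $ i = pred (c_pos q t h (z_coord e q x)) i" for x i
  proof -
    have "z_coord e q x = (\<lambda>p. zl x p + z0 p)" by (auto simp: z_coord_def coord_def zl_def z0_def)
    then show ?thesis by (simp add: f_def b_def c_add pred_add)
  qed
  \<comment> \<open>The c-values sorted by label. \<open>D x 0 = 0\<close> is a default that makes
    the first c-value the first gap, and \<open>D x (n + 1)\<close> is q t.\<close>
  define D where "D = (\<lambda>x k. if k = 0 then 0 else c_pos q t h (z_coord e q x) (u k))"
  have fD: "f x $ e (u k) + b $ e (u k) = D x k - D x (k - 1)" if "k \<in> {1..n}" for x k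
    unfolding fb using u1[OF that] re vu(1)[of k] that by (simp add: pred_def D_def)
  have bij_eu: "bij_betw (\<lambda>k. e (u k)) {1..n} UNIV"
  proof -
    have "bij_betw u {1..n} {1..n}"
      by (rule bij_betw_byWitness[where f' = v]) (use u1 v1 uv vu in auto)
    then show ?thesis using bij_betw_trans[OF _ e] by (simp add: comp_def)
  qed
  have sum: "(\<Sum>i\<in>UNIV. f x $ i + b $ i) = D x n" for x
  proof -
    have "(\<Sum>i\<in>UNIV. f x $ i + b $ i) = (\<Sum>k\<in>{1..n}. f x $ e (u k) + b $ e (u k))"
      by (rule sum.reindex_bij_betw[OF bij_eu, symmetric])
    also have "\<dots> = (\<Sum>k\<in>{1..n}. D x k - D x (k - 1))" using fD by (intro sum.cong) auto
    also have "\<dots> = D x n - D x 0"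
    proof -
      have "(\<Sum>k\<in>{1..m}. D x k - D x (k - 1)) = D x m - D x 0" for m by (induction m) auto
      then show ?thesis .
    qed
    finally show ?thesis by (simp add: D_def)
  qed
  have all: "(\<forall>i. P i) \<longleftrightarrow> (\<forall>k\<in>{1..n}. P (e (u k)))" for P
    using bij_eu by (metis UNIV_I bij_betw_def imageE)
  have top: "D x (n + 1) = q * t" for x
  proof -
    have "u (n + 1) = 0" using uv[of 0] v0 by simp
    then show ?thesis using h0 by (simp add: D_def c_pos_def z_coord_def coord_def)
  qed
  have Dv: "D x (v p) = c_pos q t h (z_coord e q x) p" if "p \<le> n" for x p
  proof -
    have "v p \<noteq> 0" using bij that by (force simp: bij_betw_def)
    then show ?thesis using uv[OF that] by (simp add: D_def)
  qed
  \<comment> \<open>Stated for a relation \<open>R\<close> to cover the closed simplex and its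
    strict version with one index shift.\<close>
  have shift: "(\<forall>k\<in>{1..n}. R (D x (k - 1)) (D x k)) \<and> R (D x n) (q * t) \<longleftrightarrow>
      R 0 (D x 1) \<and> (\<forall>k\<in>{1..n}. R (D x k) (D x (k + 1)))" for R x
  proof -
    have "(\<forall>k\<in>{1..n}. R (D x (k - 1)) (D x k)) \<and> R (D x n) (q * t) \<longleftrightarrow> (\<forall>k\<le>n. R (D x k) (D x (Suc k)))"
      (is "?A \<longleftrightarrow> ?B")
    proof
      assume A: ?A
      show ?B
      proof (intro allI impI)
        fix k assume k: "k \<le> n"
        show "R (D x k) (D x (Suc k))"
        proof (cases "k = n")
          case True
          then show ?thesis using A top[of x] by simp
        next
          case False
          then have "Suc k \<in> {1..n}" using k by simp
          then show ?thesis using A by fastforce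
        qed
      qed
    next
      assume B: ?B
      have "R (D x (k - 1)) (D x k)" if "k \<in> {1..n}" for k
      proof -
        have "k - 1 \<le> n" "Suc (k - 1) = k" using that by auto
        then show ?thesis using B[rule_format, of "k - 1"] by simp
      qed
      moreover have "R (D x n) (q * t)" using B[rule_format, of n] top[of x] by simp
      ultimately show ?A by blast
    qed
    also have "\<dots> \<longleftrightarrow> R (D x 0) (D x 1) \<and> (\<forall>k\<in>{1..n}. R (D x k) (D x (k + 1)))" (is "_ \<longleftrightarrow> ?C")
    proof
      assume ?C
      then have "R (D x k) (D x (Suc k))" if "k \<le> n" for k using that by (cases "k = 0") auto
      then show "\<forall>k\<le>n. R (D x k) (D x (Suc k))" by blast
    qed auto
    finally show ?thesis by (simp add: D_def)
  qed
  have simplex: "coding_simplex n e v h q t =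
      {x. (\<forall>i. 0 \<le> f x $ i + b $ i) \<and> (\<Sum>i\<in>UNIV. f x $ i + b $ i) \<le> q * t}"
  proof -
    have "(\<forall>i. 0 \<le> f x $ i + b $ i) \<longleftrightarrow> (\<forall>k\<in>{1..n}. D x (k - 1) \<le> D x k)" for x
      unfolding all using fD by simp
    moreover note coding_chain_iff(1)[where C = "D _", OF bij Dv] shift[where R = "(\<le>)"]
    ultimately show ?thesis unfolding coding_simplex_def sum by simp
  qed
  have strict: "(\<forall>p\<le>n. 0 < c_pos q t h (z_coord e q x) p) \<and>
      (\<forall>p\<le>n. \<forall>p'\<le>n. v p < v p' \<longrightarrow> c_pos q t h (z_coord e q x) p < c_pos q t h (z_coord e q x) p')"
    if "\<And>i. 0 < f x $ i + b $ i" "(\<Sum>i\<in>UNIV. f x $ i + b $ i) < q * t" for x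
  proof -
    have "D x (k - 1) < D x k" if "k \<in> {1..n}" for k
      using fD[OF that, of x] \<open>\<And>i. 0 < f x $ i + b $ i\<close>[of "e (u k)"] by simp
    then have "0 < D x 1 \<and> (\<forall>k\<in>{1..n}. D x k < D x (k + 1))"
      using that(2) shift[where R = "(<)" and x = x] unfolding sum by blast
    then show ?thesis by (intro coding_chain_iff(2)[where C = "D x", OF bij Dv]) auto
  qed
  \<comment> \<open>\<open>\<gamma>\<close> gives the linear parts of the c-values by position,
    \<open>\<delta>\<close> subtracts from each the value at the preceding label.\<close>
  define \<gamma> where "\<gamma> = (\<lambda>x. \<chi> i. c_pos q t h (zl x) (r i))"
  define \<delta> where "\<delta> = (\<lambda>y :: real ^ 'n. \<chi> i. y $ i - (if v (r i) = 1 then 0 else y $ e (u (v (r i) - 1))))"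
  have lin\<gamma>: "linear \<gamma>"
    by (rule linearI) (simp_all add: \<gamma>_def vec_eq_iff zl_add zl_scale c_add c_scale)
  have lin\<delta>: "linear \<delta>"
    by (rule linearI) (auto simp: \<delta>_def vec_eq_iff algebra_simps)
  have prev: "v (r i) - 1 \<in> {1..n}" if "v (r i) \<noteq> 1" for i using v1[OF r(1)[of i]] that by auto
  have f_eq: "f = \<delta> \<circ> \<gamma>"
  proof (intro ext, simp add: vec_eq_iff, intro allI)
    fix x i
    show "f x $ i = \<delta> (\<gamma> x) $ i"
    proof (cases "v (r i) = 1")
      case False
      then show ?thesis using re[OF u1[OF prev[OF False]]] by (simp add: f_def \<delta>_def \<gamma>_def pred_def)
    qed (simp add: f_def \<delta>_def \<gamma>_def pred_def)
  qed
  have inj_r: "inj r" by (metis injI r(2))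
  have det\<delta>: "det (matrix \<delta>) = 1"
  proof -
    have "inj (\<lambda>i. v (r i))"
    proof (rule injI)
      fix i j assume "v (r i) = v (r j)"
      moreover have "r i \<le> n" "r j \<le> n" using r(1)[of i] r(1)[of j] by auto
      ultimately have "r i = r j" using uv by metis
      then show "i = j" using inj_r by (simp add: inj_eq)
    qed
    have less: "v (r (e (u (v (r i) - 1)))) < v (r i)" if "v (r i) \<noteq> 1" for i
      using re[OF u1[OF prev[OF that]]] vu(1)[of "v (r i) - 1"] prev[OF that] by auto
    have entry: "matrix \<delta> $ i $ j = (if i = j then 1 else 0) -
        (if v (r i) \<noteq> 1 \<and> e (u (v (r i) - 1)) = j then 1 else 0)" for i j
      by (auto simp: matrix_def \<delta>_def axis_def)
    have "det (matrix \<delta>) = (\<Prod>i\<in>UNIV. matrix \<delta> $ i $ i)"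
    proof (rule det_triangular_rank[OF \<open>inj (\<lambda>i. v (r i))\<close>])
      fix i j assume "v (r i) < v (r j)"
      then show "matrix \<delta> $ i $ j = 0" using less[of i] by (auto simp: entry)
    qed
    also have "\<dots> = 1" using less by (intro prod.neutral) (force simp: entry)
    finally show ?thesis .
  qed
  have det\<gamma>: "det (matrix \<gamma>) = (\<Prod>p\<in>{1..n}. if h p = 0 then t else q / (1 + t) ^ (h p - 1))"
  proof -
    have entry: "matrix \<gamma> $ i $ j = c_pos q t h (\<lambda>p. if p = r j then 1 else 0) (r i)" for i j
    proof -
      have "zl (axis j 1) p = (if p = r j then 1 else 0)" if "p \<le> n" for p
        using that r[of j] re[of p] by (auto simp: zl_def axis_def)
      moreover have "r i \<le> n" "root_pos h (r i) \<le> n"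
        using r(1)[of i] root_pos_le[of h "r i"] by auto
      ultimately show ?thesis by (simp add: matrix_def \<gamma>_def c_pos_def)
    qed
    have "det (matrix \<gamma>) = (\<Prod>i\<in>UNIV. matrix \<gamma> $ i $ i)"
    proof (rule det_triangular_rank[OF inj_r])
      fix i j assume "r i < r j"
      then show "matrix \<gamma> $ i $ j = 0" using root_pos_le[of h "r i"] by (auto simp: entry c_pos_def)
    qed
    also have "\<dots> = (\<Prod>i\<in>UNIV. if h (r i) = 0 then t else q / (1 + t) ^ (h (r i) - 1))"
    proof (intro prod.cong refl)
      fix i
      \<comment> \<open>A non-root has its root at an earlier position, so the diagonal entry is the
        coefficient of its own z alone.\<close>
      have "root_pos h (r i) \<noteq> r i" if "h (r i) \<noteq> 0" using root_pos_root[where h = h and p = "r i"] h0 that by metis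
      then show "matrix \<gamma> $ i $ i = (if h (r i) = 0 then t else q / (1 + t) ^ (h (r i) - 1))"
        by (auto simp: entry c_pos_def)
    qed
    also have "\<dots> = (\<Prod>p\<in>{1..n}. if h p = 0 then t else q / (1 + t) ^ (h p - 1))"
      by (subst prod.reindex_bij_betw[OF e, symmetric]) (simp add: re cong: if_cong)
    finally show ?thesis .
  qed
  have "det (matrix f) = det (matrix \<delta>) * det (matrix \<gamma>)"
    unfolding f_eq matrix_compose[OF lin\<gamma> lin\<delta>] by (rule det_mul)
  then have "det (matrix f) = (\<Prod>p\<in>{1..n}. if h p = 0 then t else q / (1 + t) ^ (h p - 1))"
    using det\<delta> det\<gamma> by simp
  moreover have "\<forall>x. (\<forall>i. 0 < f x $ i + b $ i) \<and> (\<Sum>i\<in>UNIV. f x $ i + b $ i) < q * t \<longrightarrow>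
      (\<forall>p\<le>n. 0 < c_pos q t h (z_coord e q x) p) \<and>
      (\<forall>p\<le>n. \<forall>p'\<le>n. v p < v p' \<longrightarrow> c_pos q t h (z_coord e q x) p < c_pos q t h (z_coord e q x) p')"
    using strict by blast
  ultimately show thesis using that lin simplex by blast
qed

lemma det_coding_pos: "0 < (\<Prod>p\<in>{1..n}. if h p = 0 then t else q / (1 + t) ^ (h p - 1))"
  using q t by (intro prod_pos) auto

lemma card_index: "CARD('n) = n"
  using bij_betw_same_card[OF e] by simp

lemma coding_simplex_simplex: "int n simplex coding_simplex n e v h q t"
  and measure_coding_simplex: "fact n * measure lebesgue (coding_simplex n e v h q t) =
     q ^ card {p \<in> {1..n}. h p = 0} * t ^ card {p \<in> {1..n}. h p > 0} * (1 + t) ^ (\<Sum>p\<in>{1..n}. h p - 1)"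
  and interior_coding_simplex: "x \<in> interior (coding_simplex n e v h q t) \<Longrightarrow>
      (\<forall>p\<le>n. 0 < c_pos q t h (z_coord e q x) p) \<and>
      (\<forall>p\<le>n. \<forall>p'\<le>n. v p < v p' \<longrightarrow> c_pos q t h (z_coord e q x) p < c_pos q t h (z_coord e q x) p')"
proof -
  let ?d = "\<Prod>p\<in>{1..n}. if h p = 0 then t else q / (1 + t) ^ (h p - 1)"
  obtain f :: "real ^ 'n \<Rightarrow> real ^ 'n" and b where f: "linear f" "det (matrix f) = ?d"
      "coding_simplex n e v h q t = {x. (\<forall>i. 0 \<le> f x $ i + b $ i) \<and> (\<Sum>i\<in>UNIV. f x $ i + b $ i) \<le> q * t}"
    and strict: "\<forall>x. (\<forall>i. 0 < f x $ i + b $ i) \<and> (\<Sum>i\<in>UNIV. f x $ i + b $ i) < q * t \<longrightarrow>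
      (\<forall>p\<le>n. 0 < c_pos q t h (z_coord e q x) p) \<and>
      (\<forall>p\<le>n. \<forall>p'\<le>n. v p < v p' \<longrightarrow> c_pos q t h (z_coord e q x) p < c_pos q t h (z_coord e q x) p')"
    by (rule coding_simplex_affine) (rule that)
  have nz: "det (matrix f) \<noteq> 0" unfolding f(2) using det_coding_pos by (rule less_imp_neq[symmetric])
  have qt: "q * t > 0" using q t by simp
  show "int n simplex coding_simplex n e v h q t"
    using affine_simplex(1)[OF f(1) nz qt f(3)] unfolding card_index .
  have "fact n * measure lebesgue (coding_simplex n e v h q t) = (q * t) ^ n / ?d"
    using affine_simplex(2)[OF f(1) nz qt f(3)] abs_of_pos[OF det_coding_pos]
    unfolding card_index f(2) by simp
  also have "(q * t) ^ n = (\<Prod>p\<in>{1..n}. q * t)" by simp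
  \<comment> \<open>Position by position: a root contributes q t / t = q, any other position t (1 +
    t)^(h p - 1).\<close>
  also have "(\<Prod>p\<in>{1..n}. q * t) / ?d =
      (\<Prod>p\<in>{1..n}. (if h p = 0 then q else 1) * (if h p > 0 then t else 1) * (1 + t) ^ (h p - 1))"
    unfolding prod_dividef[symmetric] using q t by (intro prod.cong refl) auto
  also have "\<dots> = q ^ card {p \<in> {1..n}. h p = 0} * t ^ card {p \<in> {1..n}. h p > 0} *
      (1 + t) ^ (\<Sum>p\<in>{1..n}. h p - 1)"
    by (simp only: prod.distrib prod_if_1[OF finite_atLeastAtMost] power_sum)
  finally show "fact n * measure lebesgue (coding_simplex n e v h q t) =
     q ^ card {p \<in> {1..n}. h p = 0} * t ^ card {p \<in> {1..n}. h p > 0} * (1 + t) ^ (\<Sum>p\<in>{1..n}. h p - 1)" .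
  assume x: "x \<in> interior (coding_simplex n e v h q t)"
  show "(\<forall>p\<le>n. 0 < c_pos q t h (z_coord e q x) p) \<and>
      (\<forall>p\<le>n. \<forall>p'\<le>n. v p < v p' \<longrightarrow> c_pos q t h (z_coord e q x) p < c_pos q t h (z_coord e q x) p')"
    using strict interior_affine_simplex[OF f(1) nz f(3) x] by blast
qed

end

section \<open>The triangulation\<close>

lemma finite_labeled_graphs: "finite (labeled_graphs N)"
  by (simp add: labeled_graphs_def complete_graph_def finite_imp_finite_nsets)

lemma finite_labeled_forests: "finite (labeled_forests N)"
  using finite_labeled_graphs[of N] by (simp add: labeled_forests_def)

lemma card_lessThan_Suc_filter:
  fixes P :: "nat \<Rightarrow> bool"
  shows "card {p. p < n + 1 \<and> P p} = (if P 0 then 1 else 0) + card {p \<in> {1..n}. P p}"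
proof -
  have "{p. p < n + 1 \<and> P p} = (if P 0 then {0} else {}) \<union> {p \<in> {1..n}. P p}"
    by (auto simp: less_Suc_eq_le Suc_le_eq) (metis gr0I)
  then show ?thesis by (auto simp: card_insert_if)
qed

text \<open>Position 0 is always a root; it accounts for the component subtracted in the exponent of
  q, so positions 1, ..., n remain.\<close>

lemma forest_statistics:
  assumes F: "F \<in> labeled_forests (n + 1)"
  shows "num_components (n + 1) F - 1 = card {p \<in> {1..n}. nfs_height (n + 1) F p = 0}"
    and "card F = card {p \<in> {1..n}. nfs_height (n + 1) F p > 0}"
    and "num_cane_paths F = (\<Sum>p\<in>{1..n}. nfs_height (n + 1) F p - 1)"
proof -
  let ?h = "nfs_height (n + 1) F"
  have h0: "?h 0 = 0" using nfs_coding_full_trace[of n F] by (simp add: nfs_coding_def)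
  show "num_components (n + 1) F - 1 = card {p \<in> {1..n}. ?h p = 0}"
    unfolding num_components_graph[OF labeled_forest_graph[OF F]] card_lessThan_Suc_filter using h0 by simp
  show "card F = card {p \<in> {1..n}. ?h p > 0}"
    unfolding card_forest[OF F] card_lessThan_Suc_filter using h0 by simp
  have "{..<n + 1} = insert 0 {1..n}" by auto
  then have "(\<Sum>p<n + 1. ?h p - 1) = (?h 0 - 1) + (\<Sum>p\<in>{1..n}. ?h p - 1)"
    by (simp only: finite_atLeastAtMost) (subst sum.insert; simp)
  then show "num_cane_paths F = (\<Sum>p\<in>{1..n}. ?h p - 1)"
    unfolding num_cane_paths_forest[OF F] using h0 by simp
qed

lemma num_components_complete_graph: "num_components (n + 1) (complete_graph (n + 1)) = 1"
proof -
  let ?K = "complete_graph (n + 1)"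
  have K: "?K \<in> labeled_graphs (n + 1)" by (simp add: labeled_graphs_def)
  have "component ?K v = {1..n + 1}" if v: "v \<in> {1..n + 1}" for v
  proof
    show "component ?K v \<subseteq> {1..n + 1}" by (rule component_labeled_graph[OF K v])
    show "{1..n + 1} \<subseteq> component ?K v"
    proof
      fix u assume u: "u \<in> {1..n + 1}"
      show "u \<in> component ?K v"
      proof (cases "u = v")
        case False
        then have "{v, u} \<in> ?K" unfolding complete_graph_def doubleton_in_nsets_2 using u v by blast
        then show ?thesis unfolding component_def by blast
      qed simp
    qed
  qed
  then have "components (n + 1) ?K = (\<lambda>v. {1..n + 1}) ` {1..n + 1}"
    unfolding components_def by (intro image_cong) auto
  also have "\<dots> = {{1..n + 1}}" by force
  finally show ?thesis by (simp add: num_components_def)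
qed

lemma convex_tutte_polytope:
  assumes "0 < q" "t > 0"
  shows "convex (tutte_polytope n e q t)"
  unfolding convex_alt
proof (intro ballI allI impI)
  fix x y u assume x: "x \<in> tutte_polytope n e q t" and y: "y \<in> tutte_polytope n e q t"
    and u: "0 \<le> u \<and> u \<le> (1 :: real)"
  define w where "w = (1 - u) *\<^sub>R x + u *\<^sub>R y"
  have w: "z_coord e q w p = (1 - u) * z_coord e q x p + u * z_coord e q y p" for p
    by (simp add: w_def z_coord_def coord_def algebra_simps)
  have X: "tutte_seq n q t (z_coord e q x)" and Y: "tutte_seq n q t (z_coord e q y)"
    using x y by (simp_all add: tutte_polytope_iff)
  have "tutte_seq n q t (z_coord e q w)"
    unfolding tutte_seq_def
  proof (intro conjI allI impI)
    show "0 \<le> z_coord e q w n" using X Y u by (simp add: w tutte_seq_def)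
    fix l p assume lp: "l \<le> p \<and> p < n"
    let ?x = "z_coord e q x" and ?y = "z_coord e q y"
    have "(1 - u) * (q * ?x (Suc p)) \<le> (1 - u) * (q * (1 + t) * ?x p + t * (1 - q) * ?x l)"
      using X lp u by (intro mult_left_mono) (auto simp: tutte_seq_def)
    moreover have "u * (q * ?y (Suc p)) \<le> u * (q * (1 + t) * ?y p + t * (1 - q) * ?y l)"
      using Y lp u by (intro mult_left_mono) (auto simp: tutte_seq_def)
    moreover have "q * z_coord e q w (Suc p) = (1 - u) * (q * ?x (Suc p)) + u * (q * ?y (Suc p))"
      by (simp add: w algebra_simps)
    moreover have "q * (1 + t) * z_coord e q w p + t * (1 - q) * z_coord e q w l =
        (1 - u) * (q * (1 + t) * ?x p + t * (1 - q) * ?x l) + u * (q * (1 + t) * ?y p + t * (1 - q) * ?y l)"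
      unfolding w by (simp add: algebra_simps)
    ultimately show "q * z_coord e q w (Suc p) \<le> q * (1 + t) * z_coord e q w p + t * (1 - q) * z_coord e q w l"
      by linarith
  qed
  then show "(1 - u) *\<^sub>R x + u *\<^sub>R y \<in> tutte_polytope n e q t"
    by (simp add: tutte_polytope_iff w_def)
qed

text \<open>A convex union of finitely many polytopes is the convex hull of all their generating
  points. Applied to the simplices it shows that the Tutte polytope, convex by its inequalities, is
  bounded and finitely generated.\<close>

lemma polytope_of_simplices:
  fixes \<T> :: "'a::euclidean_space set set"
  assumes "finite \<T>" and "\<And>S. S \<in> \<T> \<Longrightarrow> int m simplex S" and "convex (\<Union>\<T>)"
  shows "polytope (\<Union>\<T>)"
proof -
  have "\<exists>C. finite C \<and> S = convex hull C" if "S \<in> \<T>" for S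
    using simplex_imp_polytope[OF assms(2)[OF that]] by (auto simp: polytope_def)
  then obtain C where C: "\<And>S. S \<in> \<T> \<Longrightarrow> finite (C S) \<and> S = convex hull C S" by metis
  have "\<Union>\<T> = convex hull (\<Union>S\<in>\<T>. C S)"
  proof
    show "\<Union>\<T> \<subseteq> convex hull (\<Union>S\<in>\<T>. C S)"
    proof
      fix x assume "x \<in> \<Union>\<T>"
      then obtain S where S: "S \<in> \<T>" "x \<in> S" by blast
      then have "x \<in> convex hull (C S)" using C by blast
      also have "\<dots> \<subseteq> convex hull (\<Union>S\<in>\<T>. C S)" using S by (intro hull_mono) blast
      finally show "x \<in> convex hull (\<Union>S\<in>\<T>. C S)" .
    qed
    show "convex hull (\<Union>S\<in>\<T>. C S) \<subseteq> \<Union>\<T>"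
    proof (rule hull_minimal)
      have "C S \<subseteq> S" if "S \<in> \<T>" for S using C[OF that] hull_subset[of "C S" convex] by simp
      then show "(\<Union>S\<in>\<T>. C S) \<subseteq> \<Union>\<T>" by blast
    qed (rule assms(3))
  qed
  moreover have "finite (\<Union>S\<in>\<T>. C S)" using assms(1) C by blast
  ultimately show ?thesis by (auto simp: polytope_def)
qed

lemma measure_lborel_simplex: "m simplex S \<Longrightarrow> measure lborel S = measure lebesgue S"
  using polytope_imp_compact[OF simplex_imp_polytope, of m S] by (simp add: borel_compact)

text \<open>Two simplices overlap in a convex set with empty interior, and such a set is
  negligible.\<close>

lemma measure_Union_triangulation:
  fixes \<T> :: "'a::euclidean_space set set"
  assumes "finite \<T>" and "\<And>S. S \<in> \<T> \<Longrightarrow> int m simplex S"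
    and "pairwise (\<lambda>S S'. interior S \<inter> interior S' = {}) \<T>"
  shows "measure lebesgue (\<Union>\<T>) = (\<Sum>S\<in>\<T>. measure lebesgue S)"
proof (rule measure_negligible_finite_Union)
  show "S \<in> lmeasurable" if "S \<in> \<T>" for S
    using polytope_imp_compact[OF simplex_imp_polytope[OF assms(2)[OF that]]] by (rule lmeasurable_compact)
  show "pairwise (\<lambda>S T. negligible (S \<inter> T)) \<T>"
  proof (rule pairwiseI)
    fix S T assume ST: "S \<in> \<T>" "T \<in> \<T>" "S \<noteq> T"
    then have "interior S \<inter> interior T = {}" using assms(3) by (simp add: pairwise_def)
    moreover have "convex (S \<inter> T)"
      using polytope_imp_convex[OF simplex_imp_polytope] assms(2) ST by (blast intro: convex_Int)
    ultimately show "negligible (S \<inter> T)" by (simp add: negligible_convex_interior)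
  qed
qed (rule assms(1))

theorem theorem7p1:
  fixes n :: nat and q t :: real and e :: "nat \<Rightarrow> 'n::finite"
  assumes "n \<ge> 1" and "0 < q" and "q \<le> 1" and "t > 0"
    and "bij_betw e {1..n} (UNIV :: 'n set)"
  shows "(\<forall>F\<in>labeled_forests (n + 1).
            int n simplex forest_simplex n e F q t \<and>
            fact n * measure lborel (forest_simplex n e F q t)
              = (\<Sum>G | G \<in> labeled_graphs (n + 1) \<and> search_forest (n + 1) G = F.
                   q ^ (num_components (n + 1) G - 1) * t ^ card G) \<and>
            (\<Sum>G | G \<in> labeled_graphs (n + 1) \<and> search_forest (n + 1) G = F.
                   q ^ (num_components (n + 1) G - 1) * t ^ card G)
              = q ^ (num_components (n + 1) F - 1) * t ^ card F * (1 + t) ^ num_cane_paths F) \<and>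
         inj_on (\<lambda>F. forest_simplex n e F q t) (labeled_forests (n + 1)) \<and>
         triangulates ((\<lambda>F. forest_simplex n e F q t) ` labeled_forests (n + 1))
           (tutte_polytope n e q t) \<and>
         fact n * measure lborel (tutte_polytope n e q t)
           = (\<Sum>G\<in>labeled_graphs (n + 1). q ^ (num_components (n + 1) G - 1) * t ^ card G) \<and>
         (\<Sum>G\<in>labeled_graphs (n + 1). q ^ (num_components (n + 1) G - 1) * t ^ card G)
           = Z_poly (n + 1) (complete_graph (n + 1)) q t"
proof -
  let ?N = "n + 1"
  let ?v = "nfs_label ?N" and ?h = "nfs_height ?N"
  let ?S = "\<lambda>F. forest_simplex n e F q t"
  let ?w = "\<lambda>G. q ^ (num_components ?N G - 1) * t ^ card G"
  have code: "nfs_coding n (?v F) (?h F)" for F by (rule nfs_coding_full_trace)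
  note ctx = assms(2-5) code
  have simplex: "int n simplex ?S F" if "F \<in> labeled_forests ?N" for F
    unfolding forest_simplex_eq[OF that] by (rule coding_simplex_simplex[OF ctx])
  have fiber: "(\<Sum>G | G \<in> labeled_graphs ?N \<and> search_forest ?N G = F. ?w G) =
      q ^ (num_components ?N F - 1) * t ^ card F * (1 + t) ^ num_cane_paths F"
    if "F \<in> labeled_forests ?N" for F
    by (rule search_forest_fiber_sum[OF that])
  have vol: "fact n * measure lebesgue (?S F) =
      (\<Sum>G | G \<in> labeled_graphs ?N \<and> search_forest ?N G = F. ?w G)"
    if "F \<in> labeled_forests ?N" for F
    unfolding fiber[OF that] forest_statistics[OF that] forest_simplex_eq[OF that]
    by (rule measure_coding_simplex[OF ctx])
  have disjoint: "F = F'"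
    if "F \<in> labeled_forests ?N" "F' \<in> labeled_forests ?N" "interior (?S F) \<inter> interior (?S F') \<noteq> {}" for F F'
  proof -
    from that(3) obtain x where "x \<in> interior (?S F)" "x \<in> interior (?S F')" by blast
    then have x: "x \<in> interior (coding_simplex n e (?v F) (?h F) q t)"
      "x \<in> interior (coding_simplex n e (?v F') (?h F') q t)"
      by (simp_all only: forest_simplex_eq that)
    have "?h F p = ?h F' p \<and> ?v F p = ?v F' p" if "p \<le> n" for p
      by (rule coding_determined[OF assms(2-4) code code _ _ _ _ that, where z = "z_coord e q x"])
        (use interior_coding_simplex[OF ctx x(1)] interior_coding_simplex[OF ctx x(2)] in blast)+
    then show ?thesis using forest_eqI[OF that(1,2)] by blast
  qed
  have inj: "inj_on ?S (labeled_forests ?N)"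
  proof (rule inj_onI)
    fix F F' assume F: "F \<in> labeled_forests ?N" "F' \<in> labeled_forests ?N" "?S F = ?S F'"
    \<comment> \<open>A simplex of positive volume has interior points, so two forests with the same
      simplex fall under \<open>disjoint\<close>.\<close>
    have "fact n * measure lebesgue (?S F) > 0"
      unfolding vol[OF F(1)] fiber[OF F(1)] using assms by simp
    then have "\<not> negligible (?S F)" by (auto simp: negligible_iff_measure)
    then have "interior (?S F) \<noteq> {}"
      using negligible_convex_interior[OF polytope_imp_convex[OF simplex_imp_polytope[OF simplex[OF F(1)]]]] by blast
    then show "F = F'" using disjoint[OF F(1,2)] F(3) by simp
  qed
  have union: "\<Union>(?S ` labeled_forests ?N) = tutte_polytope n e q t"
  proof (intro subset_antisym subsetI)
    fix x assume "x \<in> \<Union>(?S ` labeled_forests ?N)"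
    then obtain F where "F \<in> labeled_forests ?N" "x \<in> ?S F" by blast
    then have x: "x \<in> coding_simplex n e (?v F) (?h F) q t" by (simp only: forest_simplex_eq)
    show "x \<in> tutte_polytope n e q t"
      unfolding tutte_polytope_iff
      by (rule tutte_seq_of_coding[OF assms(2-4) code]) (use x in \<open>auto simp: coding_simplex_def\<close>)
  next
    fix x assume "x \<in> tutte_polytope n e q t"
    then have T: "tutte_seq n q t (z_coord e q x)" by (simp only: tutte_polytope_iff)
    have z0: "z_coord e q x 0 = q" by (simp add: z_coord_def coord_def)
    obtain v h where vh: "nfs_coding n v h" "\<And>p. p \<le> n \<Longrightarrow> 0 \<le> c_pos q t h (z_coord e q x) p"
      "\<And>p p'. p \<le> n \<Longrightarrow> p' \<le> n \<Longrightarrow> v p < v p' \<Longrightarrow>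
        c_pos q t h (z_coord e q x) p \<le> c_pos q t h (z_coord e q x) p'"
      by (rule coding_of_tutte_seq[OF assms(2-4) T z0]) (rule that)
    obtain F where F: "F \<in> labeled_forests ?N" "\<And>p. p \<le> n \<Longrightarrow> ?v F p = v p \<and> ?h F p = h p"
      using forest_of_coding[OF vh(1)] by blast
    \<comment> \<open>\<open>F\<close> has the given coding only at positions up to
      \<open>n\<close>, and \<open>c_pos\<close> at such a position looks at no later ones.\<close>
    have "c_pos q t (?h F) z p = c_pos q t h z p" if "p \<le> n" for p z
      using F(2) that by (intro c_pos_cong) auto
    then have "x \<in> coding_simplex n e (?v F) (?h F) q t"
      unfolding coding_simplex_def using vh(2,3) F(2) by simp
    then show "x \<in> \<Union>(?S ` labeled_forests ?N)" using F(1) forest_simplex_eq[OF F(1)] by blast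
  qed
  have pw: "pairwise (\<lambda>S S'. interior S \<inter> interior S' = {}) (?S ` labeled_forests ?N)"
    using disjoint unfolding pairwise_def by blast
  have fin: "finite (?S ` labeled_forests ?N)" using finite_labeled_forests by blast
  have simplices: "\<And>S. S \<in> ?S ` labeled_forests ?N \<Longrightarrow> int n simplex S" using simplex by blast
  have poly: "polytope (tutte_polytope n e q t)"
    unfolding union[symmetric]
  proof (rule polytope_of_simplices[OF fin])
    show "int n simplex S" if "S \<in> ?S ` labeled_forests ?N" for S by (rule simplices[OF that])
    show "convex (\<Union>(?S ` labeled_forests ?N))"
      unfolding union by (rule convex_tutte_polytope[OF assms(2,4)])
  qed
  have tri: "triangulates (?S ` labeled_forests ?N) (tutte_polytope n e q t)"
    unfolding triangulates_def using poly simplices union pw card_index[OF assms(2-5) code] by simp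
  have forest: "search_forest ?N G \<in> labeled_forests ?N" if "G \<in> labeled_graphs ?N" for G
    unfolding search_forest_eq[OF that] by (rule tforest_labeled_forest)
  have "fact n * measure lborel (tutte_polytope n e q t) = fact n * measure lebesgue (tutte_polytope n e q t)"
    using polytope_imp_compact[OF poly] by (simp add: borel_compact)
  also have "\<dots> = fact n * (\<Sum>S\<in>?S ` labeled_forests ?N. measure lebesgue S)"
    unfolding union[symmetric]
    by (rule arg_cong[OF measure_Union_triangulation[OF fin _ pw]]) (rule simplices)
  also have "\<dots> = (\<Sum>F\<in>labeled_forests ?N. fact n * measure lebesgue (?S F))"
    unfolding sum.reindex[OF inj] sum_distrib_left by (simp only: comp_def)
  also have "\<dots> = (\<Sum>F\<in>labeled_forests ?N. \<Sum>G | G \<in> labeled_graphs ?N \<and> search_forest ?N G = F. ?w G)"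
    using vol by (intro sum.cong) auto
  \<comment> \<open>The search forest of every graph is a labeled forest, so the fibres of \<Phi>
    partition the labeled graphs.\<close>
  also have "\<dots> = (\<Sum>G\<in>labeled_graphs ?N. ?w G)"
    using forest by (intro sum.group finite_labeled_graphs finite_labeled_forests) blast
  finally have total: "fact n * measure lborel (tutte_polytope n e q t) = (\<Sum>G\<in>labeled_graphs ?N. ?w G)" .
  have "(\<Sum>G\<in>labeled_graphs ?N. ?w G) = Z_poly ?N (complete_graph ?N) q t"
    unfolding Z_poly_def num_components_complete_graph labeled_graphs_def ..
  then show ?thesis
    using simplex vol fiber inj tri total measure_lborel_simplex[OF simplex] by auto
qed

end
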